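(* Let $(H,\sqsubseteq)$ be a definable bounded distributive lattice with $\dim H = 1$. Then the principal chain $C_H$ can be decomposed into the following data: - finitely many $\sqsubseteq$-cells (i.e. $\sqsubseteq$-intervals of $C_H$ and single points) $M_1,\dots,M_n$ partitioning $C_H$, - a definable function $t$ that assigns to each natural number $1\le i\le n$ a lexicographic fiber type $t_i$ of $H$, - a definable function $l$ that assigns to each pair of natural numbers $1\le i\le j\le n$ a lexicographic gluing type $l_{i,j}$, so that the following hold: 1. the $\sqsubseteq$-cells are linearly ordered: whenever $1\le i<j\le n$, we have $x\sqsubset y$ for all $x\in M_i$ and all $y\in M_j$; 2. $l_{i,i}\circ l_{i,i}=l_{i,i}$ for all $1\le i\le n$; 3. the lexicographic fiber type function is constant on each cell: every $x\in M_i$ has lexicographic fiber type $t_i$; 4. the cells determine the lexicographic gluing types: if $x\in M_i$, $y\in M_j$, $x\sqsubset y$ and $i\le j$, then the lexicographic gluing type $\ell_{x,y}$ over $(x,y)$ equals $l_{i,j}$.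
   Context: Fix an o-minimal structure $R$ expanding a real-closed field. "Definable" means definable in $R$ with parameters; a definable lattice is a lattice whose underlying set is a definable subset of some $R^d$ and whose order relation is definable; $\dim$ is o-minimal dimension. Let $(H,\sqsubseteq)$ be a definable bounded distributive lattice with $H\subseteq R^d$, $\dim H=1$; write $\sqcup,\sqcap$ for join and meet and $[a,b]_\sqsubseteq=\{z\in H : a\sqsubseteq z\sqsubseteq b\}$. Principal chain: $C_H=\{x\in H : \forall y\sqsubset x,\ \dim[y,x]_\sqsubseteq=1\}$. It is linearly ordered by $\sqsubseteq$. A $\sqsubseteq$-interval of $C_H$ is a set $\{z\in C_H: a\sqsubset z\sqsubset b\}$ where the endpoints $a\sqsubset b$ are allowed to lie in the definable completion of the linear order $(C_H,\sqsubseteq)$ (a definable linear order extending it in which every definable subset of $C_H$ has a least upper bound). Principal projection: for each $x\in H$ there is a unique $c_x\in C_H$ with $\dim[c_x,x]_\sqsubseteq=0$ and such that for all $c\in C_H$, $c\sqsubseteq x$ iff $c\sqsubseteq c_x$. The map $c_\bullet:H\to C_H$, $x\mapsto c_x$, is definable, and its fibers $H_x=c_\bullet^{-1}(x)$ ($x\in C_H$), called principal fibers, are finite with cardinalities bounded by a single $N\in\mathbb N$, which we fix. Lexicographic coordinates: for $1\le n\le N$, $f_n$ is the partial function $C_H\to H$ sending $x$ to the $n$-th smallest element of $H_x$ in the lexicographic order of $R^d$ (undefined if $H_x$ has fewer than $n$ elements). Lexicographic fiber type over $x\in C_H$: the $N\times N$ integer table whose $(i,j)$ entry is $k$ if $f_i(x),f_j(x),f_k(x)$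 are all defined and $f_i(x)\sqcup f_j(x)=f_k(x)$, and is $0$ otherwise (when one of the coordinates is undefined). Lexicographic gluing type $\ell_{x,y}$ over a pair $x\sqsubset y$ in $C_H$: the integer sequence of length $N$ whose $i$-th entry is $j$ if $f_i(x)$ is defined and $y\sqcup f_i(x)=f_j(y)$, and is $0$ if $f_i(x)$ is undefined. In general, lexicographic gluing types are regarded as sequences in $\{0,\dots,N\}^N$. Composition of gluing types: for $\ell,\ell'\in\{0,\dots,N\}^N$, $\ell'\circ\ell$ is the sequence whose $n$-th entry is $\ell'(\ell(n))$ if $\ell(n)>0$ and $\ell'(\ell(n))>0$, and $0$ otherwise. *)

theory Defs
  imports
    "HOL-Algebra.Lattice"
    "HOL-Library.Disjoint_Sets"
begin

section \<open>O-minimal expansions of real-closed fields\<close>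

class real_closed_field = linordered_field +
  assumes nonneg_imp_square: "0 \<le> a \<Longrightarrow> \<exists>b. b * b = a"
    and odd_degree_imp_root: "odd n \<Longrightarrow> c n \<noteq> 0 \<Longrightarrow> \<exists>x. (\<Sum>i\<le>n. c i * x ^ i) = 0"

text \<open>
  First-order formulas in the language of ordered rings extended by function symbols from
  \<open>'f\<close> and relation symbols from \<open>'r\<close>; bound variables are de Bruijn indices. Constants
  for 0, 1, etc. are not needed, because definability below allows parameters. A symbol may be
  applied to argument lists of any length; a symbol of fixed arity is interpreted trivially
  (by a constant, resp. by the empty relation) at all other lengths, which adds no definable sets.
\<close>

datatype 'f tm = Var nat | Add "'f tm" "'f tm" | Mul "'f tm" "'f tm" | App 'f "'f tm list"

datatype ('f, 'r) fm =
    Eq "'f tm" "'f tm"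
  | Less "'f tm" "'f tm"
  | Rel 'r "'f tm list"
  | Neg "('f, 'r) fm"
  | Conj "('f, 'r) fm" "('f, 'r) fm"
  | Ex "('f, 'r) fm"

record ('f, 'r, 'a) expansion =
  fn_interp :: "'f \<Rightarrow> 'a list \<Rightarrow> 'a"
  rel_interp :: "'r \<Rightarrow> 'a list \<Rightarrow> bool"

primrec tm_val ::
  "('f, 'r, 'a::linordered_field) expansion \<Rightarrow> (nat \<Rightarrow> 'a) \<Rightarrow> 'f tm \<Rightarrow> 'a" where
  "tm_val S e (Var n) = e n"
| "tm_val S e (Add s t) = tm_val S e s + tm_val S e t"
| "tm_val S e (Mul s t) = tm_val S e s * tm_val S e t"
| "tm_val S e (App f ts) = fn_interp S f (map (tm_val S e) ts)"

primrec sat ::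
  "('f, 'r, 'a::linordered_field) expansion \<Rightarrow> (nat \<Rightarrow> 'a) \<Rightarrow> ('f, 'r) fm \<Rightarrow> bool" where
  "sat S e (Eq s t) \<longleftrightarrow> tm_val S e s = tm_val S e t"
| "sat S e (Less s t) \<longleftrightarrow> tm_val S e s < tm_val S e t"
| "sat S e (Rel r ts) \<longleftrightarrow> rel_interp S r (map (tm_val S e) ts)"
| "sat S e (Neg \<phi>) \<longleftrightarrow> \<not> sat S e \<phi>"
| "sat S e (Conj \<phi> \<psi>) \<longleftrightarrow> sat S e \<phi> \<and> sat S e \<psi>"
| "sat S e (Ex \<phi>) \<longleftrightarrow> (\<exists>a. sat S (case_nat a e) \<phi>)"

text \<open>
  Points of \<open>R\<^sup>d\<close> are lists of length \<open>d\<close>. Variables \<open>0, ..., d - 1\<close> stand for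
  the coordinates of the point, all other free variables for the parameters (given by \<open>e\<close>).
\<close>

definition definable ::
  "('f, 'r, 'a::linordered_field) expansion \<Rightarrow> nat \<Rightarrow> 'a list set \<Rightarrow> bool" where
  "definable S d X \<longleftrightarrow>
     (\<exists>\<phi> e. X = {x. length x = d \<and> sat S (\<lambda>i. if i < d then x ! i else e i) \<phi>})"

definition o_minimal :: "('f, 'r, 'a::linordered_field) expansion \<Rightarrow> bool" where
  "o_minimal S \<longleftrightarrow>
     (\<forall>X. definable S 1 X \<longrightarrow>
        (\<exists>\<I>. finite \<I> \<and> {a. [a] \<in> X} = \<Union>\<I> \<and>
           (\<forall>I\<in>\<I>. (\<exists>a. I = {a}) \<or> (\<exists>a b. I = {a<..<b}) \<or>
                    (\<exists>a. I = {a<..}) \<or> (\<exists>b. I = {..<b}) \<or> I = UNIV)))"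

definition has_interior :: "nat \<Rightarrow> 'a::linordered_field list set \<Rightarrow> bool" where
  "has_interior k X \<longleftrightarrow>
     (\<exists>a b. length a = k \<and> length b = k \<and> (\<forall>i<k. a ! i < b ! i) \<and>
        {x. length x = k \<and> (\<forall>i<k. a ! i < x ! i \<and> x ! i < b ! i)} \<subseteq> X)"

text \<open>
  O-minimal dimension of \<open>X \<subseteq> R\<^sup>d\<close>: the largest \<open>k\<close> such that the image of \<open>X\<close> under some
  projection onto \<open>k\<close> of the coordinates has non-empty interior in \<open>R\<^sup>k\<close>
  (\<open>R\<^sup>0\<close> is an open point, so \<open>k = 0\<close> always qualifies if \<open>X\<close> is non-empty).
  \<open>None\<close> encodes the dimension \<open>-\<infinity>\<close> of the empty set.
\<close>

definition omin_dim :: "nat \<Rightarrow> 'a::linordered_field list set \<Rightarrow> nat option" where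
  "omin_dim d X =
     (if X = {} then None
      else Some (Max {card I |I. I \<subseteq> {..<d} \<and> has_interior (card I) ((\<lambda>x. nths x I) ` X)}))"


section \<open>Definable orders and lattices\<close>

definition definable_order ::
  "('f, 'r, 'a::linordered_field) expansion \<Rightarrow> nat \<Rightarrow> 'a list gorder \<Rightarrow> bool" where
  "definable_order S d L \<longleftrightarrow>
     definable S d (carrier L) \<and>
     definable S (d + d) {x @ y |x y. x \<in> carrier L \<and> y \<in> carrier L \<and> x \<sqsubseteq>\<^bsub>L\<^esub> y}"

definition distributive :: "'b gorder \<Rightarrow> bool" where
  "distributive L \<longleftrightarrow>
     (\<forall>x\<in>carrier L. \<forall>y\<in>carrier L. \<forall>z\<in>carrier L.
        x \<sqinter>\<^bsub>L\<^esub> (y \<squnion>\<^bsub>L\<^esub> z) = (x \<sqinter>\<^bsub>L\<^esub> y) \<squnion>\<^bsub>L\<^esub> (x \<sqinter>\<^bsub>L\<^esub> z))"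

definition definable_bounded_distrib_lattice ::
  "('f, 'r, 'a::linordered_field) expansion \<Rightarrow> nat \<Rightarrow> 'a list gorder \<Rightarrow> bool" where
  "definable_bounded_distrib_lattice S d L \<longleftrightarrow>
     bounded_lattice L \<and> distributive L \<and> definable_order S d L"

definition principal_chain :: "nat \<Rightarrow> 'a::linordered_field list gorder \<Rightarrow> 'a list set" where
  "principal_chain d L =
     {x \<in> carrier L. \<forall>y\<in>carrier L. y \<sqsubset>\<^bsub>L\<^esub> x \<longrightarrow> omin_dim d \<lbrace>y..x\<rbrace>\<^bsub>L\<^esub> = Some 1}"

definition principal_proj ::
  "nat \<Rightarrow> 'a::linordered_field list gorder \<Rightarrow> 'a list \<Rightarrow> 'a list" where
  "principal_proj d L x =
     (THE c. c \<in> principal_chain d L \<and> omin_dim d \<lbrace>c..x\<rbrace>\<^bsub>L\<^esub> = Some 0 \<and>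
        (\<forall>c'\<in>principal_chain d L. c' \<sqsubseteq>\<^bsub>L\<^esub> x \<longleftrightarrow> c' \<sqsubseteq>\<^bsub>L\<^esub> c))"

definition principal_fiber ::
  "nat \<Rightarrow> 'a::linordered_field list gorder \<Rightarrow> 'a list \<Rightarrow> 'a list set" where
  "principal_fiber d L x = {z \<in> carrier L. principal_proj d L z = x}"

text \<open>
  A definable completion \<open>D\<close> of the chain \<open>C \<subseteq> R\<^sup>d\<close> with the order of \<open>L\<close>. It may live in
  another power \<open>R\<^sup>m\<close>, so "extending" means that \<open>C\<close> is definably order-embedded by \<open>\<iota>\<close>.
\<close>

definition definable_completion ::
  "('f, 'r, 'a::linordered_field) expansion \<Rightarrow> nat \<Rightarrow> 'a list gorder \<Rightarrow> 'a list set \<Rightarrow>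
   nat \<Rightarrow> 'a list gorder \<Rightarrow> ('a list \<Rightarrow> 'a list) \<Rightarrow> bool" where
  "definable_completion S d L C m D \<iota> \<longleftrightarrow>
     total_order D \<and> definable_order S m D \<and>
     \<iota> ` C \<subseteq> carrier D \<and> definable S (d + m) {x @ \<iota> x |x. x \<in> C} \<and>
     (\<forall>x\<in>C. \<forall>y\<in>C. \<iota> x \<sqsubseteq>\<^bsub>D\<^esub> \<iota> y \<longleftrightarrow> x \<sqsubseteq>\<^bsub>L\<^esub> y) \<and>
     (\<forall>A. definable S d A \<and> A \<subseteq> C \<longrightarrow> (\<exists>s. least D s (Upper D (\<iota> ` A))))"

definition chain_interval ::
  "'a list set \<Rightarrow> 'a list gorder \<Rightarrow> ('a list \<Rightarrow> 'a list) \<Rightarrow> 'a list set \<Rightarrow> bool" where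
  "chain_interval C D \<iota> M \<longleftrightarrow>
     (\<exists>a\<in>carrier D. \<exists>b\<in>carrier D. a \<sqsubset>\<^bsub>D\<^esub> b \<and> M = {z \<in> C. a \<sqsubset>\<^bsub>D\<^esub> \<iota> z \<and> \<iota> z \<sqsubset>\<^bsub>D\<^esub> b})"

definition chain_cell ::
  "'a list set \<Rightarrow> 'a list gorder \<Rightarrow> ('a list \<Rightarrow> 'a list) \<Rightarrow> 'a list set \<Rightarrow> bool" where
  "chain_cell C D \<iota> M \<longleftrightarrow> (\<exists>x\<in>C. M = {x}) \<or> chain_interval C D \<iota> M"


section \<open>Lexicographic coordinates and types\<close>

abbreviation lex_less :: "'a::linorder list \<Rightarrow> 'a list \<Rightarrow> bool" where
  "lex_less u v \<equiv> (u, v) \<in> lexord {(a, b). a < b}"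

text \<open>The \<open>n\<close>-th smallest element of the (finite) fiber, counting from \<open>n = 1\<close>.\<close>

definition lex_coord ::
  "nat \<Rightarrow> 'a::linordered_field list gorder \<Rightarrow> nat \<Rightarrow> 'a list \<Rightarrow> 'a list option" where
  "lex_coord d L n x =
     (if 1 \<le> n \<and> n \<le> card (principal_fiber d L x)
      then Some (THE z. z \<in> principal_fiber d L x \<and>
                   card {w \<in> principal_fiber d L x. lex_less w z} = n - 1)
      else None)"

text \<open>
  Tables are lists of rows and sequences are lists; their indices are \<open>1, ..., N\<close> as in
  \<open>[1..<Suc N]\<close>, so that the entry 0 is free to mean "undefined".
\<close>

definition lex_fiber_type ::
  "nat \<Rightarrow> 'a::linordered_field list gorder \<Rightarrow> nat \<Rightarrow> 'a list \<Rightarrow> nat list list" where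
  "lex_fiber_type d L N x =
     (let P = (\<lambda>i j k. k \<in> {1..N} \<and>
                 (\<exists>u v w. lex_coord d L i x = Some u \<and> lex_coord d L j x = Some v \<and>
                    lex_coord d L k x = Some w \<and> u \<squnion>\<^bsub>L\<^esub> v = w))
      in map (\<lambda>i. map (\<lambda>j. if \<exists>k. P i j k then THE k. P i j k else 0) [1..<Suc N]) [1..<Suc N])"

definition lex_gluing_type ::
  "nat \<Rightarrow> 'a::linordered_field list gorder \<Rightarrow> nat \<Rightarrow> 'a list \<Rightarrow> 'a list \<Rightarrow> nat list" where
  "lex_gluing_type d L N x y =
     map (\<lambda>i. case lex_coord d L i x of
                None \<Rightarrow> 0
              | Some u \<Rightarrow> (THE j. j \<in> {1..N} \<and> lex_coord d L j y = Some (y \<squnion>\<^bsub>L\<^esub> u)))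
       [1..<Suc N]"

definition gluing_seqs :: "nat \<Rightarrow> nat list set" where
  "gluing_seqs N = {\<l>. length \<l> = N \<and> set \<l> \<subseteq> {0..N}}"

definition seq_entry :: "nat list \<Rightarrow> nat \<Rightarrow> nat" where
  "seq_entry \<l> n = \<l> ! (n - 1)"

definition gluing_comp :: "nat list \<Rightarrow> nat list \<Rightarrow> nat list" where
  "gluing_comp \<l>' \<l> =
     map (\<lambda>n. if seq_entry \<l> n > 0 \<and> seq_entry \<l>' (seq_entry \<l> n) > 0
               then seq_entry \<l>' (seq_entry \<l> n) else 0)
       [1..<Suc (length \<l>)]"

text \<open>
  Definability of the data \<open>t\<close> and \<open>l\<close>: their graphs are subsets of a power of \<open>R\<close> when
  natural numbers are read as elements of \<open>R\<close> and tables are flattened.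
\<close>

definition definable_table_fun ::
  "('f, 'r, 'a::linordered_field) expansion \<Rightarrow> nat \<Rightarrow> nat \<Rightarrow> (nat \<Rightarrow> nat list list) \<Rightarrow> bool" where
  "definable_table_fun S N n t \<longleftrightarrow>
     definable S (1 + N * N) {of_nat i # map of_nat (concat (t i)) |i. 1 \<le> i \<and> i \<le> n}"

definition definable_seq_fun ::
  "('f, 'r, 'a::linordered_field) expansion \<Rightarrow> nat \<Rightarrow> nat \<Rightarrow> (nat \<Rightarrow> nat \<Rightarrow> nat list) \<Rightarrow> bool" where
  "definable_seq_fun S N n l \<longleftrightarrow>
     definable S (2 + N)
       {of_nat i # of_nat j # map of_nat (l i j) |i j. 1 \<le> i \<and> i \<le> j \<and> j \<le> n}"

end

theory Submission
  imports Defs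
begin

text \<open>
  Everything rests on two consequences of o-minimality. A definable subset of \<open>R\<^sup>2\<close> with
  infinitely many infinite fibers contains a box; hence a definable family, with infinite index set,
  of infinite subsets of a one-dimensional set has infinitely many members through a common point
  (the overlap principle).

  By the overlap principle incomparable elements cannot occur in the principal chain, principal
  projections exist, every infinite definable subset of the chain contains an infinite segment, and a
  definable equivalence relation on the chain with convex classes has only finitely many infinite
  classes (their suprema in the completion index a disjoint family). Gluing types are additive:
  \<open>\<ell>\<^bsub>x,z\<^esub> = \<ell>\<^bsub>y,z\<^esub> \<circ> \<ell>\<^bsub>x,y\<^esub>\<close>. So calling two points equivalent when the fiber type, the
  right germ of the gluing type and the gluing type itself are constant between them gives a
  convex equivalence relation; the overlap principle shows that it has finitely many classes, and
  additivity makes the gluing type between two endpointless classes constant.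
\<close>

section \<open>Definable predicates\<close>

text \<open>The box statement does the work of cell decomposition and of the monotonicity theorem.
  It needs only that infinite definable subsets of the line contain intervals and that bounded ones
  have suprema: an interval inside each fiber is described by its center and its inverse radius, and
  infima of such data are made to accumulate. The chain is not parametrised by an interval of the
  field, so finiteness statements about it are obtained by counting overlaps.

  The delicate point is transitivity of the final equivalence relation. If the gluing type is
  constantly \<open>e\<close> between \<open>x\<close> and \<open>y\<close> and constantly
  \<open>e'\<close> between \<open>y\<close> and \<open>z\<close>, nothing so far relates
  \<open>e\<close> to \<open>e'\<close>. The right germ of the gluing type is an invariant of a
  single point, so requiring it to be constant as well forces \<open>e = e'\<close> at the common
  point \<open>y\<close>. Density then provides an intermediate point, additivity gives that
  \<open>e\<close> composed with itself is \<open>e\<close>, and pairs straddling \<open>y\<close>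
  receive \<open>e\<close> too. The same idempotence is the condition on \<open>l i i\<close>. The
  completion enters because a convex class may have no supremum in the chain itself.\<close>

primrec rename_tm :: "(nat \<Rightarrow> nat) \<Rightarrow> 'f tm \<Rightarrow> 'f tm" where
  "rename_tm \<rho> (Var n) = Var (\<rho> n)"
| "rename_tm \<rho> (Add s t) = Add (rename_tm \<rho> s) (rename_tm \<rho> t)"
| "rename_tm \<rho> (Mul s t) = Mul (rename_tm \<rho> s) (rename_tm \<rho> t)"
| "rename_tm \<rho> (App f ts) = App f (map (rename_tm \<rho>) ts)"

primrec rename_fm :: "(nat \<Rightarrow> nat) \<Rightarrow> ('f, 'r) fm \<Rightarrow> ('f, 'r) fm" where
  "rename_fm \<rho> (Eq s t) = Eq (rename_tm \<rho> s) (rename_tm \<rho> t)"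
| "rename_fm \<rho> (Less s t) = Less (rename_tm \<rho> s) (rename_tm \<rho> t)"
| "rename_fm \<rho> (Rel r ts) = Rel r (map (rename_tm \<rho>) ts)"
| "rename_fm \<rho> (Neg \<phi>) = Neg (rename_fm \<rho> \<phi>)"
| "rename_fm \<rho> (Conj \<phi> \<psi>) = Conj (rename_fm \<rho> \<phi>) (rename_fm \<rho> \<psi>)"
| "rename_fm \<rho> (Ex \<phi>) = Ex (rename_fm (case_nat 0 (\<lambda>n. Suc (\<rho> n))) \<phi>)"

lemma tm_val_rename [simp]: "tm_val S e (rename_tm \<rho> t) = tm_val S (\<lambda>n. e (\<rho> n)) t"
proof (induction t)
  case (App f ts)
  then have "map (\<lambda>t. tm_val S e (rename_tm \<rho> t)) ts = map (tm_val S (\<lambda>n. e (\<rho> n))) ts"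
    by simp
  then show ?case by (simp only: rename_tm.simps tm_val.simps list.map_comp comp_def)
qed auto

lemma sat_rename [simp]: "sat S e (rename_fm \<rho> \<phi>) = sat S (\<lambda>n. e (\<rho> n)) \<phi>"
proof (induction \<phi> arbitrary: e \<rho>)
  case (Ex \<phi>)
  have "(\<lambda>n. case_nat a e (case_nat 0 (\<lambda>n. Suc (\<rho> n)) n)) = case_nat a (\<lambda>n. e (\<rho> n))" for a
    by (auto split: nat.splits)
  then show ?case by (simp add: Ex)
qed (auto simp: comp_def)

text \<open>
  An assignment \<open>s\<close> sends each variable of a formula to a coordinate of the environment
  (\<open>Inl\<close>) or to a parameter (\<open>Inr\<close>).
\<close>

abbreviation assign :: "(nat \<Rightarrow> nat + 'a) \<Rightarrow> (nat \<Rightarrow> 'a) \<Rightarrow> nat \<Rightarrow> 'a" where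
  "assign s v n \<equiv> case_sum v (\<lambda>c. c) (s n)"

definition def_pred ::
  "('f, 'r, 'a::linordered_field) expansion \<Rightarrow> ((nat \<Rightarrow> 'a) \<Rightarrow> bool) \<Rightarrow> bool" where
  "def_pred S P \<longleftrightarrow> (\<exists>\<phi> s. \<forall>v. P v \<longleftrightarrow> sat S (assign s v) \<phi>)"

definition def_term ::
  "('f, 'r, 'a::linordered_field) expansion \<Rightarrow> ((nat \<Rightarrow> 'a) \<Rightarrow> 'a) \<Rightarrow> bool" where
  "def_term S f \<longleftrightarrow> (\<exists>t s. \<forall>v. f v = tm_val S (assign s v) t)"

text \<open>Compound terms are excluded so that substituting such a tuple into any predicate is a
  mere reassignment of variables.\<close>

definition def_list :: "nat \<Rightarrow> ((nat \<Rightarrow> 'a) \<Rightarrow> 'a list) \<Rightarrow> bool" where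
  "def_list d f \<longleftrightarrow> (\<exists>s. \<forall>v. f v = map (assign s v) [0..<d])"

text \<open>Interleaving: the even variables carry one assignment and the odd ones the other, so
  that two formulas with unrelated parameters can be combined after renaming.\<close>

lemma merge_assign:
  obtains s :: "nat \<Rightarrow> nat + 'a"
  where "\<And>v. (\<lambda>n. assign s v (2 * n)) = assign s1 v"
    "\<And>v. (\<lambda>n. assign s v (Suc (2 * n))) = assign s2 v"
proof
  let ?s = "\<lambda>n. if even n then s1 (n div 2) else s2 (n div 2)"
  show "(\<lambda>n. assign ?s v (2 * n)) = assign s1 v" for v by simp
  show "(\<lambda>n. assign ?s v (Suc (2 * n))) = assign s2 v" for v by simp
qed

section \<open>Closure of definable terms and predicates under the logical operations\<close>

lemma def_term_var: "def_term S (\<lambda>v. v i)"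
  unfolding def_term_def by (rule exI[of _ "Var 0"], rule exI[of _ "\<lambda>_. Inl i"]) simp

lemma def_term_const: "def_term S (\<lambda>v. c)"
  unfolding def_term_def by (rule exI[of _ "Var 0"], rule exI[of _ "\<lambda>_. Inr c"]) simp

lemma def_term_binary:
  assumes "def_term S f" "def_term S g"
  obtains s t1 t2 where "\<And>v. f v = tm_val S (assign s v) t1" "\<And>v. g v = tm_val S (assign s v) t2"
proof -
  obtain t1 s1 where f: "\<And>v. f v = tm_val S (assign s1 v) t1"
    using assms(1) unfolding def_term_def by blast
  obtain t2 s2 where g: "\<And>v. g v = tm_val S (assign s2 v) t2"
    using assms(2) unfolding def_term_def by blast
  obtain s where "\<And>v. (\<lambda>n. assign s v (2 * n)) = assign s1 v"
    "\<And>v. (\<lambda>n. assign s v (Suc (2 * n))) = assign s2 v"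
    using merge_assign[of s1 s2] by blast
  then show thesis
    using that[of s "rename_tm (\<lambda>n. 2 * n) t1" "rename_tm (\<lambda>n. Suc (2 * n)) t2"] f g by simp
qed

lemma def_term_add:
  assumes "def_term S f" "def_term S g"
  shows "def_term S (\<lambda>v. f v + g v)"
proof -
  obtain s t1 t2
    where "\<And>v. f v = tm_val S (assign s v) t1" "\<And>v. g v = tm_val S (assign s v) t2"
    using def_term_binary[OF assms] by blast
  then show ?thesis unfolding def_term_def by (intro exI[of _ "Add t1 t2"] exI[of _ s]) simp
qed

lemma def_term_mult:
  assumes "def_term S f" "def_term S g"
  shows "def_term S (\<lambda>v. f v * g v)"
proof -
  obtain s t1 t2
    where "\<And>v. f v = tm_val S (assign s v) t1" "\<And>v. g v = tm_val S (assign s v) t2"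
    using def_term_binary[OF assms] by blast
  then show ?thesis unfolding def_term_def by (intro exI[of _ "Mul t1 t2"] exI[of _ s]) simp
qed

lemma def_term_minus: "def_term S f \<Longrightarrow> def_term S g \<Longrightarrow> def_term S (\<lambda>v. f v - g v)"
  using def_term_add[OF _ def_term_mult[OF def_term_const[of S "-1"], of g], of f] by simp

lemma def_pred_eq:
  assumes "def_term S f" "def_term S g"
  shows "def_pred S (\<lambda>v. f v = g v)"
proof -
  obtain s t1 t2
    where "\<And>v. f v = tm_val S (assign s v) t1" "\<And>v. g v = tm_val S (assign s v) t2"
    using def_term_binary[OF assms] by blast
  then show ?thesis unfolding def_pred_def by (intro exI[of _ "Eq t1 t2"] exI[of _ s]) simp
qed

lemma def_pred_less:
  assumes "def_term S f" "def_term S g"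
  shows "def_pred S (\<lambda>v. f v < g v)"
proof -
  obtain s t1 t2
    where "\<And>v. f v = tm_val S (assign s v) t1" "\<And>v. g v = tm_val S (assign s v) t2"
    using def_term_binary[OF assms] by blast
  then show ?thesis unfolding def_pred_def by (intro exI[of _ "Less t1 t2"] exI[of _ s]) simp
qed

lemma def_pred_not:
  assumes "def_pred S P"
  shows "def_pred S (\<lambda>v. \<not> P v)"
proof -
  obtain \<phi> s where "\<And>v. P v = sat S (assign s v) \<phi>"
    using assms unfolding def_pred_def by blast
  then show ?thesis unfolding def_pred_def by (intro exI[of _ "Neg \<phi>"] exI[of _ s]) simp
qed

lemma def_pred_conj:
  assumes "def_pred S P" "def_pred S Q"
  shows "def_pred S (\<lambda>v. P v \<and> Q v)"
proof -
  obtain \<phi> s1 where P: "\<And>v. P v = sat S (assign s1 v) \<phi>"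
    using assms(1) unfolding def_pred_def by blast
  obtain \<psi> s2 where Q: "\<And>v. Q v = sat S (assign s2 v) \<psi>"
    using assms(2) unfolding def_pred_def by blast
  obtain s where "\<And>v. (\<lambda>n. assign s v (2 * n)) = assign s1 v"
    "\<And>v. (\<lambda>n. assign s v (Suc (2 * n))) = assign s2 v"
    using merge_assign[of s1 s2] by blast
  then show ?thesis
    unfolding def_pred_def
    by (intro exI[of _ "Conj (rename_fm (\<lambda>n. 2 * n) \<phi>) (rename_fm (\<lambda>n. Suc (2 * n)) \<psi>)"] exI[of _ s])
      (simp add: P Q)
qed

lemma def_pred_disj: "def_pred S P \<Longrightarrow> def_pred S Q \<Longrightarrow> def_pred S (\<lambda>v. P v \<or> Q v)"
  using def_pred_not[OF def_pred_conj[OF def_pred_not[of S P] def_pred_not[of S Q]]] by simp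

lemma def_pred_imp: "def_pred S P \<Longrightarrow> def_pred S Q \<Longrightarrow> def_pred S (\<lambda>v. P v \<longrightarrow> Q v)"
  unfolding imp_conv_disj by (intro def_pred_disj def_pred_not)

lemma def_pred_le: "def_term S f \<Longrightarrow> def_term S g \<Longrightarrow> def_pred S (\<lambda>v. f v \<le> g v)"
  using def_pred_not[OF def_pred_less[of S g f]] by (simp add: not_less)

lemma def_pred_const: "def_pred S (\<lambda>v. b)"
proof (cases b)
  case True
  then show ?thesis using def_pred_eq[OF def_term_var[of S 0] def_term_var[of S 0]] by simp
next
  case False
  then show ?thesis using def_pred_less[OF def_term_var[of S 0] def_term_var[of S 0]] by simp
qed

text \<open>
  Quantifier rules have the form of de Bruijn binders: the bound variable becomes coordinate 0 (for
  lists, the first \<open>d\<close> coordinates) and the free variables are shifted. As \<open>P\<close> is a higher-order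
  pattern, definability proofs are applications of \<open>intro\<close>.
\<close>

lemma def_pred_ex:
  assumes "def_pred S (\<lambda>v. P (v 0) (\<lambda>n. v (Suc n)))"
  shows "def_pred S (\<lambda>v. \<exists>a. P a v)"
proof -
  obtain \<phi> s where *: "\<And>v. P (v 0) (\<lambda>n. v (Suc n)) = sat S (assign s v) \<phi>"
    using assms unfolding def_pred_def by blast
  \<comment> \<open>A variable tied to coordinate 0 becomes the bound index 0; all others move up by
    one. The truncated \<open>k - 1\<close> in \<open>s'\<close> at \<open>k = 0\<close> is never
    read, because such variables have been redirected.\<close>
  define \<rho> where "\<rho> n = (if s n = Inl 0 then 0 else Suc n)" for n
  define s' where "s' n = map_sum (\<lambda>k. k - 1) (\<lambda>c. c) (s n)" for n
  have "assign s (case_nat a v) = (\<lambda>n. case_nat a (assign s' v) (\<rho> n))" for a v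
    unfolding \<rho>_def s'_def by (rule ext) (auto split: sum.splits nat.splits)
  moreover have "P a v = sat S (assign s (case_nat a v)) \<phi>" for a v
    using *[of "case_nat a v"] by simp
  ultimately have "(\<exists>a. P a v) = sat S (assign s' v) (Ex (rename_fm \<rho> \<phi>))" for v
    by simp
  then show ?thesis unfolding def_pred_def by blast
qed

lemma def_pred_all:
  assumes "def_pred S (\<lambda>v. P (v 0) (\<lambda>n. v (Suc n)))"
  shows "def_pred S (\<lambda>v. \<forall>a. P a v)"
  using def_pred_not[OF def_pred_ex[of S "\<lambda>a v. \<not> P a v", OF def_pred_not[OF assms]]] by simp

lemma def_pred_finite_bex:
  "finite I \<Longrightarrow> (\<And>i. i \<in> I \<Longrightarrow> def_pred S (P i)) \<Longrightarrow> def_pred S (\<lambda>v. \<exists>i\<in>I. P i v)"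
proof (induction I rule: finite_induct)
  case empty
  show ?case using def_pred_const[of S False] by simp
next
  case (insert i I)
  then show ?case using def_pred_disj[of S "P i" "\<lambda>v. \<exists>i\<in>I. P i v"] by simp
qed

lemma def_pred_finite_ball:
  "finite I \<Longrightarrow> (\<And>i. i \<in> I \<Longrightarrow> def_pred S (P i)) \<Longrightarrow> def_pred S (\<lambda>v. \<forall>i\<in>I. P i v)"
  using def_pred_not[OF def_pred_finite_bex[of I S "\<lambda>i v. \<not> P i v"]] def_pred_not by auto

lemma def_pred_bex_less:
  "(\<And>i. i < (d::nat) \<Longrightarrow> def_pred S (P i)) \<Longrightarrow> def_pred S (\<lambda>v. \<exists>i<d. P i v)"
  using def_pred_finite_bex[of "{..<d}" S P, OF finite_lessThan] by (simp add: Bex_def)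

lemma def_pred_ball_less:
  "(\<And>i. i < (d::nat) \<Longrightarrow> def_pred S (P i)) \<Longrightarrow> def_pred S (\<lambda>v. \<forall>i<d. P i v)"
  using def_pred_finite_ball[of "{..<d}" S P, OF finite_lessThan] by (simp add: Ball_def)

lemma def_pred_subst:
  assumes "def_pred S P"
  shows "def_pred S (\<lambda>v. P (assign \<sigma> v))"
proof -
  obtain \<phi> s where *: "\<And>v. P v = sat S (assign s v) \<phi>"
    using assms unfolding def_pred_def by blast
  have "assign s (assign \<sigma> v) = assign (\<lambda>n. case_sum \<sigma> Inr (s n)) v" for v
    by (rule ext) (auto split: sum.splits)
  then show ?thesis unfolding def_pred_def * by (intro exI[of _ \<phi>] exI[of _ "\<lambda>n. case_sum \<sigma> Inr (s n)"]) simp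
qed

section \<open>Tuples, relations between tuples, and definable sets\<close>

lemma def_list_vars: "def_list d (\<lambda>v. map (\<lambda>i. v (k i)) [0..<d])"
  unfolding def_list_def by (rule exI[of _ "\<lambda>i. Inl (k i)"]) simp

lemma def_list_block: "def_list d (\<lambda>v. map v [0..<d])"
  using def_list_vars[of d "\<lambda>i. i"] by simp

lemma def_list_const: "length c = d \<Longrightarrow> def_list d (\<lambda>v. c)"
  unfolding def_list_def by (rule exI[of _ "\<lambda>i. Inr (c ! i)"]) (auto intro: nth_equalityI)

lemma def_term_nth:
  assumes "def_list d f" "i < d"
  shows "def_term S (\<lambda>v. f v ! i)"
proof -
  obtain s where "\<And>v. f v = map (assign s v) [0..<d]"
    using assms(1) unfolding def_list_def by blast
  then show ?thesis
    unfolding def_term_def by (intro exI[of _ "Var i"] exI[of _ s]) (simp add: assms(2))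
qed

lemma def_list_length: "def_list d f \<Longrightarrow> length (f v) = d"
  unfolding def_list_def by auto

lemma def_pred_subst_list:
  assumes "def_pred S (\<lambda>v. P (map v [0..<d]))" "def_list d f"
  shows "def_pred S (\<lambda>v. P (f v))"
proof -
  obtain s where "\<And>v. f v = map (assign s v) [0..<d]"
    using assms(2) unfolding def_list_def by blast
  then show ?thesis using def_pred_subst[OF assms(1), of s] by simp
qed

text \<open>The two arguments occupy consecutive blocks of coordinates; \<open>def_rel_subst\<close>
  moves this normal form to any other tuples.\<close>

definition def_rel ::
  "('f, 'r, 'a::linordered_field) expansion \<Rightarrow> nat \<Rightarrow> nat \<Rightarrow> ('a list \<Rightarrow> 'a list \<Rightarrow> bool) \<Rightarrow> bool" where
  "def_rel S d e R \<longleftrightarrow>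
     def_pred S (\<lambda>v. R (map v [0..<d]) (map (\<lambda>n. v (n + d)) [0..<e]))"

lemma def_rel_subst:
  assumes "def_rel S d e R" "def_list d f" "def_list e g"
  shows "def_pred S (\<lambda>v. R (f v) (g v))"
proof -
  obtain s1 where f: "\<And>v. f v = map (assign s1 v) [0..<d]"
    using assms(2) unfolding def_list_def by blast
  obtain s2 where g: "\<And>v. g v = map (assign s2 v) [0..<e]"
    using assms(3) unfolding def_list_def by blast
  let ?s = "\<lambda>n. if n < d then s1 n else s2 (n - d)"
  have "map (assign ?s v) [0..<d] = f v" "map (\<lambda>n. assign ?s v (n + d)) [0..<e] = g v" for v
    unfolding f g by auto
  then show ?thesis
    using def_pred_subst[OF assms(1)[unfolded def_rel_def], of ?s] by simp
qed

lemma definable_imp_def_pred: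
  assumes "definable S d X"
  shows "def_pred S (\<lambda>v. map v [0..<d] \<in> X)"
proof -
  obtain \<phi> e where X: "X = {x. length x = d \<and> sat S (\<lambda>i. if i < d then x ! i else e i) \<phi>}"
    using assms unfolding definable_def by blast
  have "assign (\<lambda>n. if n < d then Inl n else Inr (e n)) v
      = (\<lambda>i. if i < d then map v [0..<d] ! i else e i)" for v
    by auto
  then show ?thesis
    unfolding def_pred_def X
    by (intro exI[of _ \<phi>] exI[of _ "\<lambda>n. if n < d then Inl n else Inr (e n)"]) simp
qed

lemma definable_length: "definable S d X \<Longrightarrow> x \<in> X \<Longrightarrow> length x = d"
  unfolding definable_def by auto

lemma def_pred_mem: "definable S d X \<Longrightarrow> def_list d f \<Longrightarrow> def_pred S (\<lambda>v. f v \<in> X)"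
  by (rule def_pred_subst_list[of S "\<lambda>x. x \<in> X"]) (rule definable_imp_def_pred)

lemma definableI:
  assumes "def_pred S (\<lambda>v. P (map v [0..<d]))"
  shows "definable S d {x. length x = d \<and> P x}"
proof -
  obtain \<phi> s where *: "\<And>v. P (map v [0..<d]) = sat S (assign s v) \<phi>"
    using assms unfolding def_pred_def by blast
  \<comment> \<open>Parameters move to the slots \<open>d + n\<close>. A coordinate outside the
    block receives the value 0, which is harmless because \<open>P\<close> sees only the first
    \<open>d\<close> coordinates.\<close>
  define \<rho> where "\<rho> n = (case s n of Inl k \<Rightarrow> if k < d then k else d + n | Inr c \<Rightarrow> d + n)" for n
  define e where "e n = assign s (\<lambda>_. 0) (n - d)" for n
  have "P x = sat S (\<lambda>i. if i < d then x ! i else e i) (rename_fm \<rho> \<phi>)" if "length x = d" for x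
  proof -
    let ?v = "\<lambda>i. if i < d then x ! i else 0"
    have "map ?v [0..<d] = x" using that by (auto intro: nth_equalityI)
    then have "P x = sat S (assign s ?v) \<phi>" using *[of ?v] by simp
    also have "assign s ?v = (\<lambda>n. (\<lambda>i. if i < d then x ! i else e i) (\<rho> n))"
      unfolding \<rho>_def e_def by (rule ext) (auto split: sum.splits)
    finally show ?thesis by simp
  qed
  then show ?thesis unfolding definable_def by blast
qed

lemma definable_subset:
  assumes "definable S d A" "def_pred S (\<lambda>v. P (map v [0..<d]))"
  shows "definable S d {x \<in> A. P x}"
proof -
  have "definable S d {x. length x = d \<and> x \<in> A \<and> P x}"
    by (rule definableI) (intro def_pred_conj definable_imp_def_pred assms)
  also have "{x. length x = d \<and> x \<in> A \<and> P x} = {x \<in> A. P x}"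
    using definable_length[OF assms(1)] by auto
  finally show ?thesis .
qed

lemma def_pred_ex_list:
  assumes "def_pred S (\<lambda>v. P (map v [0..<d]) (\<lambda>n. v (n + d)))"
  shows "def_pred S (\<lambda>v. \<exists>x. length x = d \<and> P x v)"
  using assms
proof (induction d arbitrary: P)
  case 0
  then show ?case by simp
next
  case (Suc d)
  \<comment> \<open>The entry is appended, not prepended: the inner block of \<open>d\<close> bound
    coordinates pushes the outer bound coordinate to position \<open>d\<close>, the last one of the
    tuple.\<close>
  have "def_pred S (\<lambda>v. \<exists>y. length y = d \<and> P (y @ [v 0]) (\<lambda>n. v (Suc n)))"
    by (rule Suc.IH) (use Suc.prems in simp)
  then have "def_pred S (\<lambda>v. \<exists>a y. length y = d \<and> P (y @ [a]) v)"
    by (rule def_pred_ex)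
  also have "(\<lambda>v. \<exists>a y. length y = d \<and> P (y @ [a]) v) = (\<lambda>v. \<exists>x. length x = Suc d \<and> P x v)"
    by (rule ext) (metis length_append_singleton length_Suc_conv_rev)
  finally show ?case .
qed

lemma def_pred_bex:
  assumes "definable S d A" "def_pred S (\<lambda>v. P (map v [0..<d]) (\<lambda>n. v (n + d)))"
  shows "def_pred S (\<lambda>v. \<exists>x\<in>A. P x v)"
proof -
  have "def_pred S (\<lambda>v. \<exists>x. length x = d \<and> x \<in> A \<and> P x v)"
    by (rule def_pred_ex_list) (intro def_pred_conj definable_imp_def_pred assms)
  also have "(\<lambda>v. \<exists>x. length x = d \<and> x \<in> A \<and> P x v) = (\<lambda>v. \<exists>x\<in>A. P x v)"
    using definable_length[OF assms(1)] by blast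
  finally show ?thesis .
qed

lemma def_pred_ball:
  assumes "definable S d A" "def_pred S (\<lambda>v. P (map v [0..<d]) (\<lambda>n. v (n + d)))"
  shows "def_pred S (\<lambda>v. \<forall>x\<in>A. P x v)"
  using def_pred_not[OF def_pred_bex[OF assms(1), of "\<lambda>x v. \<not> P x v", OF def_pred_not[OF assms(2)]]]
  by simp

lemma def_pred_list_eq:
  assumes "def_list d f" "def_list d g"
  shows "def_pred S (\<lambda>v. f v = g v)"
proof -
  have "def_pred S (\<lambda>v. \<forall>i<d. f v ! i = g v ! i)"
    by (intro def_pred_ball_less def_pred_eq def_term_nth[OF assms(1)] def_term_nth[OF assms(2)])
  also have "(\<lambda>v. \<forall>i<d. f v ! i = g v ! i) = (\<lambda>v. f v = g v)"
    using assms by (auto simp: list_eq_iff_nth_eq def_list_length)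
  finally show ?thesis .
qed

lemma finite_imp_definable:
  assumes "finite F" "\<And>x. x \<in> F \<Longrightarrow> length x = d"
  shows "definable S d F"
proof -
  have "definable S d {x. length x = d \<and> (\<exists>c\<in>F. x = c)}"
    by (rule definableI)
      (intro def_pred_finite_bex assms(1) def_pred_list_eq[where d = d] def_list_block
        def_list_const assms(2))
  also have "{x. length x = d \<and> (\<exists>c\<in>F. x = c)} = F" using assms(2) by auto
  finally show ?thesis .
qed

text \<open>Only finitely many sets of true indices are possible, so the condition is a finite
  disjunction over \<open>Pow I\<close>. Fiber types and gluing types are shown definable by writing
  them as such a function \<open>G\<close>.\<close>

lemma def_pred_finite_valued:
  assumes "finite I" "\<And>i. i \<in> I \<Longrightarrow> def_pred S (P i)"
  shows "def_pred S (\<lambda>v. G {i \<in> I. P i v} = k)"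
proof -
  have "def_pred S (\<lambda>v. \<exists>J\<in>Pow I. G J = k \<and> (\<forall>i\<in>I. P i v \<longleftrightarrow> i \<in> J))"
  proof (intro def_pred_finite_bex def_pred_conj def_pred_const)
    fix J
    have "def_pred S (\<lambda>v. P i v = (i \<in> J))" if "i \<in> I" for i
      using assms(2)[OF that] def_pred_not by (cases "i \<in> J") simp_all
    then show "def_pred S (\<lambda>v. \<forall>i\<in>I. P i v \<longleftrightarrow> i \<in> J)"
      by (intro def_pred_finite_ball assms(1))
  qed (use assms(1) in simp)
  also have "(\<lambda>v. \<exists>J\<in>Pow I. G J = k \<and> (\<forall>i\<in>I. P i v \<longleftrightarrow> i \<in> J)) = (\<lambda>v. G {i \<in> I. P i v} = k)"
  proof (rule ext)
    fix v
    have "{i \<in> I. P i v} = J" if "J \<in> Pow I" "\<forall>i\<in>I. P i v \<longleftrightarrow> i \<in> J" for J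
      using that by auto
    then show "(\<exists>J\<in>Pow I. G J = k \<and> (\<forall>i\<in>I. P i v \<longleftrightarrow> i \<in> J)) = (G {i \<in> I. P i v} = k)"
      by (auto intro!: exI[of _ "{i \<in> I. P i v}"])
  qed
  finally show ?thesis .
qed

section \<open>O-minimality in one variable\<close>

text \<open>A coordinate or a parameter only: these are the arguments that can be substituted into a
  predicate known merely to be definable.\<close>

definition def_var :: "((nat \<Rightarrow> 'a) \<Rightarrow> 'a) \<Rightarrow> bool" where
  "def_var f \<longleftrightarrow> (\<exists>s. \<forall>v. f v = case_sum v (\<lambda>c. c) s)"

lemma def_var_var: "def_var (\<lambda>v. v i)"
  unfolding def_var_def by (rule exI[of _ "Inl i"]) simp

lemma def_var_const: "def_var (\<lambda>v. c)"
  unfolding def_var_def by (rule exI[of _ "Inr c"]) simp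

lemma def_pred_subst_var:
  assumes "def_pred S (\<lambda>v. P (v 0))" "def_var f"
  shows "def_pred S (\<lambda>v. P (f v))"
proof -
  obtain s where "\<And>v. f v = case_sum v (\<lambda>c. c) s" using assms(2) unfolding def_var_def by blast
  then show ?thesis using def_pred_subst[OF assms(1), of "\<lambda>_. s"] by simp
qed

lemma def_pred_subst_var2:
  assumes "def_pred S (\<lambda>v. X (v 0) (v (Suc 0)))" "def_var f" "def_var g"
  shows "def_pred S (\<lambda>v. X (f v) (g v))"
proof -
  obtain s where f: "\<And>v. f v = case_sum v (\<lambda>c. c) s" using assms(2) unfolding def_var_def by blast
  obtain t where g: "\<And>v. g v = case_sum v (\<lambda>c. c) t" using assms(3) unfolding def_var_def by blast
  show ?thesis
    using def_pred_subst[OF assms(1), of "\<lambda>n. if n = 0 then s else t"] by (simp add: f g)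
qed

lemmas def_rules =
  def_pred_all def_pred_ex def_pred_conj def_pred_disj def_pred_imp def_pred_not
  def_pred_less def_pred_le def_pred_eq
  def_term_add def_term_mult def_term_minus def_term_var def_term_const def_var_var def_var_const

section \<open>Finite unions of points and open intervals\<close>

definition basic_set :: "'a::linorder set \<Rightarrow> bool" where
  "basic_set I \<longleftrightarrow> (\<exists>a. I = {a}) \<or> (\<exists>a b. I = {a<..<b}) \<or>
     (\<exists>a. I = {a<..}) \<or> (\<exists>b. I = {..<b}) \<or> I = UNIV"

lemma basic_set_cases:
  assumes "basic_set I"
  obtains a where "I = {a}" | a b where "I = {a<..<b}" | a where "I = {a<..}"
    | b where "I = {..<b}" | "I = UNIV"
  using assms unfolding basic_set_def by blast

text \<open>The field need not be order complete, but the endpoints of the pieces are elements of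
  the field. Pieces unbounded above are ruled out by \<open>u\<close>.\<close>

lemma basic_sets_lub:
  fixes \<I> :: "'a::linordered_field set set"
  assumes "finite \<I>" "\<And>I. I \<in> \<I> \<Longrightarrow> basic_set I" "\<Union>\<I> \<noteq> {}" "\<And>a. a \<in> \<Union>\<I> \<Longrightarrow> a \<le> u"
  shows "\<exists>s. (\<forall>a\<in>\<Union>\<I>. a \<le> s) \<and> (\<forall>u. (\<forall>a\<in>\<Union>\<I>. a \<le> u) \<longrightarrow> s \<le> u)"
  using assms
proof (induction \<I> rule: finite_induct)
  case empty
  then show ?case by simp
next
  case (insert I \<I>)
  have I: "\<exists>s. (\<forall>a\<in>I. a \<le> s) \<and> (\<forall>u. (\<forall>a\<in>I. a \<le> u) \<longrightarrow> s \<le> u)" if "I \<noteq> {}"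
  proof -
    have bd: "a \<le> u" if "a \<in> I" for a using insert.prems(3) that by blast
    have "basic_set I" using insert.prems(1) by simp
    then show ?thesis
    proof (cases rule: basic_set_cases)
      case (1 a)
      then show ?thesis by (intro exI[of _ a]) auto
    next
      case (2 a b)
      then have ab: "a < b" using that by auto
      have "b \<le> w" if "\<forall>x\<in>I. x \<le> w" for w
        by (rule dense_le_bounded[OF ab]) (metis 2 that greaterThanLessThan_iff)
      then show ?thesis using 2 by (intro exI[of _ b]) (metis greaterThanLessThan_iff order_less_imp_le)
    next
      case (3 a)
      have "a \<le> max a u" "u \<le> max a u" "max a u < max a u + 1" by simp_all
      then have "max a u + 1 \<in> I" "\<not> max a u + 1 \<le> u" using 3 by auto
      then show ?thesis using bd by blast
    next
      case (4 b)
      then have "b \<le> w" if "\<forall>x\<in>I. x \<le> w" for w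
        using that dense_le[of b w] by auto
      then show ?thesis using 4 by (intro exI[of _ b]) auto
    next
      case 5
      then have "u + 1 \<le> u" using bd by blast
      then show ?thesis by simp
    qed
  qed
  show ?case
  proof (cases "I = {} \<or> \<Union>\<I> = {}")
    case True
    then show ?thesis
    proof
      assume "I = {}"
      then show ?thesis using insert by auto
    next
      assume e: "\<Union>\<I> = {}"
      then have "I \<noteq> {}" using insert.prems(2) by simp
      moreover have "\<Union>(insert I \<I>) = I" using e by auto
      ultimately show ?thesis using I by (simp only: simp_thms)
    qed
  next
    case False
    then obtain s where s: "\<forall>a\<in>I. a \<le> s" "\<forall>u. (\<forall>a\<in>I. a \<le> u) \<longrightarrow> s \<le> u" using I by blast
    have "\<exists>s. (\<forall>a\<in>\<Union>\<I>. a \<le> s) \<and> (\<forall>u. (\<forall>a\<in>\<Union>\<I>. a \<le> u) \<longrightarrow> s \<le> u)"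
      by (rule insert.IH) (use insert.prems False in auto)
    then obtain t where t: "\<forall>a\<in>\<Union>\<I>. a \<le> t" "\<forall>u. (\<forall>a\<in>\<Union>\<I>. a \<le> u) \<longrightarrow> t \<le> u" by blast
    have "\<forall>a\<in>\<Union>(insert I \<I>). a \<le> max s t"
      using s(1) t(1) by (auto simp: le_max_iff_disj)
    moreover have "max s t \<le> u" if "\<forall>a\<in>\<Union>(insert I \<I>). a \<le> u" for u
      using s(2) t(2) that by auto
    ultimately show ?thesis by blast
  qed
qed

text \<open>Each single piece contains or misses a short interval to the right of \<open>x\<close>;
  the minimum of the two witnesses serves for the union.\<close>

lemma basic_sets_right_germ:
  fixes \<I> :: "'a::linordered_field set set"
  assumes "finite \<I>" "\<And>I. I \<in> \<I> \<Longrightarrow> basic_set I"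
  shows "\<exists>z>x. {x<..<z} \<subseteq> \<Union>\<I> \<or> {x<..<z} \<inter> \<Union>\<I> = {}"
  using assms
proof (induction \<I> rule: finite_induct)
  case empty
  then show ?case by (intro exI[of _ "x + 1"]) simp
next
  case (insert I \<I>)
  have "\<exists>z>x. {x<..<z} \<subseteq> \<Union>\<I> \<or> {x<..<z} \<inter> \<Union>\<I> = {}"
    by (rule insert.IH) (use insert.prems in auto)
  then obtain z where z: "z > x" "{x<..<z} \<subseteq> \<Union>\<I> \<or> {x<..<z} \<inter> \<Union>\<I> = {}" by blast
  have "\<exists>w>x. {x<..<w} \<subseteq> I \<or> {x<..<w} \<inter> I = {}"
  proof -
    have "basic_set I" using insert.prems by simp
    then show ?thesis
    proof (cases rule: basic_set_cases)
      case (1 a)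
      then show ?thesis
        by (intro exI[of _ "if x < a then a else x + 1"]) auto
    next
      case (2 a b)
      then show ?thesis
        by (intro exI[of _ "if x < a then a else if x < b then b else x + 1"]) auto
    next
      case (3 a)
      then show ?thesis
        by (intro exI[of _ "if x < a then a else x + 1"]) auto
    next
      case (4 b)
      then show ?thesis
        by (intro exI[of _ "if x < b then b else x + 1"]) auto
    next
      case 5
      then show ?thesis by (intro exI[of _ "x + 1"]) auto
    qed
  qed
  then obtain w where w: "w > x" "{x<..<w} \<subseteq> I \<or> {x<..<w} \<inter> I = {}" by blast
  have "min z w > x" using z w by simp
  moreover have "{x<..<min z w} \<subseteq> {x<..<z}" "{x<..<min z w} \<subseteq> {x<..<w}" by auto
  then have "{x<..<min z w} \<subseteq> \<Union>(insert I \<I>) \<or> {x<..<min z w} \<inter> \<Union>(insert I \<I>) = {}"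
    using z(2) w(2) by (simp add: Int_Un_distrib) blast
  ultimately show ?case by blast
qed

section \<open>Consequences of o-minimality on the line and in the plane\<close>

locale o_minimal_structure =
  fixes S :: "('f, 'r, 'a::linordered_field) expansion"
  assumes o_minimal: "o_minimal S"
begin

lemma basic_decomposition:
  assumes "def_pred S (\<lambda>v. P (v 0))"
  obtains \<I> where "finite \<I>" "{a. P a} = \<Union>\<I>" "\<And>I. I \<in> \<I> \<Longrightarrow> basic_set I"
proof -
  have "definable S 1 {x. length x = 1 \<and> P (x ! 0)}"
    by (rule definableI) (use assms in simp)
  then have "\<exists>\<I>. finite \<I> \<and> {a. [a] \<in> {x. length x = 1 \<and> P (x ! 0)}} = \<Union>\<I> \<and>
      (\<forall>I\<in>\<I>. basic_set I)"
    unfolding basic_set_def by (rule o_minimal[unfolded o_minimal_def, rule_format])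
  then obtain \<I> where "finite \<I>" "{a. [a] \<in> {x. length x = 1 \<and> P (x ! 0)}} = \<Union>\<I>"
    "\<forall>I\<in>\<I>. basic_set I" by blast
  then show thesis using that[of \<I>] by simp
qed

lemma infinite_imp_interval:
  assumes "def_pred S (\<lambda>v. P (v 0))" "infinite {a. P a}"
  obtains a b where "a < b" "\<And>c. a < c \<Longrightarrow> c < b \<Longrightarrow> P c"
proof -
  obtain \<I> where \<I>: "finite \<I>" "{a. P a} = \<Union>\<I>" "\<And>I. I \<in> \<I> \<Longrightarrow> basic_set I"
    using basic_decomposition[OF assms(1)] by blast
  then obtain I where I: "I \<in> \<I>" "infinite I"
    using assms(2) finite_Union[of \<I>] by auto
  have *: "P c" if "c \<in> I" for c using \<I>(2) I(1) that by blast
  show thesis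
    using \<I>(3)[OF I(1)]
  proof (cases rule: basic_set_cases)
    case (1 a)
    then show thesis using I(2) by simp
  next
    case (2 a b)
    then have "a < b" using I(2) by (metis finite.emptyI greaterThanLessThan_empty_iff not_less)
    then show thesis using that * 2 by auto
  next
    case (3 a)
    then show thesis using that[of a "a + 1"] * by auto
  next
    case (4 b)
    then show thesis using that[of "b - 1" b] * by auto
  next
    case 5
    then show thesis using that[of 0 1] * by auto
  qed
qed

text \<open>Turns infinity into a first-order condition, so that it may occur inside definable
  predicates.\<close>

lemma infinite_iff_interval:
  assumes "def_pred S (\<lambda>v. P (v 0))"
  shows "infinite {a. P a} \<longleftrightarrow> (\<exists>a b. a < b \<and> (\<forall>c. a < c \<and> c < b \<longrightarrow> P c))"
proof
  assume "\<exists>a b. a < b \<and> (\<forall>c. a < c \<and> c < b \<longrightarrow> P c)"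
  then obtain a b where ab: "a < b" "\<forall>c. a < c \<and> c < b \<longrightarrow> P c" by blast
  then have "{a<..<b} \<subseteq> {c. P c}" by auto
  then show "infinite {a. P a}" using infinite_Ioo[OF ab(1)] infinite_super by blast
next
  assume "infinite {a. P a}"
  then obtain a b where "a < b" "\<And>c. a < c \<Longrightarrow> c < b \<Longrightarrow> P c"
    using infinite_imp_interval[where P = P] assms by blast
  then show "\<exists>a b. a < b \<and> (\<forall>c. a < c \<and> c < b \<longrightarrow> P c)" by blast
qed

lemma def_pred_infinite:
  assumes "def_pred S (\<lambda>v. P (v 0) (\<lambda>n. v (Suc n)))"
  shows "def_pred S (\<lambda>v. infinite {a. P a v})"
proof -
  have fixed: "def_pred S (\<lambda>w. P (w 0) v)" for v
    using def_pred_subst[OF assms, of "case_nat (Inl 0) (\<lambda>n. Inr (v n))"] by simp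
  \<comment> \<open>The interval criterion binds three variables, two endpoints and a point between
    them, so the outer environment sits three positions deeper.\<close>
  have shifted: "def_pred S (\<lambda>v. P (v 0) (\<lambda>n. v (Suc (Suc (Suc n)))))"
    using def_pred_subst[OF assms, of "case_nat (Inl 0) (\<lambda>n. Inl (Suc (Suc (Suc n))))"] by simp
  show ?thesis
    unfolding infinite_iff_interval[OF fixed] by (intro def_rules shifted)
qed

lemma lub_exists:
  assumes "def_pred S (\<lambda>v. P (v 0))" "P a" "\<forall>a. P a \<longrightarrow> a \<le> u"
  shows "\<exists>s. (\<forall>a. P a \<longrightarrow> a \<le> s) \<and> (\<forall>u. (\<forall>a. P a \<longrightarrow> a \<le> u) \<longrightarrow> s \<le> u)"
proof -
  obtain \<I> where \<I>: "finite \<I>" "{a. P a} = \<Union>\<I>" "\<And>I. I \<in> \<I> \<Longrightarrow> basic_set I"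
    using basic_decomposition[OF assms(1)] by blast
  have iff: "c \<in> \<Union>\<I> \<longleftrightarrow> P c" for c using \<I>(2) by blast
  have "\<exists>s. (\<forall>a\<in>\<Union>\<I>. a \<le> s) \<and> (\<forall>u. (\<forall>a\<in>\<Union>\<I>. a \<le> u) \<longrightarrow> s \<le> u)"
    by (rule basic_sets_lub[OF \<I>(1,3), of u]) (use assms(2,3) iff in blast)+
  then show ?thesis unfolding Ball_def iff .
qed

text \<open>The infimum is the supremum of the lower bounds, which again form a definable
  set.\<close>

lemma glb_exists:
  assumes "def_pred S (\<lambda>v. P (v 0))" "P a" "\<forall>a. P a \<longrightarrow> l \<le> a"
  shows "\<exists>s. (\<forall>a. P a \<longrightarrow> s \<le> a) \<and> (\<forall>l. (\<forall>a. P a \<longrightarrow> l \<le> a) \<longrightarrow> l \<le> s)"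
proof -
  have "def_pred S (\<lambda>v. \<forall>b. P b \<longrightarrow> v 0 \<le> b)"
    by (intro def_rules def_pred_subst_var[of S P, OF assms(1)])
  then have "\<exists>s. (\<forall>c. (\<forall>b. P b \<longrightarrow> c \<le> b) \<longrightarrow> c \<le> s) \<and>
      (\<forall>u. (\<forall>c. (\<forall>b. P b \<longrightarrow> c \<le> b) \<longrightarrow> c \<le> u) \<longrightarrow> s \<le> u)"
    by (rule lub_exists[where P = "\<lambda>c. \<forall>b. P b \<longrightarrow> c \<le> b" and a = l and u = a])
      (use assms(2,3) in blast)+
  then show ?thesis by blast
qed

lemma right_germ:
  assumes "def_pred S (\<lambda>v. P (v 0))"
  obtains z where "x < z" "(\<forall>y. x < y \<and> y < z \<longrightarrow> P y) \<or> (\<forall>y. x < y \<and> y < z \<longrightarrow> \<not> P y)"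
proof -
  obtain \<I> where \<I>: "finite \<I>" "{a. P a} = \<Union>\<I>" "\<And>I. I \<in> \<I> \<Longrightarrow> basic_set I"
    using basic_decomposition[OF assms(1)] by blast
  obtain z where "x < z" "{x<..<z} \<subseteq> {a. P a} \<or> {x<..<z} \<inter> {a. P a} = {}"
    using basic_sets_right_germ[OF \<I>(1,3), of x] unfolding \<I>(2)[symmetric] by blast
  then have "(\<forall>y. x < y \<and> y < z \<longrightarrow> P y) \<or> (\<forall>y. x < y \<and> y < z \<longrightarrow> \<not> P y)"
    by (auto simp: subset_iff disjoint_iff)
  then show thesis using that \<open>x < z\<close> by blast
qed

text \<open>The infimum of \<open>{q. 0 \<le> q \<and> T t q}\<close> serves as a definable choice function.\<close>

lemma infinite_cluster:
  assumes B: "def_pred S (\<lambda>v. B (v 0))" and T: "def_pred S (\<lambda>v. T (v 0) (v (Suc 0)))"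
    and inf: "infinite {t. B t}" and ex: "\<And>t. B t \<Longrightarrow> \<exists>q\<ge>0. T t q" and "0 < \<delta>"
  obtains p where "infinite {t. B t \<and> (\<exists>q. 0 \<le> q \<and> T t q \<and> p - \<delta> < q \<and> q < p + \<delta>)}"
proof -
  \<comment> \<open>The bound 0 makes the infimum \<open>s\<close> exist. It need not be attained,
    which is why the conclusion speaks only of values near \<open>p\<close>.\<close>
  define f where "f t s \<longleftrightarrow> (\<forall>q. 0 \<le> q \<and> T t q \<longrightarrow> s \<le> q) \<and>
    (\<forall>u. (\<forall>q. 0 \<le> q \<and> T t q \<longrightarrow> u \<le> q) \<longrightarrow> u \<le> s)" for t s
  have f_unique: "s = s'" if "f t s" "f t s'" for t s s'
    using that unfolding f_def by (meson order.antisym)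
  have f_ex: "\<exists>s. f t s" if t: "B t" for t
  proof -
    obtain q where "0 \<le> q" "T t q" using ex[OF t] by blast
    moreover have "def_pred S (\<lambda>v. 0 \<le> v 0 \<and> T t (v 0))"
      by (intro def_rules def_pred_subst_var2[of S T, OF T])
    ultimately show ?thesis
      unfolding f_def by (intro glb_exists[where P = "\<lambda>q. 0 \<le> q \<and> T t q" and a = q and l = 0]) auto
  qed
  have approx: "\<exists>q. 0 \<le> q \<and> T t q \<and> s \<le> q \<and> q < w" if "f t s" "s < w" for t s w
    using that unfolding f_def by (meson not_le)
  have f_def_pred: "def_pred S (\<lambda>v. f (v 0) (v (Suc 0)))"
    unfolding f_def by (intro def_rules def_pred_subst_var2[of S T, OF T])
  \<comment> \<open>If there are finitely many infima, one of them is shared by infinitely many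
    \<open>t\<close>. Otherwise the infima fill an interval, and a window in it of width at most
    \<open>\<delta>\<close> has infinitely many preimages.\<close>
  show thesis
  proof (cases "finite {s. \<exists>t. B t \<and> f t s}")
    case True
    have "{t. B t} \<subseteq> (\<Union>s\<in>{s. \<exists>t. B t \<and> f t s}. {t. B t \<and> f t s})" using f_ex by blast
    then have "infinite (\<Union>s\<in>{s. \<exists>t. B t \<and> f t s}. {t. B t \<and> f t s})"
      using inf infinite_super by blast
    then obtain s where s: "infinite {t. B t \<and> f t s}" using True by auto
    have "\<exists>q. 0 \<le> q \<and> T t q \<and> s - \<delta> < q \<and> q < s + \<delta>" if "f t s" for t
      using approx[OF that, of "s + \<delta>"] \<open>0 < \<delta>\<close>
      by (metis diff_less_eq less_add_same_cancel1 order_less_le_trans)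
    then have "{t. B t \<and> f t s} \<subseteq> {t. B t \<and> (\<exists>q. 0 \<le> q \<and> T t q \<and> s - \<delta> < q \<and> q < s + \<delta>)}"
      by blast
    then show thesis using that s infinite_super by blast
  next
    case False
    have "def_pred S (\<lambda>v. \<exists>t. B t \<and> f t (v 0))"
      by (intro def_rules def_pred_subst_var2[of S f, OF f_def_pred] def_pred_subst_var[of S B, OF B])
    then obtain u w where uw: "u < w" "\<And>s. u < s \<Longrightarrow> s < w \<Longrightarrow> \<exists>t. B t \<and> f t s"
      using infinite_imp_interval[where P = "\<lambda>s. \<exists>t. B t \<and> f t s"] False by blast
    define J where "J = {t. B t \<and> (\<exists>s. f t s \<and> u < s \<and> s < min w (u + \<delta>))}"
    have "{u<..<min w (u + \<delta>)} \<subseteq> (\<lambda>t. THE s. f t s) ` J"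
    proof
      fix s assume s: "s \<in> {u<..<min w (u + \<delta>)}"
      then obtain t where t: "B t" "f t s" using uw(2) by auto
      then have "(THE s. f t s) = s" using f_unique by blast
      moreover have "t \<in> J" using t s unfolding J_def by auto
      ultimately show "s \<in> (\<lambda>t. THE s. f t s) ` J" by blast
    qed
    moreover have "infinite {u<..<min w (u + \<delta>)}" using uw(1) \<open>0 < \<delta>\<close> by (simp add: infinite_Ioo)
    ultimately have "infinite J" using finite_surj by blast
    moreover have "J \<subseteq> {t. B t \<and> (\<exists>q. 0 \<le> q \<and> T t q \<and> u - \<delta> < q \<and> q < u + \<delta>)}"
    proof
      fix t assume "t \<in> J"
      then obtain s where t: "B t" "f t s" "u < s" "s < u + \<delta>" unfolding J_def by auto
      then obtain q where q: "0 \<le> q" "T t q" "s \<le> q" "q < u + \<delta>" using approx by blast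
      have "u - \<delta> < u" using \<open>0 < \<delta>\<close> by simp
      also have "u < q" using t(3) q(3) by simp
      finally show "t \<in> {t. B t \<and> (\<exists>q. 0 \<le> q \<and> T t q \<and> u - \<delta> < q \<and> q < u + \<delta>)}"
        using t(1) q by blast
    qed
    ultimately show thesis using that infinite_super by blast
  qed
qed

text \<open>Every fiber contains an interval with some center and radius, and two applications of
  \<open>infinite_cluster\<close> make these uniform on an infinite set of indices. Bounding the
  inverse radii bounds the radii below by \<open>\<epsilon>\<close>; centers within
  \<open>\<epsilon> / 2\<close> of a common point then leave a common interval of half-width
  \<open>\<epsilon> / 2\<close>.\<close>

lemma infinite_fibers_imp_box:
  assumes B: "def_pred S (\<lambda>v. B (v 0))" and X: "def_pred S (\<lambda>v. X (v 0) (v (Suc 0)))"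
    and inf: "infinite {t. B t}" and fib: "\<And>t. B t \<Longrightarrow> infinite {r. X t r}"
  obtains a b c e where "a < b" "c < e"
    "\<And>t. a < t \<Longrightarrow> t < b \<Longrightarrow> B t"
    "\<And>t r. a < t \<Longrightarrow> t < b \<Longrightarrow> c < r \<Longrightarrow> r < e \<Longrightarrow> X t r"
proof -
  \<comment> \<open>\<open>q\<close> is the inverse of the radius, since an upper bound on
    \<open>q\<close> is a lower bound on the radius. Multiplying out keeps the condition within the
    language.\<close>
  define T where "T t q \<longleftrightarrow> 0 < q \<and> (\<exists>p. \<forall>r. (p - r) * q < 1 \<and> (r - p) * q < 1 \<longrightarrow> X t r)" for t q
  have T: "def_pred S (\<lambda>v. T (v 0) (v (Suc 0)))"
    unfolding T_def by (intro def_rules def_pred_subst_var2[of S X, OF X])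
  have "\<exists>q\<ge>0. T t q" if t: "B t" for t
  proof -
    have "def_pred S (\<lambda>v. X t (v 0))" by (intro def_rules def_pred_subst_var2[of S X, OF X])
    then obtain a b where ab: "a < b" "\<And>c. a < c \<Longrightarrow> c < b \<Longrightarrow> X t c"
      using infinite_imp_interval[where P = "X t"] fib[OF t] by blast
    have "X t r" if "((a + b) / 2 - r) * (2 / (b - a)) < 1" "(r - (a + b) / 2) * (2 / (b - a)) < 1" for r
      by (rule ab(2)) (use that ab(1) in \<open>simp_all add: field_simps\<close>)
    then have "T t (2 / (b - a))"
      unfolding T_def using ab(1) by (intro conjI exI[of _ "(a + b) / 2"]) auto
    moreover have "2 / (b - a) \<ge> 0" using ab(1) by simp
    ultimately show ?thesis by blast
  qed
  then obtain p0 where p0: "infinite {t. B t \<and> (\<exists>q. 0 \<le> q \<and> T t q \<and> p0 - 1 < q \<and> q < p0 + 1)}"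
    using infinite_cluster[OF B T inf, of 1] by auto
  then have "{t. B t \<and> (\<exists>q. 0 \<le> q \<and> T t q \<and> p0 - 1 < q \<and> q < p0 + 1)} \<noteq> {}" by force
  then have p0_pos: "0 < p0 + 1" by auto
  \<comment> \<open>The clustered values satisfy \<open>q < p0 + 1\<close>, so all the radii
    \<open>1 / q\<close> exceed this number.\<close>
  define \<epsilon> where "\<epsilon> = 1 / (p0 + 1)"
  have \<epsilon>: "0 < \<epsilon>" using p0_pos by (simp add: \<epsilon>_def)
  define B1 where "B1 t \<longleftrightarrow> B t \<and> (\<exists>p. \<forall>r. p - \<epsilon> < r \<and> r < p + \<epsilon> \<longrightarrow> X t r)" for t
  have "B1 t" if t: "B t" "T t q" "q < p0 + 1" for t q
  proof -
    obtain p where p: "\<And>r. (p - r) * q < 1 \<Longrightarrow> (r - p) * q < 1 \<Longrightarrow> X t r" and q: "0 < q"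
      using t(2) unfolding T_def by blast
    have "\<epsilon> < 1 / q" using q t(3) p0_pos unfolding \<epsilon>_def by (simp add: frac_less2)
    then have "X t r" if "p - \<epsilon> < r" "r < p + \<epsilon>" for r
      using that q by (intro p) (simp_all add: pos_less_divide_eq[symmetric])
    then show ?thesis unfolding B1_def using t(1) by blast
  qed
  then have "{t. B t \<and> (\<exists>q. 0 \<le> q \<and> T t q \<and> p0 - 1 < q \<and> q < p0 + 1)} \<subseteq> {t. B1 t}" by blast
  then have inf1: "infinite {t. B1 t}" using p0 infinite_super by blast
  have B1: "def_pred S (\<lambda>v. B1 (v 0))"
    unfolding B1_def by (intro def_rules def_pred_subst_var2[of S X, OF X] B)
  \<comment> \<open>\<open>infinite_cluster\<close> asks for nonnegative values, so the absolute
    value of the center is recorded. The lost sign is recovered by considering both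
    \<open>p1\<close> and \<open>- p1\<close>.\<close>
  define T2 where "T2 t q \<longleftrightarrow> (\<exists>p. (q = p \<or> q + p = 0) \<and> (\<forall>r. p - \<epsilon> < r \<and> r < p + \<epsilon> \<longrightarrow> X t r))" for t q
  have T2: "def_pred S (\<lambda>v. T2 (v 0) (v (Suc 0)))"
    unfolding T2_def by (intro def_rules def_pred_subst_var2[of S X, OF X])
  have "\<exists>q\<ge>0. T2 t q" if t: "B1 t" for t
  proof -
    obtain p where p: "\<forall>r. p - \<epsilon> < r \<and> r < p + \<epsilon> \<longrightarrow> X t r" using t unfolding B1_def by blast
    then have "T2 t \<bar>p\<bar>" unfolding T2_def by (intro exI[of _ p]) (simp add: abs_if)
    then show ?thesis using abs_ge_zero by blast
  qed
  then obtain p1 where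
    p1: "infinite {t. B1 t \<and> (\<exists>q. 0 \<le> q \<and> T2 t q \<and> p1 - \<epsilon> / 2 < q \<and> q < p1 + \<epsilon> / 2)}"
    using infinite_cluster[OF B1 T2 inf1, of "\<epsilon> / 2"] \<epsilon> by auto
  define C where "C p t \<longleftrightarrow> B t \<and> (\<forall>r. p - \<epsilon> / 2 < r \<and> r < p + \<epsilon> / 2 \<longrightarrow> X t r)" for p t
  have "C p1 t \<or> C (- p1) t"
    if t: "B1 t" "T2 t q" "p1 - \<epsilon> / 2 < q" "q < p1 + \<epsilon> / 2" for t q
  proof -
    obtain p where p: "q = p \<or> q + p = 0" "\<And>r. p - \<epsilon> < r \<Longrightarrow> r < p + \<epsilon> \<Longrightarrow> X t r"
      using t(2) unfolding T2_def by blast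
    have "B t" using t(1) unfolding B1_def by simp
    from p(1) show ?thesis
    proof
      assume "q = p"
      then have "X t r" if "p1 - \<epsilon> / 2 < r" "r < p1 + \<epsilon> / 2" for r
        by (intro p(2)) (use that t(3,4) in \<open>simp_all add: field_simps\<close>)
      then show ?thesis unfolding C_def using \<open>B t\<close> by blast
    next
      assume "q + p = 0"
      then have "p = - q" by (simp add: eq_neg_iff_add_eq_0 add.commute)
      then have "X t r" if "- p1 - \<epsilon> / 2 < r" "r < - p1 + \<epsilon> / 2" for r
        by (intro p(2)) (use that t(3,4) in \<open>simp_all add: field_simps\<close>)
      then show ?thesis unfolding C_def using \<open>B t\<close> by blast
    qed
  qed
  then have "{t. B1 t \<and> (\<exists>q. 0 \<le> q \<and> T2 t q \<and> p1 - \<epsilon> / 2 < q \<and> q < p1 + \<epsilon> / 2)}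
      \<subseteq> {t. C p1 t} \<union> {t. C (- p1) t}" by blast
  then have "infinite {t. C p1 t} \<or> infinite {t. C (- p1) t}"
    using p1 infinite_super by blast
  then obtain p where p: "infinite {t. C p t}" by blast
  have "def_pred S (\<lambda>v. C p (v 0))"
    unfolding C_def by (intro def_rules def_pred_subst_var2[of S X, OF X] B)
  then obtain a b where "a < b" "\<And>t. a < t \<Longrightarrow> t < b \<Longrightarrow> C p t"
    using infinite_imp_interval p by blast
  then show thesis
    using that[of a b "p - \<epsilon> / 2" "p + \<epsilon> / 2"] \<epsilon> unfolding C_def by simp
qed

end

section \<open>Curves\<close>

lemma nths_singleton_index: "i < length xs \<Longrightarrow> nths xs {i} = [xs ! i]"
proof (induction xs arbitrary: i)
  case (Cons x xs)
  have "{j. Suc j \<in> {i}} = (if i = 0 then {} else {i - 1})" by auto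
  then show ?case using Cons by (cases i) (simp_all add: nths_Cons)
qed simp

lemma nths_pair_index: "i < j \<Longrightarrow> j < length xs \<Longrightarrow> nths xs {i, j} = [xs ! i, xs ! j]"
proof (induction xs arbitrary: i j)
  case (Cons x xs)
  show ?case
  proof (cases i)
    case 0
    then have "{k. Suc k \<in> {i, j}} = {j - 1}" using Cons.prems(1) by auto
    then show ?thesis
      using Cons.prems 0 by (auto simp: nths_Cons nths_singleton_index nth_Cons')
  next
    case (Suc k)
    then have "{l. Suc l \<in> {i, j}} = {k, j - 1}" using Cons.prems(1) by auto
    then show ?thesis
      using Cons.prems Suc Cons.IH[of k "j - 1"] by (auto simp: nths_Cons nth_Cons')
  qed
qed simp

lemma has_interior_mono: "has_interior k X \<Longrightarrow> X \<subseteq> Y \<Longrightarrow> has_interior k Y"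
  unfolding has_interior_def by (elim exE conjE) (intro exI conjI; (assumption | erule order.trans; assumption))

lemma has_interior_singleton_proj:
  assumes "\<And>x. x \<in> X \<Longrightarrow> length x = d" "i < d"
  shows "has_interior 1 ((\<lambda>x. nths x {i}) ` X) \<longleftrightarrow>
    (\<exists>a b. a < b \<and> (\<forall>c. a < c \<and> c < b \<longrightarrow> (\<exists>x\<in>X. x ! i = c)))"
proof -
  have img: "[c] \<in> (\<lambda>x. nths x {i}) ` X \<longleftrightarrow> (\<exists>x\<in>X. x ! i = c)" for c
    using assms by (auto simp: nths_singleton_index image_iff)
  show ?thesis
  proof
    assume "has_interior 1 ((\<lambda>x. nths x {i}) ` X)"
    then obtain a b where ab: "a ! 0 < b ! 0"
      "{x. length x = 1 \<and> (\<forall>i<1. a ! i < x ! i \<and> x ! i < b ! i)} \<subseteq> (\<lambda>x. nths x {i}) ` X"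
      unfolding has_interior_def by auto
    have "\<exists>x\<in>X. x ! i = c" if "a ! 0 < c" "c < b ! 0" for c
    proof -
      have "[c] \<in> {x. length x = 1 \<and> (\<forall>i<1. a ! i < x ! i \<and> x ! i < b ! i)}" using that by simp
      then show ?thesis using ab(2) img by blast
    qed
    then show "\<exists>a b. a < b \<and> (\<forall>c. a < c \<and> c < b \<longrightarrow> (\<exists>x\<in>X. x ! i = c))"
      using ab(1) by blast
  next
    assume "\<exists>a b. a < b \<and> (\<forall>c. a < c \<and> c < b \<longrightarrow> (\<exists>x\<in>X. x ! i = c))"
    then obtain a b where ab: "a < b" "\<And>c. a < c \<Longrightarrow> c < b \<Longrightarrow> \<exists>x\<in>X. x ! i = c" by blast
    have "x \<in> (\<lambda>x. nths x {i}) ` X" if x: "length x = 1" "a < x ! 0" "x ! 0 < b" for x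
    proof -
      have "x = [x ! 0]" using x(1) by (cases x) auto
      then show ?thesis using img[of "x ! 0"] ab(2)[OF x(2,3)] by simp
    qed
    then show "has_interior 1 ((\<lambda>x. nths x {i}) ` X)"
      unfolding has_interior_def using ab(1) by (intro exI[of _ "[a]"] exI[of _ "[b]"]) auto
  qed
qed

lemma finite_projections_imp_finite:
  assumes "\<And>x. x \<in> X \<Longrightarrow> length x = d" "\<And>i. i < d \<Longrightarrow> finite ((\<lambda>x. x ! i) ` X)"
  shows "finite X"
proof (rule finite_subset)
  show "X \<subseteq> {x. set x \<subseteq> (\<Union>i<d. (\<lambda>x. x ! i) ` X) \<and> length x = d}"
  proof safe
    fix x a assume x: "x \<in> X" and "a \<in> set x"
    then obtain i where "i < length x" "a = x ! i" by (metis in_set_conv_nth)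
    then show "a \<in> (\<Union>i<d. (\<lambda>x. x ! i) ` X)" using x assms(1) by auto
  qed (use assms(1) in auto)
  show "finite {x. set x \<subseteq> (\<Union>i<d. (\<lambda>x. x ! i) ` X) \<and> length x = d}"
    by (rule finite_lists_length_eq) (use assms(2) in simp)
qed

lemma infinite_iff_projection:
  assumes "\<And>x. x \<in> X \<Longrightarrow> length x = d"
  shows "infinite X \<longleftrightarrow> (\<exists>i<d. infinite {c. \<exists>x\<in>X. x ! i = c})"
proof -
  have "{c. \<exists>x\<in>X. x ! i = c} = (\<lambda>x. x ! i) ` X" for i by auto
  then show ?thesis
    using finite_projections_imp_finite[of X d] assms finite_imageI[of X] by (simp only:) blast
qed

text \<open>A set of tuples is infinite iff some coordinate takes infinitely many values on it,
  which reduces the claim to \<open>def_pred_infinite\<close>.\<close>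

lemma (in o_minimal_structure) def_pred_infinite_list:
  assumes A: "definable S e A" and P: "def_pred S (\<lambda>v. P (map v [0..<e]) (\<lambda>n. v (n + e)))"
  shows "def_pred S (\<lambda>v. infinite {y \<in> A. P y v})"
proof -
  have shifted: "def_pred S (\<lambda>v. P (map v [0..<e]) (\<lambda>n. v (Suc n + e)))"
  proof -
    let ?\<sigma> = "\<lambda>n. Inl (if n < e then n else Suc n)"
    have 1: "map (assign ?\<sigma> v) [0..<e] = map v [0..<e]"
      "(\<lambda>n. assign ?\<sigma> v (n + e)) = (\<lambda>n. v (Suc n + e))" for v :: "nat \<Rightarrow> 'a"
      by auto
    show ?thesis using def_pred_subst[OF P, of ?\<sigma>] unfolding 1 .
  qed
  have "def_pred S (\<lambda>v. \<exists>i<e. infinite {c. \<exists>y\<in>A. P y v \<and> y ! i = c})"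
    by (intro def_pred_bex_less def_pred_infinite def_pred_bex[OF A] def_rules shifted
        def_term_nth[OF def_list_block])
  also have "(\<lambda>v. \<exists>i<e. infinite {c. \<exists>y\<in>A. P y v \<and> y ! i = c}) = (\<lambda>v. infinite {y \<in> A. P y v})"
  proof (rule ext)
    fix v
    have "infinite {y \<in> A. P y v} \<longleftrightarrow> (\<exists>i<e. infinite {c. \<exists>x\<in>{y \<in> A. P y v}. x ! i = c})"
      by (rule infinite_iff_projection) (use definable_length[OF A] in blast)
    moreover have "{c. \<exists>x\<in>{y \<in> A. P y v}. x ! i = c} = {c. \<exists>y\<in>A. P y v \<and> y ! i = c}" for i
      by blast
    ultimately show "(\<exists>i<e. infinite {c. \<exists>y\<in>A. P y v \<and> y ! i = c}) = infinite {y \<in> A. P y v}"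
      by simp
  qed
  finally show ?thesis .
qed

section \<open>One-dimensional definable sets and the overlap principle\<close>

locale definable_curve = o_minimal_structure S
  for S :: "('f, 'r, 'a::linordered_field) expansion" +
  fixes d :: nat and H :: "'a list set"
  assumes definable_H: "definable S d H"
    and dim_H: "omin_dim d H = Some 1"
begin

lemma length_H: "x \<in> H \<Longrightarrow> length x = d"
  using definable_length[OF definable_H] .

lemma dim_set_finite:
  "finite {card I |I. I \<subseteq> {..<d} \<and> has_interior (card I) ((\<lambda>x. nths x I) ` X)}"
  by (rule finite_subset[of _ "card ` Pow {..<d}"]) auto

lemma has_interior_proj_H:
  assumes "I \<subseteq> {..<d}" "has_interior (card I) ((\<lambda>x. nths x I) ` H)"
  shows "card I \<le> 1"
proof -
  let ?K = "{card I |I. I \<subseteq> {..<d} \<and> has_interior (card I) ((\<lambda>x. nths x I) ` H)}"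
  have "Max ?K = 1"
    using dim_H unfolding omin_dim_def by (metis (no_types, lifting) option.distinct(1) option.inject)
  moreover have "card I \<le> Max ?K"
    by (rule Max_ge[OF dim_set_finite]) (use assms in blast)
  ultimately show ?thesis by (simp only:)
qed

text \<open>Such a box would give the projection to the coordinates \<open>i\<close> and
  \<open>j\<close> non-empty interior, hence dimension at least two.\<close>

lemma no_box_ordered:
  assumes "i < j" "j < d" "a < b" "c < e"
    and box: "\<And>r q. a < r \<Longrightarrow> r < b \<Longrightarrow> c < q \<Longrightarrow> q < e \<Longrightarrow> \<exists>y\<in>H. y ! i = r \<and> y ! j = q"
  shows False
proof -
  have "x \<in> (\<lambda>x. nths x {i, j}) ` H"
    if x: "length x = 2" "\<forall>k<2. [a, c] ! k < x ! k \<and> x ! k < [b, e] ! k" for x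
  proof -
    have x': "x = [x ! 0, x ! 1]" using x(1) by (auto simp: length_Suc_conv numeral_2_eq_2)
    have "a < x ! 0" "x ! 0 < b" "c < x ! 1" "x ! 1 < e"
      using x(2)[rule_format, of 0] x(2)[rule_format, of 1] by simp_all
    then obtain y where y: "y \<in> H" "y ! i = x ! 0" "y ! j = x ! 1" using box by blast
    then have "nths y {i, j} = [x ! 0, x ! 1]"
      using nths_pair_index[of i j y] assms(1,2) length_H by simp
    then show ?thesis using y(1) x' by (metis image_eqI)
  qed
  moreover have "\<forall>k<2. [a, c] ! k < [b, e] ! k" using assms(3,4) by (simp add: less_2_cases_iff)
  ultimately have "has_interior 2 ((\<lambda>x. nths x {i, j}) ` H)"
    unfolding has_interior_def by (intro exI[of _ "[a, c]"] exI[of _ "[b, e]"]) auto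
  moreover have "card {i, j} = 2" using assms(1) by simp
  ultimately show False
    using has_interior_proj_H[of "{i, j}"] assms(1,2) by (simp only:) auto
qed

lemma no_box:
  assumes "i < d" "j < d" "i \<noteq> j" "a < b" "c < e"
    and box: "\<And>r q. a < r \<Longrightarrow> r < b \<Longrightarrow> c < q \<Longrightarrow> q < e \<Longrightarrow> \<exists>y\<in>H. y ! i = r \<and> y ! j = q"
  shows False
proof (cases "i < j")
  case True
  show False by (rule no_box_ordered[OF True assms(2,4,5) box])
next
  case False
  then have "j < i" using assms(3) by simp
  then show False using assms(1,4,5) box by (intro no_box_ordered[of j i c e a b]) blast+
qed

text \<open>Otherwise some other coordinate \<open>k\<close> takes infinitely many values on each of
  infinitely many of these fibers, and \<open>infinite_fibers_imp_box\<close> fills a box in the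
  coordinates \<open>j\<close> and \<open>k\<close>.\<close>

lemma finite_coordinate_fibers:
  assumes "j < d"
  shows "finite {r. infinite {y \<in> H. y ! j = r}}"
proof (rule ccontr)
  assume inf: "infinite {r. infinite {y \<in> H. y ! j = r}}"
  define B where "B k r \<longleftrightarrow> infinite {c. \<exists>y\<in>H. y ! j = r \<and> y ! k = c}" for k r
  have "{r. infinite {y \<in> H. y ! j = r}} \<subseteq> (\<Union>k<d. {r. B k r})"
  proof safe
    fix r assume "infinite {y \<in> H. y ! j = r}"
    then obtain k where "k < d" "infinite {c. \<exists>x\<in>{y \<in> H. y ! j = r}. x ! k = c}"
      using infinite_iff_projection[of "{y \<in> H. y ! j = r}" d] length_H by auto
    moreover have "{c. \<exists>x\<in>{y \<in> H. y ! j = r}. x ! k = c} = {c. \<exists>y\<in>H. y ! j = r \<and> y ! k = c}"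
      by blast
    ultimately show "r \<in> (\<Union>k<d. {r. B k r})" unfolding B_def by auto
  qed
  then have "infinite (\<Union>k<d. {r. B k r})" using inf infinite_super by blast
  then obtain k where k: "k < d" "infinite {r. B k r}" by auto
  have "k \<noteq> j"
  proof
    assume "k = j"
    then have "{c. \<exists>y\<in>H. y ! j = r \<and> y ! k = c} \<subseteq> {r}" for r by auto
    then have "\<not> B k r" for r unfolding B_def using finite_subset by blast
    then show False using k(2) by simp
  qed
  have B: "def_pred S (\<lambda>v. B k (v 0))"
    unfolding B_def
    by (intro def_pred_infinite def_pred_bex[OF definable_H] def_rules
        def_term_nth[OF def_list_block] assms k(1))
  have X: "def_pred S (\<lambda>v. \<exists>y\<in>H. y ! j = v 0 \<and> y ! k = v (Suc 0))"
    by (intro def_pred_bex[OF definable_H] def_rules def_term_nth[OF def_list_block] assms k(1))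
  obtain a b c e where "a < b" "c < e"
    "\<And>r. a < r \<Longrightarrow> r < b \<Longrightarrow> B k r"
    "\<And>r q. a < r \<Longrightarrow> r < b \<Longrightarrow> c < q \<Longrightarrow> q < e \<Longrightarrow> \<exists>y\<in>H. y ! j = r \<and> y ! k = q"
    by (rule infinite_fibers_imp_box[where B = "B k" and X = "\<lambda>r c. \<exists>y\<in>H. y ! j = r \<and> y ! k = c",
          OF B X k(2)]) (auto simp: B_def)
  then show False using no_box[OF assms k(1) \<open>k \<noteq> j\<close>[symmetric]] by blast
qed

text \<open>Suitable coordinates \<open>i\<close> of \<open>T\<close> and \<open>j\<close> of
  \<open>H\<close> lead to a box of pairs \<open>(t ! i, y ! j)\<close> with \<open>Q t y\<close>.
  If every \<open>y\<close> lay in finitely many members, a finite fiber of \<open>H\<close> over a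
  value of \<open>y ! j\<close> could account for finitely many values \<open>t ! i\<close> only,
  not for an interval. So an interval of fibers of \<open>H\<close> would be infinite, against
  \<open>finite_coordinate_fibers\<close>.\<close>

lemma infinite_fibers_overlap:
  assumes Q: "def_rel S p d Q" and T: "definable S p T" "infinite T"
    and fib: "\<And>t. t \<in> T \<Longrightarrow> infinite {y \<in> H. Q t y}"
  shows "\<exists>y\<in>H. infinite {t \<in> T. Q t y}"
proof (rule ccontr)
  assume "\<not> ?thesis"
  then have fin: "finite {t \<in> T. Q t y}" if "y \<in> H" for y using that by blast
  define T' where "T' j = {t \<in> T. infinite {r. \<exists>y\<in>H. Q t y \<and> y ! j = r}}" for j
  have "T \<subseteq> (\<Union>j<d. T' j)"
  proof
    fix t assume t: "t \<in> T"
    obtain j where "j < d" "infinite {c. \<exists>x\<in>{y \<in> H. Q t y}. x ! j = c}"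
      using infinite_iff_projection[of "{y \<in> H. Q t y}" d] length_H fib[OF t] by auto
    moreover have "{c. \<exists>x\<in>{y \<in> H. Q t y}. x ! j = c} = {r. \<exists>y\<in>H. Q t y \<and> y ! j = r}" by blast
    ultimately show "t \<in> (\<Union>j<d. T' j)" using t unfolding T'_def by auto
  qed
  then have "infinite (\<Union>j<d. T' j)" using T(2) infinite_super by blast
  then obtain j where j: "j < d" "infinite (T' j)" by auto
  have T': "definable S p (T' j)"
    unfolding T'_def
    by (intro definable_subset[OF T(1)] def_pred_infinite def_pred_bex[OF definable_H] def_rules
        def_rel_subst[OF Q] def_list_block def_list_vars def_term_nth[OF def_list_block] j(1))
  obtain i where i: "i < p" "infinite {s. \<exists>t\<in>T' j. t ! i = s}"
    using infinite_iff_projection[of "T' j" p] definable_length[OF T'] j(2) by blast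
  define X where "X s r \<longleftrightarrow> (\<exists>t\<in>T' j. t ! i = s \<and> (\<exists>y\<in>H. Q t y \<and> y ! j = r))" for s r
  have Bd: "def_pred S (\<lambda>v. \<exists>t\<in>T' j. t ! i = v 0)"
    by (intro def_pred_bex[OF T'] def_rules def_term_nth[OF def_list_block] i(1))
  have Xd: "def_pred S (\<lambda>v. X (v 0) (v (Suc 0)))"
    unfolding X_def
    by (intro def_pred_bex[OF T'] def_pred_bex[OF definable_H] def_rules def_rel_subst[OF Q]
        def_list_block def_list_vars def_term_nth[OF def_list_block] i(1) j(1))
  have inf: "infinite {r. X s r}" if s: "\<exists>t\<in>T' j. t ! i = s" for s
  proof -
    obtain t where t: "t \<in> T' j" "t ! i = s" using s by blast
    then have "{r. \<exists>y\<in>H. Q t y \<and> y ! j = r} \<subseteq> {r. X s r}" unfolding X_def by blast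
    then show ?thesis using t(1) infinite_super unfolding T'_def by blast
  qed
  obtain a b c e where box: "a < b" "c < e"
    "\<And>s. a < s \<Longrightarrow> s < b \<Longrightarrow> \<exists>t\<in>T' j. t ! i = s"
    "\<And>s r. a < s \<Longrightarrow> s < b \<Longrightarrow> c < r \<Longrightarrow> r < e \<Longrightarrow> X s r"
    by (rule infinite_fibers_imp_box[where B = "\<lambda>s. \<exists>t\<in>T' j. t ! i = s" and X = X, OF Bd Xd i(2) inf])
      (assumption, blast)
  have "infinite {y \<in> H. y ! j = r}" if r: "c < r" "r < e" for r
  proof
    assume finite: "finite {y \<in> H. y ! j = r}"
    have "{a<..<b} \<subseteq> (\<Union>y\<in>{y \<in> H. y ! j = r}. (\<lambda>t. t ! i) ` {t \<in> T. Q t y})"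
    proof
      fix s assume "s \<in> {a<..<b}"
      then have "X s r" using box(4) r by simp
      then show "s \<in> (\<Union>y\<in>{y \<in> H. y ! j = r}. (\<lambda>t. t ! i) ` {t \<in> T. Q t y})"
        unfolding X_def T'_def by blast
    qed
    moreover have "finite (\<Union>y\<in>{y \<in> H. y ! j = r}. (\<lambda>t. t ! i) ` {t \<in> T. Q t y})"
      using finite fin by blast
    ultimately show False using infinite_Ioo[OF box(1)] finite_subset by blast
  qed
  then have "{c<..<e} \<subseteq> {r. infinite {y \<in> H. y ! j = r}}" by auto
  then show False
    using finite_coordinate_fibers[OF j(1)] infinite_Ioo[OF box(2)] finite_subset by blast
qed

text \<open>Inside a curve only projections to at most one coordinate can have interior, so the
  dimension merely tells finite sets from infinite ones.\<close>

lemma omin_dim_subset: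
  assumes X: "definable S d X" "X \<subseteq> H"
  shows "omin_dim d X = Some 1 \<longleftrightarrow> infinite X" "omin_dim d X = Some 0 \<longleftrightarrow> X \<noteq> {} \<and> finite X"
proof -
  let ?K = "{card I |I. I \<subseteq> {..<d} \<and> has_interior (card I) ((\<lambda>x. nths x I) ` X)}"
  have le_1: "k \<le> 1" if "k \<in> ?K" for k
    using that has_interior_proj_H has_interior_mono[OF _ image_mono[OF X(2)]] by blast
  have K: "?K \<subseteq> {0, 1}"
  proof
    fix k assume "k \<in> ?K"
    then have "k \<le> 1" by (rule le_1)
    then show "k \<in> {0, 1}" by (cases k) simp_all
  qed
  have zero: "0 \<in> ?K" if "X \<noteq> {}"
    using that unfolding has_interior_def by (auto intro!: exI[of _ "{}"])
  have "1 \<in> ?K \<longleftrightarrow> (\<exists>i<d. has_interior 1 ((\<lambda>x. nths x {i}) ` X))"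
  proof
    assume "1 \<in> ?K"
    then obtain I where I: "card I = 1" "I \<subseteq> {..<d}" "has_interior 1 ((\<lambda>x. nths x I) ` X)"
      by auto
    then obtain i where "I = {i}" using card_1_singletonE by blast
    then show "\<exists>i<d. has_interior 1 ((\<lambda>x. nths x {i}) ` X)" using I by auto
  next
    assume "\<exists>i<d. has_interior 1 ((\<lambda>x. nths x {i}) ` X)"
    then obtain i where "i < d" "has_interior 1 ((\<lambda>x. nths x {i}) ` X)" by blast
    then show "1 \<in> ?K" by (intro CollectI exI[of _ "{i}"]) simp
  qed
  also have "\<dots> \<longleftrightarrow> (\<exists>i<d. infinite {c. \<exists>x\<in>X. x ! i = c})"
  proof -
    have "has_interior 1 ((\<lambda>x. nths x {i}) ` X) \<longleftrightarrow> infinite {c. \<exists>x\<in>X. x ! i = c}" if "i < d" for i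
    proof -
      have "def_pred S (\<lambda>v. \<exists>x\<in>X. x ! i = v 0)"
        by (intro def_pred_bex[OF X(1)] def_rules def_term_nth[OF def_list_block] that)
      from infinite_iff_interval[OF this] show ?thesis
        using has_interior_singleton_proj[OF definable_length[OF X(1)] that] by simp
    qed
    then show ?thesis by blast
  qed
  also have "\<dots> \<longleftrightarrow> infinite X"
    using infinite_iff_projection[OF definable_length[OF X(1)]] by simp
  finally have one: "1 \<in> ?K \<longleftrightarrow> infinite X" .
  have max: "X \<noteq> {} \<Longrightarrow> Max ?K \<in> ?K" using zero by (intro Max_in[OF dim_set_finite]) auto
  have max_ge: "1 \<in> ?K \<Longrightarrow> 1 \<le> Max ?K" by (rule Max_ge[OF dim_set_finite])
  show "omin_dim d X = Some 1 \<longleftrightarrow> infinite X"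
  proof (cases "X = {}")
    case False
    then show ?thesis using max max_ge K one unfolding omin_dim_def
      by (smt (verit) empty_iff insert_iff le_zero_eq option.inject subset_iff zero_neq_one)
  qed (simp add: omin_dim_def)
  show "omin_dim d X = Some 0 \<longleftrightarrow> X \<noteq> {} \<and> finite X"
  proof (cases "X = {}")
    case False
    then show ?thesis using max max_ge K one unfolding omin_dim_def
      by (smt (verit) empty_iff insert_iff le_zero_eq option.inject subset_iff zero_neq_one)
  qed (simp add: omin_dim_def)
qed

end

section \<open>One-dimensional distributive lattices\<close>

text \<open>The length condition makes the splitting of a concatenation \<open>x @ y\<close>
  unique.\<close>

lemma def_rel_of_definable:
  fixes R :: "'a::linordered_field list \<Rightarrow> 'a list \<Rightarrow> bool"
  assumes "definable S (d + e) {x @ y |x y. R x y}" "\<And>x y. R x y \<Longrightarrow> length x = d"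
  shows "def_rel S d e R"
proof -
  have "map v [0..<d + e] \<in> {x @ y |x y. R x y} \<longleftrightarrow>
      R (map v [0..<d]) (map (\<lambda>n. v (n + d)) [0..<e])" for v :: "nat \<Rightarrow> 'a"
  proof -
    have "map v [0..<d + e] = map v [0..<d] @ map (\<lambda>n. v (n + d)) [0..<e]"
      by (auto simp: nth_append intro!: nth_equalityI)
    moreover have "map v [0..<d] @ map (\<lambda>n. v (n + d)) [0..<e] = x @ y \<longleftrightarrow>
        x = map v [0..<d] \<and> y = map (\<lambda>n. v (n + d)) [0..<e]" if "R x y" for x y
      using assms(2)[OF that] by (subst append_eq_append_conv) auto
    ultimately show ?thesis by auto
  qed
  then show ?thesis using definable_imp_def_pred[OF assms(1)] unfolding def_rel_def by simp
qed

lemma (in o_minimal_structure) def_pred_finite_list: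
  assumes "definable S e A" "def_pred S (\<lambda>v. P (map v [0..<e]) (\<lambda>n. v (n + e)))"
  shows "def_pred S (\<lambda>v. finite {y \<in> A. P y v})"
  using def_pred_not[OF def_pred_infinite_list[OF assms]] by simp

locale curve_lattice = o_minimal_structure S + bounded_lattice L
  for S :: "('f, 'r, 'a::linordered_field) expansion" and L :: "'a list gorder" (structure) +
  fixes d :: nat
  assumes distributive_L: "distributive L"
    and definable_order_L: "definable_order S d L"
    and dim_L: "omin_dim d (carrier L) = Some 1"

sublocale curve_lattice \<subseteq> definable_curve S d "carrier L"
  by unfold_locales (use definable_order_L dim_L in \<open>auto simp: definable_order_def\<close>)

context curve_lattice
begin

text \<open>Membership in the carrier is built in, because \<open>definable_order\<close> describes
  the order only there.\<close>

definition leq :: "'a list \<Rightarrow> 'a list \<Rightarrow> bool" where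
  "leq x y \<longleftrightarrow> x \<in> carrier L \<and> y \<in> carrier L \<and> x \<sqsubseteq> y"

lemma def_rel_leq: "def_rel S d d leq"
proof (rule def_rel_of_definable)
  show "definable S (d + d) {x @ y |x y. leq x y}"
    using definable_order_L unfolding definable_order_def leq_def by simp
qed (simp add: leq_def length_H)

lemmas leq_rules = def_rel_subst[OF def_rel_leq] def_list_block def_list_vars def_pred_list_eq[where d = d]
  def_pred_ball[OF definable_H] def_pred_bex[OF definable_H] def_list_const[OF length_H]

section \<open>Cancellation and finite intervals in distributive lattices\<close>

lemma meet_join_distrib:
  assumes "x \<in> carrier L" "y \<in> carrier L" "z \<in> carrier L"
  shows "x \<sqinter> (y \<squnion> z) = (x \<sqinter> y) \<squnion> (x \<sqinter> z)"
  using distributive_L assms unfolding distributive_def by blast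

lemma join_absorb: "x \<sqsubseteq> y \<Longrightarrow> x \<in> carrier L \<Longrightarrow> y \<in> carrier L \<Longrightarrow> x \<squnion> y = y"
  by (meson join_closed join_le join_right le_antisym le_refl)

lemma meet_absorb: "x \<sqsubseteq> y \<Longrightarrow> x \<in> carrier L \<Longrightarrow> y \<in> carrier L \<Longrightarrow> x \<sqinter> y = x"
  by (meson meet_closed meet_le meet_left le_antisym le_refl)

lemma join_mono_left:
  assumes "x \<sqsubseteq> y" "x \<in> carrier L" "y \<in> carrier L" "z \<in> carrier L"
  shows "x \<squnion> z \<sqsubseteq> y \<squnion> z"
proof (rule join_le)
  show "x \<sqsubseteq> y \<squnion> z" using assms by (intro le_trans[OF assms(1) join_left]) auto
qed (use assms join_right in auto)

lemma meet_mono_left: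
  assumes "x \<sqsubseteq> y" "x \<in> carrier L" "y \<in> carrier L" "z \<in> carrier L"
  shows "x \<sqinter> z \<sqsubseteq> y \<sqinter> z"
proof (rule meet_le)
  show "x \<sqinter> z \<sqsubseteq> y" using assms by (intro le_trans[OF meet_left assms(1)]) auto
qed (use assms meet_right in auto)

text \<open>Absorption writes \<open>x\<close> as \<open>x \<sqinter> (x \<squnion> z)\<close>;
  replacing the join and distributing gives an expression symmetric in \<open>x\<close> and
  \<open>y\<close>. The transfers of finiteness between intervals rest on this.\<close>

lemma distrib_cancel:
  assumes c: "x \<in> carrier L" "y \<in> carrier L" "z \<in> carrier L"
    and m: "x \<sqinter> z = y \<sqinter> z" and j: "x \<squnion> z = y \<squnion> z"
  shows "x = y"
proof -
  have "x = x \<sqinter> (x \<squnion> z)" using c by (simp add: meet_absorb join_left)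
  also have "\<dots> = (x \<sqinter> y) \<squnion> (x \<sqinter> z)" unfolding j using c by (simp add: meet_join_distrib)
  also have "\<dots> = (y \<sqinter> x) \<squnion> (y \<sqinter> z)" unfolding m by (simp add: meet_comm)
  also have "\<dots> = y \<sqinter> (x \<squnion> z)" using c by (simp add: meet_join_distrib)
  also have "\<dots> = y" unfolding j using c by (simp add: meet_absorb join_left)
  finally show ?thesis .
qed

lemma interval_iff: "z \<in> \<lbrace>a..b\<rbrace> \<longleftrightarrow> z \<in> carrier L \<and> a \<sqsubseteq> z \<and> z \<sqsubseteq> b"
  by (simp add: at_least_at_most_def)

lemma interval_mono:
  assumes "a' \<sqsubseteq> a" "b \<sqsubseteq> b'" "a \<in> carrier L" "b \<in> carrier L" "a' \<in> carrier L" "b' \<in> carrier L"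
  shows "\<lbrace>a..b\<rbrace> \<subseteq> \<lbrace>a'..b'\<rbrace>"
  using assms unfolding at_least_at_most_def by (auto intro: le_trans)

lemma definable_interval:
  assumes "a \<in> carrier L" "b \<in> carrier L"
  shows "definable S d \<lbrace>a..b\<rbrace>"
proof -
  have "\<lbrace>a..b\<rbrace> = {z \<in> carrier L. leq a z \<and> leq z b}"
    using assms unfolding at_least_at_most_def leq_def by auto
  also have "definable S d \<dots>"
    by (intro definable_subset[OF definable_H] def_rules leq_rules assms)
  finally show ?thesis .
qed

lemma dim_interval:
  assumes "a \<in> carrier L" "b \<in> carrier L"
  shows "omin_dim d \<lbrace>a..b\<rbrace> = Some 1 \<longleftrightarrow> infinite \<lbrace>a..b\<rbrace>"
    and "omin_dim d \<lbrace>a..b\<rbrace> = Some 0 \<longleftrightarrow> a \<sqsubseteq> b \<and> finite \<lbrace>a..b\<rbrace>"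
proof -
  have sub: "\<lbrace>a..b\<rbrace> \<subseteq> carrier L" by (auto simp: interval_iff)
  note dim = omin_dim_subset[OF definable_interval[OF assms] sub]
  show "omin_dim d \<lbrace>a..b\<rbrace> = Some 1 \<longleftrightarrow> infinite \<lbrace>a..b\<rbrace>" by (rule dim(1))
  have "\<lbrace>a..b\<rbrace> \<noteq> {} \<longleftrightarrow> a \<sqsubseteq> b"
    using assms by (auto simp: interval_iff intro: le_trans)
  then show "omin_dim d \<lbrace>a..b\<rbrace> = Some 0 \<longleftrightarrow> a \<sqsubseteq> b \<and> finite \<lbrace>a..b\<rbrace>" using dim(2) by simp
qed

text \<open>One half of the diamond isomorphism: on
  \<open>\<lbrace>y..y \<squnion> u\<rbrace>\<close> the join with \<open>u\<close> is constant, so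
  the meet with \<open>u\<close> is injective.\<close>

lemma finite_interval_join:
  assumes "y \<in> carrier L" "u \<in> carrier L" "finite \<lbrace>y \<sqinter> u..u\<rbrace>"
  shows "finite \<lbrace>y..y \<squnion> u\<rbrace>"
proof (rule inj_on_finite[OF _ _ assms(3)])
  show "inj_on (\<lambda>z. z \<sqinter> u) \<lbrace>y..y \<squnion> u\<rbrace>"
  proof (rule inj_onI)
    have join: "z \<squnion> u = y \<squnion> u" if "z \<in> \<lbrace>y..y \<squnion> u\<rbrace>" for z
    proof (rule le_antisym)
      show "z \<squnion> u \<sqsubseteq> y \<squnion> u"
        using that assms(1,2) unfolding interval_iff by (intro join_le) (auto intro: join_right)
      show "y \<squnion> u \<sqsubseteq> z \<squnion> u"
        using that assms(1,2) unfolding interval_iff by (intro join_mono_left) auto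
    qed (use that assms(1,2) in \<open>auto simp: interval_iff\<close>)
    fix z z' assume z: "z \<in> \<lbrace>y..y \<squnion> u\<rbrace>" "z' \<in> \<lbrace>y..y \<squnion> u\<rbrace>" and eq: "z \<sqinter> u = z' \<sqinter> u"
    have "z \<squnion> u = z' \<squnion> u" unfolding join[OF z(1)] join[OF z(2)] ..
    then show "z = z'" using z eq assms(2) by (intro distrib_cancel[of z z' u]) (simp_all add: interval_iff)
  qed
  show "(\<lambda>z. z \<sqinter> u) ` \<lbrace>y..y \<squnion> u\<rbrace> \<subseteq> \<lbrace>y \<sqinter> u..u\<rbrace>"
  proof safe
    fix z assume "z \<in> \<lbrace>y..y \<squnion> u\<rbrace>"
    then have z: "z \<in> carrier L" "y \<sqsubseteq> z" by (simp_all add: interval_iff)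
    have "y \<sqinter> u \<sqsubseteq> z \<sqinter> u"
      using z assms(1,2) by (intro meet_mono_left) auto
    then show "z \<sqinter> u \<in> \<lbrace>y \<sqinter> u..u\<rbrace>" using z assms(2) by (simp add: interval_iff meet_right)
  qed
qed

text \<open>The other half of the diamond isomorphism, with join and meet exchanged.\<close>

lemma finite_interval_meet:
  assumes "y \<in> carrier L" "u \<in> carrier L" "finite \<lbrace>u..y \<squnion> u\<rbrace>"
  shows "finite \<lbrace>y \<sqinter> u..y\<rbrace>"
proof (rule inj_on_finite[OF _ _ assms(3)])
  show "inj_on (\<lambda>z. z \<squnion> u) \<lbrace>y \<sqinter> u..y\<rbrace>"
  proof (rule inj_onI)
    have meet: "z \<sqinter> u = y \<sqinter> u" if "z \<in> \<lbrace>y \<sqinter> u..y\<rbrace>" for z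
    proof (rule le_antisym)
      show "y \<sqinter> u \<sqsubseteq> z \<sqinter> u"
        using that assms(1,2) unfolding interval_iff by (intro meet_le) (auto intro: meet_right)
      show "z \<sqinter> u \<sqsubseteq> y \<sqinter> u"
        using that assms(1,2) unfolding interval_iff by (intro meet_mono_left) auto
    qed (use that assms(1,2) in \<open>auto simp: interval_iff\<close>)
    fix z z' assume z: "z \<in> \<lbrace>y \<sqinter> u..y\<rbrace>" "z' \<in> \<lbrace>y \<sqinter> u..y\<rbrace>" and eq: "z \<squnion> u = z' \<squnion> u"
    have "z \<sqinter> u = z' \<sqinter> u" unfolding meet[OF z(1)] meet[OF z(2)] ..
    then show "z = z'" using z eq assms(2) by (intro distrib_cancel[of z z' u]) (simp_all add: interval_iff)
  qed
  show "(\<lambda>z. z \<squnion> u) ` \<lbrace>y \<sqinter> u..y\<rbrace> \<subseteq> \<lbrace>u..y \<squnion> u\<rbrace>"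
  proof safe
    fix z assume "z \<in> \<lbrace>y \<sqinter> u..y\<rbrace>"
    then have z: "z \<in> carrier L" "z \<sqsubseteq> y" by (simp_all add: interval_iff)
    have "z \<squnion> u \<sqsubseteq> y \<squnion> u"
      using z assms(1,2) by (intro join_mono_left) auto
    then show "z \<squnion> u \<in> \<lbrace>u..y \<squnion> u\<rbrace>" using z assms(2) by (simp add: interval_iff join_right)
  qed
qed

text \<open>Meet and join with the middle element embed the interval into the product of its two
  parts.\<close>

lemma finite_interval_trans:
  assumes c: "a \<in> carrier L" "b \<in> carrier L" "x \<in> carrier L" and le: "a \<sqsubseteq> b" "b \<sqsubseteq> x"
    and fin: "finite \<lbrace>a..b\<rbrace>" "finite \<lbrace>b..x\<rbrace>"
  shows "finite \<lbrace>a..x\<rbrace>"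
proof (rule inj_on_finite[OF _ _ finite_cartesian_product[OF fin]])
  show "inj_on (\<lambda>w. (w \<sqinter> b, w \<squnion> b)) \<lbrace>a..x\<rbrace>"
    using c by (auto intro!: inj_onI intro: distrib_cancel simp: interval_iff)
  show "(\<lambda>w. (w \<sqinter> b, w \<squnion> b)) ` \<lbrace>a..x\<rbrace> \<subseteq> \<lbrace>a..b\<rbrace> \<times> \<lbrace>b..x\<rbrace>"
    using c le by (auto simp: interval_iff intro: meet_le meet_right join_le join_right)
qed

section \<open>The principal chain and the principal projection\<close>

abbreviation C :: "'a list set" where "C \<equiv> principal_chain d L"

lemma principal_chain_iff:
  "x \<in> C \<longleftrightarrow> x \<in> carrier L \<and> (\<forall>y\<in>carrier L. y \<sqsubseteq> x \<and> y \<noteq> x \<longrightarrow> infinite \<lbrace>y..x\<rbrace>)"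
  unfolding principal_chain_def lless_eq using dim_interval(1) by auto

lemma C_subset: "C \<subseteq> carrier L" by (auto simp: principal_chain_iff)

lemma C_carrier: "x \<in> C \<Longrightarrow> x \<in> carrier L" using C_subset by blast

lemma definable_C: "definable S d C"
proof -
  have *: "\<lbrace>y..x\<rbrace> = {z \<in> carrier L. leq y z \<and> leq z x}" if "x \<in> carrier L" "y \<in> carrier L" for x y
    using that unfolding at_least_at_most_def leq_def by auto
  have "x \<in> C \<longleftrightarrow> x \<in> carrier L \<and> (\<forall>y\<in>carrier L. leq y x \<and> \<not> y = x \<longrightarrow>
      infinite {z \<in> carrier L. leq y z \<and> leq z x})" for x
  proof (cases "x \<in> carrier L")
    case True
    have "(y \<sqsubseteq> x \<and> y \<noteq> x \<longrightarrow> infinite \<lbrace>y..x\<rbrace>) \<longleftrightarrow> (leq y x \<and> \<not> y = x \<longrightarrow>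
      infinite {z \<in> carrier L. leq y z \<and> leq z x})" if "y \<in> carrier L" for y
      using *[OF True that] True that by (simp add: leq_def)
    then show ?thesis unfolding principal_chain_iff by blast
  qed (simp add: principal_chain_iff)
  then have "C = {x \<in> carrier L. \<forall>y\<in>carrier L. leq y x \<and> \<not> y = x \<longrightarrow>
      infinite {z \<in> carrier L. leq y z \<and> leq z x}}"
    by blast
  also have "definable S d \<dots>"
    by (intro definable_subset[OF definable_H] def_rules leq_rules
        def_pred_finite_list[OF definable_H])
  finally show ?thesis .
qed

text \<open>Expresses the join through the order alone, so that joins can occur in definable
  predicates.\<close>

lemma leq_joinI:
  "x \<in> carrier L \<Longrightarrow> y \<in> carrier L \<Longrightarrow> z = x \<squnion> y \<longleftrightarrow>
    leq x z \<and> leq y z \<and> (\<forall>w\<in>carrier L. leq x w \<and> leq y w \<longrightarrow> leq z w)"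
  unfolding leq_def using join_left[of x y] join_right[of x y] join_le[of x _ y] join_closed[of x y]
    le_antisym[of z "x \<squnion> y"] by blast

text \<open>
  Two incomparable elements of the chain would span, by taking joins, an infinite definable family
  of pairwise disjoint infinite subsets of \<open>H\<close>.
\<close>

lemma C_total:
  assumes "c \<in> C" "c' \<in> C"
  shows "c \<sqsubseteq> c' \<or> c' \<sqsubseteq> c"
proof (rule ccontr)
  assume *: "\<not> ?thesis"
  note cc = C_carrier[OF assms(1)] C_carrier[OF assms(2)]
  define a where "a = c \<sqinter> c'"
  have a: "a \<in> carrier L" "a \<sqsubseteq> c" "a \<sqsubseteq> c'" "a \<noteq> c" "a \<noteq> c'"
    using cc * meet_left[OF cc] meet_right[OF cc] unfolding a_def by auto
  have inf: "infinite \<lbrace>a..c\<rbrace>" "infinite \<lbrace>a..c'\<rbrace>"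
    using assms a unfolding principal_chain_iff by blast+
  \<comment> \<open>Distributivity splits \<open>b \<sqinter> (t \<squnion> z)\<close> into
    \<open>b \<sqinter> t = t\<close> and \<open>b \<sqinter> z = a\<close>, so \<open>t\<close> can
    be read off from \<open>t \<squnion> z\<close>.\<close>
  have recover: "b \<sqinter> (t \<squnion> z) = t"
    if "t \<in> \<lbrace>a..b\<rbrace>" "z \<in> \<lbrace>a..b'\<rbrace>" "b \<in> carrier L" "b' \<in> carrier L" "a = b \<sqinter> b'" for b b' t z
  proof -
    have tz: "t \<in> carrier L" "a \<sqsubseteq> t" "t \<sqsubseteq> b" "z \<in> carrier L" "a \<sqsubseteq> z" "z \<sqsubseteq> b'"
      using that by (simp_all add: interval_iff)
    have "a \<sqsubseteq> b" using that meet_left by simp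
    have "b \<sqinter> z \<sqsubseteq> a"
      unfolding that(5) using that(3,4) tz by (intro meet_le) (auto intro: meet_left meet_right le_trans)
    moreover have "a \<sqsubseteq> b \<sqinter> z" using that(3,4) tz a(1) \<open>a \<sqsubseteq> b\<close> by (intro meet_le) auto
    ultimately have "b \<sqinter> z = a" using that(3,4) tz a(1) by (intro le_antisym) auto
    moreover have "b \<sqinter> t = t" using that(3) tz meet_absorb[of t b] by (simp add: meet_comm)
    moreover have "t \<squnion> a = t" using a(1) tz join_absorb[of a t] by (simp add: join_comm)
    ultimately show ?thesis using that(3) tz by (simp add: meet_join_distrib)
  qed
  have left: "c \<sqinter> (t \<squnion> z) = t" if "t \<in> \<lbrace>a..c\<rbrace>" "z \<in> \<lbrace>a..c'\<rbrace>" for t z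
    by (rule recover[OF that cc a_def])
  have right: "c' \<sqinter> (t \<squnion> z) = z" if "t \<in> \<lbrace>a..c\<rbrace>" "z \<in> \<lbrace>a..c'\<rbrace>" for t z
    using recover[OF that(2,1) cc(2,1)] by (simp add: a_def meet_comm join_comm)
  \<comment> \<open>\<open>Q t\<close> consists of the joins of \<open>t\<close> with elements of
    \<open>\<lbrace>a..c'\<rbrace>\<close>, the join being replaced by its order-theoretic
    description.\<close>
  define Q where "Q t y \<longleftrightarrow> (\<exists>z\<in>carrier L. leq a z \<and> leq z c' \<and> leq t y \<and> leq z y \<and>
      (\<forall>w\<in>carrier L. leq t w \<and> leq z w \<longrightarrow> leq y w))" for t y
  have Q: "Q t y \<longleftrightarrow> (\<exists>z\<in>\<lbrace>a..c'\<rbrace>. y = t \<squnion> z)" if "t \<in> carrier L" for t y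
  proof -
    have "leq a z \<and> leq z c' \<longleftrightarrow> z \<in> \<lbrace>a..c'\<rbrace>" if "z \<in> carrier L" for z
      using a(1) cc(2) that by (simp add: leq_def interval_iff)
    then show ?thesis
      unfolding Q_def using leq_joinI[OF that] by (smt (verit, best) interval_iff)
  qed
  have "def_rel S d d Q"
    unfolding Q_def def_rel_def by (intro def_rules leq_rules a(1) cc(2))
  moreover have "infinite {y \<in> carrier L. Q t y}" if t: "t \<in> \<lbrace>a..c\<rbrace>" for t
  proof -
    have "inj_on (\<lambda>z. t \<squnion> z) \<lbrace>a..c'\<rbrace>" by (rule inj_on_inverseI) (rule right[OF t])
    then have "infinite ((\<lambda>z. t \<squnion> z) ` \<lbrace>a..c'\<rbrace>)" using inf(2) finite_imageD by blast
    moreover have "(\<lambda>z. t \<squnion> z) ` \<lbrace>a..c'\<rbrace> \<subseteq> {y \<in> carrier L. Q t y}"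
      using t Q by (auto simp: interval_iff)
    ultimately show ?thesis using infinite_super by blast
  qed
  ultimately obtain y where y: "infinite {t \<in> \<lbrace>a..c\<rbrace>. Q t y}"
    using infinite_fibers_overlap[OF _ definable_interval[OF a(1) cc(1)] inf(1)] by blast
  have "{t \<in> \<lbrace>a..c\<rbrace>. Q t y} \<subseteq> {c \<sqinter> y}"
    using Q left by (auto simp: interval_iff)
  then show False using y finite_subset by blast
qed

lemma exists_lower_bound:
  assumes "finite E" "E \<noteq> {}" "E \<subseteq> carrier L" "\<And>x y. x \<in> E \<Longrightarrow> y \<in> E \<Longrightarrow> x \<sqinter> y \<in> E"
  obtains z where "z \<in> E" "\<And>x. x \<in> E \<Longrightarrow> z \<sqsubseteq> x"
proof -
  have *: "\<exists>z\<in>E. \<forall>x\<in>F. z \<sqsubseteq> x" if "finite F" "F \<noteq> {}" "F \<subseteq> E" for F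
    using that
  proof (induction F rule: finite_ne_induct)
    case (singleton x)
    then show ?case using assms(3) le_refl by blast
  next
    case (insert x F)
    then obtain z where z: "z \<in> E" "\<forall>y\<in>F. z \<sqsubseteq> y" by auto
    have c: "x \<in> carrier L" "z \<in> carrier L" using insert.prems z(1) assms(3) by auto
    have "x \<sqinter> z \<sqsubseteq> y" if "y \<in> F" for y
      using z(2) that c meet_right[OF c] insert.prems assms(3) by (intro le_trans[of "x \<sqinter> z" z y]) auto
    then have "\<forall>y\<in>insert x F. x \<sqinter> z \<sqsubseteq> y" using meet_left[OF c] by simp
    moreover have "x \<sqinter> z \<in> E" using assms(4) insert.prems z(1) by simp
    ultimately show ?case by blast
  qed
  show thesis using *[OF assms(1,2) order_refl] that by blast
qed

text \<open>
  The candidates \<open>z\<close> form a filter below \<open>x\<close> with finite upper sections; if it were infinite, its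
  lower sections would all be infinite.
\<close>

lemma projection_exists:
  assumes x: "x \<in> carrier L"
  obtains c where "c \<in> C" "c \<sqsubseteq> x" "finite \<lbrace>c..x\<rbrace>"
proof -
  define E where "E = {z \<in> carrier L. z \<sqsubseteq> x \<and> finite \<lbrace>z..x\<rbrace>}"
  have meet_E: "z \<sqinter> z' \<in> E" if "z \<in> E" "z' \<in> E" for z z'
  proof -
    have z: "z \<in> carrier L" "z \<sqsubseteq> x" "finite \<lbrace>z..x\<rbrace>" and z': "z' \<in> carrier L" "z' \<sqsubseteq> x" "finite \<lbrace>z'..x\<rbrace>"
      using that by (simp_all add: E_def)
    have "\<lbrace>z'..z \<squnion> z'\<rbrace> \<subseteq> \<lbrace>z'..x\<rbrace>" using x z z' by (intro interval_mono) (auto intro: join_le)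
    then have "finite \<lbrace>z \<sqinter> z'..z\<rbrace>"
      using z z' by (intro finite_interval_meet) (auto intro: finite_subset)
    then have "finite \<lbrace>z \<sqinter> z'..x\<rbrace>"
      using x z z' by (intro finite_interval_trans[of "z \<sqinter> z'" z x]) (auto intro: meet_left)
    moreover have "z \<sqinter> z' \<sqsubseteq> x"
      using x z z' by (intro le_trans[of "z \<sqinter> z'" z x]) (auto intro: meet_left)
    ultimately show ?thesis using z z' by (simp add: E_def)
  qed
  have "x \<in> E"
  proof -
    have "\<lbrace>x..x\<rbrace> \<subseteq> {x}" using x by (auto simp: interval_iff)
    then show ?thesis using x finite_subset by (auto simp: E_def)
  qed
  have "finite E"
  proof (rule ccontr)
    assume inf: "infinite E"
    have "E = {z \<in> carrier L. leq z x \<and> \<not> infinite {w \<in> carrier L. leq z w \<and> leq w x}}"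
    proof -
      have "\<lbrace>z..x\<rbrace> = {w \<in> carrier L. leq z w \<and> leq w x}" if "z \<in> carrier L" for z
        using x that by (auto simp: interval_iff leq_def)
      then show ?thesis unfolding E_def using x by (auto simp: leq_def)
    qed
    also have "definable S d \<dots>"
      by (intro definable_subset[OF definable_H] def_rules leq_rules
          def_pred_finite_list[OF definable_H] x)
    finally have E: "definable S d E" .
    have "def_rel S d d (\<lambda>t y. y \<in> E \<and> leq y t)"
      unfolding def_rel_def by (intro def_rules leq_rules def_pred_mem[OF E])
    moreover have "infinite {y \<in> carrier L. y \<in> E \<and> leq y t}" if t: "t \<in> E" for t
    proof
      have tc: "t \<in> carrier L" "t \<sqsubseteq> x" using t by (simp_all add: E_def)
      assume fin: "finite {y \<in> carrier L. y \<in> E \<and> leq y t}"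
      \<comment> \<open>Every \<open>y\<close> in \<open>E\<close> lies above
        \<open>y \<sqinter> t\<close>, which is again in \<open>E\<close> and below
        \<open>t\<close>. A finite lower section would therefore cover \<open>E\<close> by finitely
        many finite intervals.\<close>
      have "E \<subseteq> (\<Union>w\<in>{y \<in> carrier L. y \<in> E \<and> leq y t}. \<lbrace>w..x\<rbrace>)"
      proof
        fix y assume y: "y \<in> E"
        then have yc: "y \<in> carrier L" "y \<sqsubseteq> x" by (simp_all add: E_def)
        have "y \<sqinter> t \<in> {y \<in> carrier L. y \<in> E \<and> leq y t}"
          using meet_E[OF y t] yc tc by (simp add: leq_def meet_right)
        moreover have "y \<in> \<lbrace>y \<sqinter> t..x\<rbrace>" using yc tc by (simp add: interval_iff meet_left)
        ultimately show "y \<in> (\<Union>w\<in>{y \<in> carrier L. y \<in> E \<and> leq y t}. \<lbrace>w..x\<rbrace>)" by blast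
      qed
      moreover have "finite (\<Union>w\<in>{y \<in> carrier L. y \<in> E \<and> leq y t}. \<lbrace>w..x\<rbrace>)"
        using fin by (auto simp: E_def)
      ultimately show False using inf finite_subset by blast
    qed
    \<comment> \<open>Overlap yields one \<open>y\<close> in \<open>E\<close> below infinitely many
      members of \<open>E\<close>, although all of these lie in the finite interval
      \<open>\<lbrace>y..x\<rbrace>\<close>.\<close>
    ultimately obtain y where y: "y \<in> carrier L" "infinite {t \<in> E. y \<in> E \<and> leq y t}"
      using infinite_fibers_overlap[OF _ E inf] by blast
    then have "y \<in> E" using not_finite_existsD by blast
    then have "finite \<lbrace>y..x\<rbrace>" by (simp add: E_def)
    moreover have "{t \<in> E. y \<in> E \<and> leq y t} \<subseteq> \<lbrace>y..x\<rbrace>"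
      by (auto simp: interval_iff leq_def E_def)
    ultimately show False using y(2) finite_subset by blast
  qed
  then obtain c where c: "c \<in> E" "\<And>z. z \<in> E \<Longrightarrow> c \<sqsubseteq> z"
    using exists_lower_bound[of E] \<open>x \<in> E\<close> meet_E by (auto simp: E_def)
  have cc: "c \<in> carrier L" "c \<sqsubseteq> x" "finite \<lbrace>c..x\<rbrace>" using c(1) by (simp_all add: E_def)
  \<comment> \<open>A finite interval would put \<open>y\<close> into \<open>E\<close>, strictly
    below its least element \<open>c\<close>.\<close>
  have "infinite \<lbrace>y..c\<rbrace>" if y: "y \<in> carrier L" "y \<sqsubseteq> c" "y \<noteq> c" for y
  proof
    assume "finite \<lbrace>y..c\<rbrace>"
    then have "finite \<lbrace>y..x\<rbrace>" using y cc x by (intro finite_interval_trans[of y c x])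
    moreover have "y \<sqsubseteq> x" using y cc x le_trans by blast
    ultimately have "c \<sqsubseteq> y" using c(2) y(1) by (simp add: E_def)
    then show False using y cc by auto
  qed
  then have "c \<in> C" using cc(1) by (simp add: principal_chain_iff)
  then show thesis using that cc by blast
qed

text \<open>If \<open>c' \<sqsubseteq> x\<close> but not \<open>c' \<sqsubseteq> c\<close>, totality
  puts \<open>c\<close> strictly below \<open>c'\<close>, and the infinite interval between them
  sits in the finite one from \<open>c\<close> to \<open>x\<close>.\<close>

lemma projection_greatest:
  assumes "x \<in> carrier L" "c \<in> C" "c \<sqsubseteq> x" "finite \<lbrace>c..x\<rbrace>" "c' \<in> C"
  shows "c' \<sqsubseteq> x \<longleftrightarrow> c' \<sqsubseteq> c"
proof
  assume "c' \<sqsubseteq> c"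
  then show "c' \<sqsubseteq> x" using assms C_carrier by (meson le_trans)
next
  assume "c' \<sqsubseteq> x"
  show "c' \<sqsubseteq> c"
  proof (rule ccontr)
    assume *: "\<not> c' \<sqsubseteq> c"
    then have "c \<sqsubseteq> c'" "c \<noteq> c'" using C_total[OF assms(2,5)] C_carrier[OF assms(2)] by auto
    then have "infinite \<lbrace>c..c'\<rbrace>" using assms(2,5) unfolding principal_chain_iff by blast
    moreover have "\<lbrace>c..c'\<rbrace> \<subseteq> \<lbrace>c..x\<rbrace>"
      using \<open>c' \<sqsubseteq> x\<close> assms C_carrier by (intro interval_mono) auto
    ultimately show False using assms(4) finite_subset by blast
  qed
qed

text \<open>The maximality clause of the definition follows from the finite interval by
  \<open>projection_greatest\<close>; what remains is free of the definite description.\<close>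

lemma principal_proj_eq_iff:
  assumes x: "x \<in> carrier L" and c: "c \<in> C"
  shows "principal_proj d L x = c \<longleftrightarrow> c \<sqsubseteq> x \<and> finite \<lbrace>c..x\<rbrace>"
proof -
  have pred: "b \<in> C \<and> omin_dim d \<lbrace>b..x\<rbrace> = Some 0 \<and> (\<forall>c'\<in>C. c' \<sqsubseteq> x \<longleftrightarrow> c' \<sqsubseteq> b) \<longleftrightarrow>
      b \<in> C \<and> b \<sqsubseteq> x \<and> finite \<lbrace>b..x\<rbrace>" for b
    using dim_interval(2)[OF C_carrier x] projection_greatest[OF x] by blast
  have unique: "b = b'" if "b \<in> C \<and> b \<sqsubseteq> x \<and> finite \<lbrace>b..x\<rbrace>" "b' \<in> C \<and> b' \<sqsubseteq> x \<and> finite \<lbrace>b'..x\<rbrace>"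
    for b b'
  proof (rule le_antisym)
    show "b \<sqsubseteq> b'" "b' \<sqsubseteq> b" using that projection_greatest[OF x] by blast+
  qed (use that C_carrier in auto)
  obtain b where b: "b \<in> C" "b \<sqsubseteq> x" "finite \<lbrace>b..x\<rbrace>" using projection_exists[OF x] by blast
  have "principal_proj d L x = b"
    unfolding principal_proj_def pred by (rule the_equality) (use b unique in blast)+
  then show ?thesis using b c unique by blast
qed

lemma principal_fiber_iff:
  assumes "x \<in> C"
  shows "z \<in> principal_fiber d L x \<longleftrightarrow> z \<in> carrier L \<and> x \<sqsubseteq> z \<and> finite \<lbrace>x..z\<rbrace>"
  unfolding principal_fiber_def using principal_proj_eq_iff[OF _ assms] by auto

text \<open>\<open>\<lbrace>y \<sqinter> u..u\<rbrace>\<close> lies in the finite interval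
  \<open>\<lbrace>x..u\<rbrace>\<close>, and the diamond isomorphism carries its finiteness over to
  \<open>\<lbrace>y..y \<squnion> u\<rbrace>\<close>. This makes gluing types well defined.\<close>

lemma join_in_fiber:
  assumes "x \<in> C" "y \<in> C" "x \<sqsubseteq> y" "u \<in> principal_fiber d L x"
  shows "y \<squnion> u \<in> principal_fiber d L y"
proof -
  note c = C_carrier[OF assms(1)] C_carrier[OF assms(2)]
  have u: "u \<in> carrier L" "x \<sqsubseteq> u" "finite \<lbrace>x..u\<rbrace>"
    using assms(4) principal_fiber_iff[OF assms(1)] by auto
  have "\<lbrace>y \<sqinter> u..u\<rbrace> \<subseteq> \<lbrace>x..u\<rbrace>" using c u assms(3) by (intro interval_mono) (auto intro: meet_le)
  then have "finite \<lbrace>y..y \<squnion> u\<rbrace>" using c u finite_subset by (intro finite_interval_join) auto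
  then show ?thesis using c u by (simp add: principal_fiber_iff[OF assms(2)] join_left)
qed

text \<open>The lattice interval from \<open>y\<close> to \<open>x\<close> is covered by the fibers
  over the chain points between them, and finitely many finite fibers cannot cover an infinite
  interval.\<close>

lemma C_dense:
  assumes fibers: "\<And>x. x \<in> C \<Longrightarrow> finite (principal_fiber d L x)"
    and "y \<in> C" "x \<in> C" "y \<sqsubseteq> x" "y \<noteq> x"
  shows "infinite {z \<in> C. y \<sqsubseteq> z \<and> z \<sqsubseteq> x}"
proof
  note c = C_carrier[OF assms(2)] C_carrier[OF assms(3)]
  assume fin: "finite {z \<in> C. y \<sqsubseteq> z \<and> z \<sqsubseteq> x}"
  have "\<lbrace>y..x\<rbrace> \<subseteq> (\<Union>z\<in>{z \<in> C. y \<sqsubseteq> z \<and> z \<sqsubseteq> x}. principal_fiber d L z)"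
  proof
    fix w assume "w \<in> \<lbrace>y..x\<rbrace>"
    then have w: "w \<in> carrier L" "y \<sqsubseteq> w" "w \<sqsubseteq> x" by (simp_all add: interval_iff)
    obtain b where b: "b \<in> C" "b \<sqsubseteq> w" "finite \<lbrace>b..w\<rbrace>" using projection_exists[OF w(1)] by blast
    have "y \<sqsubseteq> b" using projection_greatest[OF w(1) b assms(2)] w(2) by simp
    moreover have "b \<sqsubseteq> x" using le_trans[OF b(2) w(3)] b(1) w(1) c C_carrier by blast
    moreover have "w \<in> principal_fiber d L b" using b w by (simp add: principal_fiber_iff)
    ultimately show "w \<in> (\<Union>z\<in>{z \<in> C. y \<sqsubseteq> z \<and> z \<sqsubseteq> x}. principal_fiber d L z)"
      using b(1) by blast
  qed
  then have "finite \<lbrace>y..x\<rbrace>" using fin fibers finite_subset by (metis (no_types, lifting) finite_UN mem_Collect_eq)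
  moreover have "infinite \<lbrace>y..x\<rbrace>" using assms c unfolding principal_chain_iff by blast
  ultimately show False by blast
qed

end

section \<open>Definable chains\<close>

context o_minimal_structure
begin

text \<open>\<open>infinite_fibers_imp_box\<close> is applied to the pairs \<open>(x, s)\<close>
  such that \<open>P x\<close> holds all the way from \<open>x\<close> to \<open>s\<close>. A single
  \<open>s\<close> then serves all \<open>x\<close> in an interval, and it exceeds each of
  them.\<close>

lemma right_germ_uniform:
  assumes P: "def_pred S (\<lambda>v. P (v 0) (v (Suc 0)))"
    and inf: "infinite {x. u < x \<and> x < w \<and> (\<exists>s>x. \<forall>y. x < y \<and> y < s \<longrightarrow> P x y)}"
  obtains a b where "a < b" "\<And>x. a < x \<Longrightarrow> x < b \<Longrightarrow> u < x \<and> x < w"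
    "\<And>x y. a < x \<Longrightarrow> x < y \<Longrightarrow> y < b \<Longrightarrow> P x y"
proof -
  define B where "B x \<longleftrightarrow> u < x \<and> x < w \<and> (\<exists>s>x. \<forall>y. x < y \<and> y < s \<longrightarrow> P x y)" for x
  define X where "X x s \<longleftrightarrow> x < s \<and> (\<forall>y. x < y \<and> y < s \<longrightarrow> P x y)" for x s
  have B: "def_pred S (\<lambda>v. B (v 0))"
    unfolding B_def by (intro def_rules def_pred_subst_var2[of S P, OF P])
  have X: "def_pred S (\<lambda>v. X (v 0) (v (Suc 0)))"
    unfolding X_def by (intro def_rules def_pred_subst_var2[of S P, OF P])
  have infB: "infinite {x. B x}" using inf unfolding B_def .
  have infX: "infinite {s. X x s}" if "B x" for x
  proof -
    obtain s where s: "x < s" "\<forall>y. x < y \<and> y < s \<longrightarrow> P x y" using \<open>B x\<close> unfolding B_def by blast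
    then have "{x<..<s} \<subseteq> {s. X x s}" unfolding X_def by auto
    then show ?thesis using infinite_Ioo[OF s(1)] infinite_super by blast
  qed
  obtain a b c e where box: "a < b" "c < e"
    "\<And>x. a < x \<Longrightarrow> x < b \<Longrightarrow> B x"
    "\<And>x s. a < x \<Longrightarrow> x < b \<Longrightarrow> c < s \<Longrightarrow> s < e \<Longrightarrow> X x s"
    by (rule infinite_fibers_imp_box[where B = B and X = X, OF B X infB infX]) (assumption, blast)
  obtain s where s: "c < s" "s < e" using dense[OF box(2)] by blast
  have "P x y" if "a < x" "x < y" "y < b" for x y
  proof -
    have "X x s" "X y s" using box(4)[OF _ _ s] that by auto
    then show ?thesis unfolding X_def using that by blast
  qed
  then show thesis using that[of a b] box(1,3) unfolding B_def by blast
qed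

text \<open>On a right germ at \<open>x\<close> the predicate \<open>P x\<close> is true throughout
  or false throughout, and one of the two cases occurs for infinitely many \<open>x\<close>. This
  yields monotone parametrisations in the chain.\<close>

lemma eventually_monochromatic:
  assumes P: "def_pred S (\<lambda>v. P (v 0) (v (Suc 0)))" and "u < w"
  obtains a b where "a < b" "\<And>x. a < x \<Longrightarrow> x < b \<Longrightarrow> u < x \<and> x < w"
    "(\<forall>x y. a < x \<longrightarrow> x < y \<longrightarrow> y < b \<longrightarrow> P x y) \<or> (\<forall>x y. a < x \<longrightarrow> x < y \<longrightarrow> y < b \<longrightarrow> \<not> P x y)"
proof -
  let ?U = "\<lambda>P. {x. u < x \<and> x < w \<and> (\<exists>s>x. \<forall>y. x < y \<and> y < s \<longrightarrow> P x y)}"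
  have "{u<..<w} \<subseteq> ?U P \<union> ?U (\<lambda>x y. \<not> P x y)"
  proof
    fix x assume x: "x \<in> {u<..<w}"
    have "def_pred S (\<lambda>v. P x (v 0))" by (intro def_rules def_pred_subst_var2[of S P, OF P])
    then obtain s where "x < s" "(\<forall>y. x < y \<and> y < s \<longrightarrow> P x y) \<or> (\<forall>y. x < y \<and> y < s \<longrightarrow> \<not> P x y)"
      using right_germ[where P = "P x"] by blast
    then show "x \<in> ?U P \<union> ?U (\<lambda>x y. \<not> P x y)" using x by auto
  qed
  then have "infinite (?U P \<union> ?U (\<lambda>x y. \<not> P x y))"
    using infinite_Ioo[OF \<open>u < w\<close>] infinite_super by blast
  then consider "infinite (?U P)" | "infinite (?U (\<lambda>x y. \<not> P x y))" by auto
  then show thesis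
  proof cases
    case 1
    obtain a b where "a < b" "\<And>x. a < x \<Longrightarrow> x < b \<Longrightarrow> u < x \<and> x < w"
      "\<And>x y. a < x \<Longrightarrow> x < y \<Longrightarrow> y < b \<Longrightarrow> P x y"
      using right_germ_uniform[OF P 1] by blast
    then show thesis using that[of a b] by blast
  next
    case 2
    have "def_pred S (\<lambda>v. \<not> P (v 0) (v (Suc 0)))" by (intro def_rules P)
    then obtain a b where "a < b" "\<And>x. a < x \<Longrightarrow> x < b \<Longrightarrow> u < x \<and> x < w"
      "\<And>x y. a < x \<Longrightarrow> x < y \<Longrightarrow> y < b \<Longrightarrow> \<not> P x y"
      using right_germ_uniform[where P = "\<lambda>x y. \<not> P x y", OF _ 2] by blast
    then show thesis using that[of a b] by blast
  qed
qed

end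

section \<open>Dense definable linear orders inside a curve\<close>

locale definable_chain = definable_curve S d H
  for S :: "('f, 'r, 'a::linordered_field) expansion" and d H +
  fixes C :: "'a list set" and le :: "'a list \<Rightarrow> 'a list \<Rightarrow> bool" (infix \<open>\<preceq>\<close> 50)
  assumes definable_C: "definable S d C"
    and C_subset: "C \<subseteq> H"
    and def_rel_le: "def_rel S d d (\<preceq>)"
    and le_C: "x \<preceq> y \<Longrightarrow> x \<in> C \<and> y \<in> C"
    and refl: "x \<in> C \<Longrightarrow> x \<preceq> x"
    and trans: "x \<preceq> y \<Longrightarrow> y \<preceq> z \<Longrightarrow> x \<preceq> z"
    and antisym: "x \<preceq> y \<Longrightarrow> y \<preceq> x \<Longrightarrow> x = y"
    and total: "x \<in> C \<Longrightarrow> y \<in> C \<Longrightarrow> x \<preceq> y \<or> y \<preceq> x"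
    and infinite_between: "x \<preceq> y \<Longrightarrow> x \<noteq> y \<Longrightarrow> infinite {z. x \<preceq> z \<and> z \<preceq> y}"
begin

lemma length_C: "x \<in> C \<Longrightarrow> length x = d"
  using C_subset length_H by blast

lemma between_exists:
  assumes "x \<preceq> y" "x \<noteq> y"
  obtains z where "x \<preceq> z" "z \<preceq> y" "z \<noteq> x" "z \<noteq> y"
proof -
  have "infinite ({z. x \<preceq> z \<and> z \<preceq> y} - {x, y})" using infinite_between[OF assms] by simp
  then have "{z. x \<preceq> z \<and> z \<preceq> y} - {x, y} \<noteq> {}" by (metis finite.emptyI)
  then show thesis using that by blast
qed

lemmas chain_rules = def_rel_subst[OF def_rel_le] def_list_block def_list_vars
  def_pred_list_eq[where d = d]
  def_pred_ball[OF definable_C] def_pred_bex[OF definable_C]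
  def_pred_mem[OF definable_C] def_list_const[OF length_C]

lemma finite_has_min:
  assumes "finite F" "F \<noteq> {}" "F \<subseteq> C"
  shows "\<exists>m\<in>F. \<forall>x\<in>F. m \<preceq> x"
  using assms
proof (induction F rule: finite_ne_induct)
  case (singleton x)
  then show ?case using refl by auto
next
  case (insert x F)
  then obtain m where m: "m \<in> F" "\<forall>y\<in>F. m \<preceq> y" by auto
  then consider "x \<preceq> m" | "m \<preceq> x" using total[of x m] insert.prems by auto
  then show ?case
  proof cases
    case 1
    then show ?thesis using m trans refl insert.prems by (intro bexI[of _ x]) auto
  next
    case 2
    then show ?thesis using m by (intro bexI[of _ m]) auto
  qed
qed

text \<open>
  Each point of \<open>C\<close> in the convex hull of a monotonically parametrised set \<open>B\<close> lies in a cut of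
  \<open>B\<close> at some parameter; infinite cuts are pairwise disjoint, so only finitely many exist, and the
  finite ones are trivial by density.
\<close>

lemma monotone_segment:
  assumes B: "definable S d B" "B \<subseteq> C" and i: "i < d" and "u < w"
    and bd: "\<And>z. z \<in> B \<Longrightarrow> u < z ! i \<and> z ! i < w"
    and onto: "\<And>r. u < r \<Longrightarrow> r < w \<Longrightarrow> \<exists>z\<in>B. z ! i = r"
    and inj: "\<And>z z'. z \<in> B \<Longrightarrow> z' \<in> B \<Longrightarrow> z ! i = z' ! i \<Longrightarrow> z = z'"
    and mono: "\<And>z z'. z \<in> B \<Longrightarrow> z' \<in> B \<Longrightarrow> z ! i < z' ! i \<Longrightarrow> z \<preceq> z'"
  shows "\<exists>p\<in>B. \<exists>q\<in>B. p \<preceq> q \<and> p \<noteq> q \<and> (\<forall>z. p \<preceq> z \<and> z \<preceq> q \<longrightarrow> z \<in> B)"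
proof -
  \<comment> \<open>\<open>Q t z\<close> says that \<open>z\<close> lies in the cut of
    \<open>B\<close> at the parameter of \<open>t\<close>: above all members with smaller and below
    all members with larger parameter.\<close>
  define Q where "Q t z \<longleftrightarrow> z \<in> C \<and> (\<forall>x\<in>B. (x ! i < t ! i \<longrightarrow> x \<preceq> z) \<and> (t ! i < x ! i \<longrightarrow> z \<preceq> x))"
    for t z
  have Q: "def_rel S d d Q"
    unfolding def_rel_def Q_def
    by (intro def_rules def_pred_ball[OF B(1)] chain_rules def_term_nth[OF def_list_block]
        def_term_nth[OF def_list_vars] i)
  define T where "T = {t \<in> B. infinite {z \<in> H. Q t z}}"
  have T: "definable S d T"
    unfolding T_def
    by (intro definable_subset[OF B(1)] def_pred_infinite_list[OF definable_H]
        def_rel_subst[OF Q] chain_rules)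
  \<comment> \<open>Two members of \<open>B\<close> with distinct parameters strictly between those
    of \<open>t\<close> and \<open>t'\<close> separate the cuts.\<close>
  have disjoint: False if t: "t \<in> B" "t' \<in> B" "t ! i < t' ! i" and y: "Q t y" "Q t' y" for t t' y
  proof -
    obtain c where c: "t ! i < c" "c < t' ! i" using dense[OF t(3)] by blast
    obtain c' where c': "c < c'" "c' < t' ! i" using dense[OF c(2)] by blast
    obtain e where e: "e \<in> B" "e ! i = c" using onto[of c] bd[OF t(1)] bd[OF t(2)] c by force
    obtain e' where e': "e' \<in> B" "e' ! i = c'" using onto[of c'] bd[OF t(1)] bd[OF t(2)] c c' by force
    have "y \<preceq> e" using y(1) e c unfolding Q_def by blast
    moreover have "e' \<preceq> y" using y(2) e' c' unfolding Q_def by blast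
    moreover have "e \<preceq> e'" using mono e e' c' by blast
    ultimately have "e = e'" using trans antisym by blast
    then show False using e e' c' by simp
  qed
  have "finite T"
  proof (rule ccontr)
    assume "infinite T"
    then obtain y where "infinite {t \<in> T. Q t y}"
      using infinite_fibers_overlap[OF Q T] unfolding T_def by blast
    moreover have "{t \<in> T. Q t y} \<subseteq> {t}" if "t \<in> {t \<in> T. Q t y}" for t
    proof
      fix t' assume "t' \<in> {t \<in> T. Q t y}"
      then have t: "t \<in> B" "t' \<in> B" "Q t y" "Q t' y" using \<open>t \<in> {t \<in> T. Q t y}\<close> by (auto simp: T_def)
      then have "t ! i = t' ! i" using disjoint by (metis linorder_neqE)
      then show "t' \<in> {t}" using inj t by blast
    qed
    ultimately show False by (metis (no_types, lifting) finite.emptyI finite_insert finite_subset ex_in_conv)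
  qed
  define R where "R r \<longleftrightarrow> u < r \<and> r < w \<and> \<not> (\<exists>t\<in>T. t ! i = r)" for r
  have "infinite ({u<..<w} - (\<lambda>t. t ! i) ` T)" using infinite_Ioo[OF \<open>u < w\<close>] \<open>finite T\<close> by simp
  also have "{u<..<w} - (\<lambda>t. t ! i) ` T = {r. R r}" unfolding R_def by auto
  finally have infR: "infinite {r. R r}" .
  have "def_pred S (\<lambda>v. R (v 0))"
    unfolding R_def by (intro def_rules def_pred_bex[OF T] def_term_nth[OF def_list_block] i)
  then obtain u' w' where uw: "u' < w'" "\<And>r. u' < r \<Longrightarrow> r < w' \<Longrightarrow> R r"
    using infinite_imp_interval[where P = R] infR by blast
  \<comment> \<open>A cut is convex and contains \<open>t\<close>, so by density a second point
    would make it infinite.\<close>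
  have trivial: "z = t" if t: "t \<in> B" "u' < t ! i" "t ! i < w'" and z: "Q t z" for t z
  proof (rule ccontr)
    assume "z \<noteq> t"
    have "t \<notin> T" using uw(2)[OF t(2,3)] unfolding R_def by blast
    then have fin: "finite {z \<in> H. Q t z}" using t(1) unfolding T_def by blast
    have zC: "z \<in> C" using z unfolding Q_def by blast
    have Qt: "Q t t" unfolding Q_def using t(1) B(2) mono by blast
    have conv: "Q t a" if "Q t x" "Q t y" "x \<preceq> a" "a \<preceq> y" for a x y
      using that le_C trans unfolding Q_def by meson
    consider "z \<preceq> t" | "t \<preceq> z" using total[of z t] zC t(1) B(2) by auto
    then show False
    proof cases
      case 1
      have "{a. z \<preceq> a \<and> a \<preceq> t} \<subseteq> {z \<in> H. Q t z}" using conv[OF z Qt] le_C C_subset by blast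
      then show ?thesis using infinite_between[OF 1 \<open>z \<noteq> t\<close>] fin finite_subset by blast
    next
      case 2
      have "{a. t \<preceq> a \<and> a \<preceq> z} \<subseteq> {z \<in> H. Q t z}" using conv[OF Qt z] le_C C_subset by blast
      then show ?thesis using infinite_between[OF 2 \<open>z \<noteq> t\<close>[symmetric]] fin finite_subset by blast
    qed
  qed
  obtain c1 where c1: "u' < c1" "c1 < w'" using dense[OF uw(1)] by blast
  obtain c2 where c2: "c1 < c2" "c2 < w'" using dense[OF c1(2)] by blast
  have "R c1" "R c2" using uw(2) c1 c2 by auto
  then obtain p q where p: "p \<in> B" "p ! i = c1" and q: "q \<in> B" "q ! i = c2"
    unfolding R_def using onto by blast
  have "z \<in> B" if z: "p \<preceq> z" "z \<preceq> q" for z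
  proof -
    have zC: "z \<in> C" using z le_C by blast
    have le_c2: "x ! i \<le> c2" if x: "x \<in> B" "x \<preceq> z" for x
    proof (rule ccontr)
      assume "\<not> x ! i \<le> c2"
      then have "q \<preceq> x" "q \<noteq> x" using mono[of q x] q x by auto
      then show False using x z trans antisym by blast
    qed
    \<comment> \<open>\<open>c\<close> will be the supremum of the parameters of the members of
      \<open>B\<close> below \<open>z\<close>. Then \<open>z\<close> lies in the cut at
      \<open>c\<close>, which is trivial, so \<open>z\<close> is the member of \<open>B\<close> with
      parameter \<open>c\<close>.\<close>
    have "def_pred S (\<lambda>v. \<exists>x\<in>B. x ! i = v 0 \<and> x \<preceq> z)"
      by (intro def_rules def_pred_bex[OF B(1)] chain_rules def_term_nth[OF def_list_block] i zC)
    then have "\<exists>s. (\<forall>r. (\<exists>x\<in>B. x ! i = r \<and> x \<preceq> z) \<longrightarrow> r \<le> s) \<and>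
        (\<forall>u. (\<forall>r. (\<exists>x\<in>B. x ! i = r \<and> x \<preceq> z) \<longrightarrow> r \<le> u) \<longrightarrow> s \<le> u)"
      by (rule lub_exists[where P = "\<lambda>r. \<exists>x\<in>B. x ! i = r \<and> x \<preceq> z" and a = c1 and u = c2])
        (use p z le_c2 in auto)
    then obtain c where c: "\<And>x. x \<in> B \<Longrightarrow> x \<preceq> z \<Longrightarrow> x ! i \<le> c"
      "\<And>u. (\<And>x. x \<in> B \<Longrightarrow> x \<preceq> z \<Longrightarrow> x ! i \<le> u) \<Longrightarrow> c \<le> u" by blast
    have c_bd: "c1 \<le> c" "c \<le> c2" using c(1)[OF p(1) z(1)] p(2) c(2)[of c2] le_c2 by auto
    then have c_uw: "u' < c" "c < w'" using c1 c2 by auto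
    then obtain t where t: "t \<in> B" "t ! i = c" using uw(2) onto unfolding R_def by blast
    have "Q t z"
      unfolding Q_def
    proof (intro conjI ballI impI zC)
      fix x assume x: "x \<in> B"
      {
        assume "x ! i < t ! i"
        then have "\<not> c \<le> x ! i" using t by simp
        then obtain x' where "x' \<in> B" "x' \<preceq> z" "x ! i < x' ! i" using c(2)[of "x ! i"] not_le by blast
        then show "x \<preceq> z" using mono[OF x] trans by blast
      }
      {
        assume "t ! i < x ! i"
        then have "\<not> x \<preceq> z" using c(1)[OF x] t by auto
        then show "z \<preceq> x" using total[of x z] x B(2) zC by blast
      }
    qed
    then have "z = t" using trivial t c_uw by simp
    then show ?thesis using t by simp
  qed
  moreover have "p \<preceq> q" "p \<noteq> q" using mono p q c2 by auto
  ultimately show ?thesis using p q by blast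
qed

end

text \<open>Reduces decreasing parametrisations to increasing ones.\<close>

lemma (in definable_chain) dual_chain: "definable_chain S d H C (\<lambda>x y. y \<preceq> x)"
proof unfold_locales
  show "def_rel S d d (\<lambda>x y. y \<preceq> x)"
    unfolding def_rel_def by (intro chain_rules)
  show "infinite {z. z \<preceq> x \<and> y \<preceq> z}" if "y \<preceq> x" "x \<noteq> y" for x y
  proof -
    have "{z. z \<preceq> x \<and> y \<preceq> z} = {z. y \<preceq> z \<and> z \<preceq> x}" by blast
    then show ?thesis using infinite_between[OF that(1)] that(2) by simp
  qed
qed (use definable_C C_subset le_C refl trans antisym total in blast)+

context definable_chain
begin

text \<open>Over all but finitely many values of a suitable coordinate \<open>i\<close> the fibers
  are finite, so taking least points gives a definable section. On a smaller interval its
  parametrisation by \<open>i\<close> is increasing or decreasing, and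
  \<open>monotone_segment\<close> applies to the order or to its dual.\<close>

lemma exists_segment:
  assumes A: "definable S d A" "A \<subseteq> C" and inf: "infinite A"
  shows "\<exists>p\<in>A. \<exists>q\<in>A. p \<preceq> q \<and> p \<noteq> q \<and> (\<forall>z. p \<preceq> z \<and> z \<preceq> q \<longrightarrow> z \<in> A)"
proof -
  obtain i where i: "i < d" "infinite {c. \<exists>x\<in>A. x ! i = c}"
    using infinite_iff_projection[OF definable_length[OF A(1)]] inf by blast
  define F where "F = {r. infinite {y \<in> H. y ! i = r}}"
  have "finite F" unfolding F_def by (rule finite_coordinate_fibers[OF i(1)])
  define R where "R r \<longleftrightarrow> (\<exists>x\<in>A. x ! i = r) \<and> (\<forall>f\<in>F. \<not> r = f)" for r
  have "infinite ({c. \<exists>x\<in>A. x ! i = c} - F)" using i(2) \<open>finite F\<close> by simp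
  also have "{c. \<exists>x\<in>A. x ! i = c} - F = {r. R r}" unfolding R_def by auto
  finally have infR: "infinite {r. R r}" .
  have "def_pred S (\<lambda>v. R (v 0))"
    unfolding R_def
    by (intro def_rules def_pred_bex[OF A(1)] def_term_nth[OF def_list_block] i(1)
        def_pred_finite_ball \<open>finite F\<close>)
  then obtain u w where uw: "u < w" "\<And>r. u < r \<Longrightarrow> r < w \<Longrightarrow> R r"
    using infinite_imp_interval[where P = R] infR by blast
  define B where "B = {z \<in> A. u < z ! i \<and> z ! i < w \<and> (\<forall>z'\<in>A. z' ! i = z ! i \<longrightarrow> z \<preceq> z')}"
  have B: "definable S d B"
    unfolding B_def
    by (intro definable_subset[OF A(1)] def_rules def_pred_ball[OF A(1)] chain_rules
        def_term_nth[OF def_list_block] def_term_nth[OF def_list_vars] i(1))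
  have onto: "\<exists>z\<in>B. z ! i = r" if r: "u < r" "r < w" for r
  proof -
    have "R r" using uw(2) r by blast
    then have "finite {y \<in> H. y ! i = r}" "{y \<in> A. y ! i = r} \<noteq> {}"
      unfolding R_def F_def by auto
    moreover have "{y \<in> A. y ! i = r} \<subseteq> {y \<in> H. y ! i = r}" "{y \<in> A. y ! i = r} \<subseteq> C"
      using A(2) C_subset by blast+
    ultimately obtain m where "m \<in> {y \<in> A. y ! i = r}" "\<forall>x\<in>{y \<in> A. y ! i = r}. m \<preceq> x"
      using finite_has_min[of "{y \<in> A. y ! i = r}"] finite_subset by blast
    then show ?thesis using r unfolding B_def by blast
  qed
  have inj: "z = z'" if "z \<in> B" "z' \<in> B" "z ! i = z' ! i" for z z'
    using that antisym unfolding B_def by auto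
  define P where "P x y \<longleftrightarrow> (\<exists>z\<in>B. \<exists>z'\<in>B. z ! i = x \<and> z' ! i = y \<and> z \<preceq> z')" for x y
  have "def_pred S (\<lambda>v. P (v 0) (v (Suc 0)))"
    unfolding P_def
    by (intro def_rules def_pred_bex[OF B] chain_rules def_term_nth[OF def_list_block]
        def_term_nth[OF def_list_vars] i(1))
  then obtain a b where ab: "a < b" "\<And>x. a < x \<Longrightarrow> x < b \<Longrightarrow> u < x \<and> x < w"
    "(\<forall>x y. a < x \<longrightarrow> x < y \<longrightarrow> y < b \<longrightarrow> P x y) \<or> (\<forall>x y. a < x \<longrightarrow> x < y \<longrightarrow> y < b \<longrightarrow> \<not> P x y)"
    using eventually_monochromatic[where P = P, OF _ uw(1)] by blast
  define B' where "B' = {z \<in> B. a < z ! i \<and> z ! i < b}"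
  have B': "definable S d B'"
    unfolding B'_def
    by (intro definable_subset[OF B] def_rules def_term_nth[OF def_list_block] i(1))
  have sub: "B' \<subseteq> C" "B' \<subseteq> A" using A(2) unfolding B'_def B_def by auto
  have onto': "\<exists>z\<in>B'. z ! i = r" if "a < r" "r < b" for r
    using onto[of r] ab(2) that unfolding B'_def by blast
  have bd': "a < z ! i \<and> z ! i < b" if "z \<in> B'" for z using that unfolding B'_def by blast
  have inj': "z = z'" if "z \<in> B'" "z' \<in> B'" "z ! i = z' ! i" for z z'
    using that inj unfolding B'_def by blast
  have P_iff: "P (z ! i) (z' ! i) \<longleftrightarrow> z \<preceq> z'" if "z \<in> B'" "z' \<in> B'" for z z'
    using that inj unfolding P_def B'_def by blast
  from ab(3) show ?thesis
  proof
    assume "\<forall>x y. a < x \<longrightarrow> x < y \<longrightarrow> y < b \<longrightarrow> P x y"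
    then have "z \<preceq> z'" if "z \<in> B'" "z' \<in> B'" "z ! i < z' ! i" for z z'
      using P_iff[OF that(1,2)] that(3) bd'[OF that(1)] bd'[OF that(2)] by blast
    from monotone_segment[OF B' sub(1) i(1) ab(1) bd' onto' inj' this]
    show ?thesis using sub(2) by blast
  next
    assume *: "\<forall>x y. a < x \<longrightarrow> x < y \<longrightarrow> y < b \<longrightarrow> \<not> P x y"
    have "z' \<preceq> z" if "z \<in> B'" "z' \<in> B'" "z ! i < z' ! i" for z z'
    proof -
      have "\<not> z \<preceq> z'" using * P_iff[OF that(1,2)] that(3) bd'[OF that(1)] bd'[OF that(2)] by blast
      then show ?thesis using total[of z z'] that sub(1) by blast
    qed
    from definable_chain.monotone_segment[OF dual_chain B' sub(1) i(1) ab(1) bd' onto' inj' this]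
    show ?thesis using sub(2) by blast
  qed
qed

end

section \<open>Suprema in the completion and convex equivalence relations\<close>

locale completed_chain = definable_chain S d H C le
  for S :: "('f, 'r, 'a::linordered_field) expansion" and d H C and le (infix \<open>\<preceq>\<close> 50) +
  fixes m :: nat and D :: "'a list gorder" and \<iota> :: "'a list \<Rightarrow> 'a list"
  assumes total_D: "total_order D" and definable_D: "definable_order S m D"
    and \<iota>_D: "x \<in> C \<Longrightarrow> \<iota> x \<in> carrier D"
    and \<iota>_graph: "definable S (d + m) {x @ \<iota> x |x. x \<in> C}"
    and \<iota>_le: "x \<in> C \<Longrightarrow> y \<in> C \<Longrightarrow> \<iota> x \<sqsubseteq>\<^bsub>D\<^esub> \<iota> y \<longleftrightarrow> x \<preceq> y"
    and sup_exists: "definable S d A \<Longrightarrow> A \<subseteq> C \<Longrightarrow> \<exists>s. least D s (Upper D (\<iota> ` A))"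
begin

sublocale D: total_order D by (rule total_D)

lemma definable_carrier_D: "definable S m (carrier D)"
  using definable_D unfolding definable_order_def by blast

lemma def_rel_D: "def_rel S m m (\<lambda>s t. s \<in> carrier D \<and> t \<in> carrier D \<and> s \<sqsubseteq>\<^bsub>D\<^esub> t)"
proof (rule def_rel_of_definable)
  show "definable S (m + m) {x @ y |x y. x \<in> carrier D \<and> y \<in> carrier D \<and> x \<sqsubseteq>\<^bsub>D\<^esub> y}"
    using definable_D unfolding definable_order_def by blast
qed (use definable_length[OF definable_carrier_D] in blast)

lemma def_rel_\<iota>: "def_rel S d m (\<lambda>x s. x \<in> C \<and> s = \<iota> x)"
proof (rule def_rel_of_definable)
  have "{x @ s |x s. x \<in> C \<and> s = \<iota> x} = {x @ \<iota> x |x. x \<in> C}" by blast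
  then show "definable S (d + m) {x @ s |x s. x \<in> C \<and> s = \<iota> x}" using \<iota>_graph by simp
qed (use length_C in blast)

definition below :: "'a list \<Rightarrow> 'a list \<Rightarrow> bool" where
  "below x s \<longleftrightarrow> x \<in> C \<and> s \<in> carrier D \<and> \<iota> x \<sqsubseteq>\<^bsub>D\<^esub> s"

lemma def_rel_below: "def_rel S d m below"
proof -
  have "below x s \<longleftrightarrow> (\<exists>t\<in>carrier D. (x \<in> C \<and> t = \<iota> x) \<and> (t \<in> carrier D \<and> s \<in> carrier D \<and> t \<sqsubseteq>\<^bsub>D\<^esub> s))"
    for x s
    unfolding below_def using \<iota>_D by blast
  then show ?thesis
    unfolding def_rel_def
    by (simp only:) (intro def_pred_bex[OF definable_carrier_D] def_pred_conj def_rel_subst[OF def_rel_\<iota>]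
        def_rel_subst[OF def_rel_D] def_list_block def_list_vars)
qed

text \<open>The least upper bound in \<open>D\<close> of the image of \<open>A\<close>, spelled out
  with quantifiers so that it can enter formulas.\<close>

definition is_sup :: "'a list set \<Rightarrow> 'a list \<Rightarrow> bool" where
  "is_sup A s \<longleftrightarrow> s \<in> carrier D \<and> (\<forall>x\<in>A. \<iota> x \<sqsubseteq>\<^bsub>D\<^esub> s) \<and>
     (\<forall>t\<in>carrier D. (\<forall>x\<in>A. \<iota> x \<sqsubseteq>\<^bsub>D\<^esub> t) \<longrightarrow> s \<sqsubseteq>\<^bsub>D\<^esub> t)"

lemma is_sup_exists:
  assumes "definable S d A" "A \<subseteq> C"
  obtains s where "is_sup A s"
proof -
  obtain s where "least D s (Upper D (\<iota> ` A))" using sup_exists[OF assms] by blast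
  moreover have "Upper D (\<iota> ` A) = {u \<in> carrier D. \<forall>x\<in>A. \<iota> x \<sqsubseteq>\<^bsub>D\<^esub> u}"
    using assms(2) \<iota>_D unfolding Upper_def by blast
  ultimately have "is_sup A s" unfolding least_def is_sup_def by simp
  then show thesis using that by blast
qed

lemma is_sup_unique: "is_sup A s \<Longrightarrow> is_sup A t \<Longrightarrow> s = t"
  unfolding is_sup_def by (blast intro: D.le_antisym)

text \<open>The restriction to pairs \<open>x \<preceq> y\<close> of an equivalence relation with convex classes.\<close>

definition convex_rel :: "('a list \<Rightarrow> 'a list \<Rightarrow> bool) \<Rightarrow> bool" where
  "convex_rel P \<longleftrightarrow> (\<forall>x y. P x y \<longrightarrow> x \<preceq> y) \<and> (\<forall>x\<in>C. P x x) \<and>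
     (\<forall>x y a b. P x y \<longrightarrow> x \<preceq> a \<longrightarrow> a \<preceq> b \<longrightarrow> b \<preceq> y \<longrightarrow> P a b) \<and>
     (\<forall>x y z. P x y \<longrightarrow> P y z \<longrightarrow> P x z)"

text \<open>Bounds the number of points with finite class: an infinite definable set of such points
  would contain two equivalent ones, and density would make their class infinite.\<close>

definition hits_infinite_sets :: "('a list \<Rightarrow> 'a list \<Rightarrow> bool) \<Rightarrow> bool" where
  "hits_infinite_sets P \<longleftrightarrow>
     (\<forall>A. definable S d A \<longrightarrow> A \<subseteq> C \<longrightarrow> infinite A \<longrightarrow> (\<exists>p\<in>A. \<exists>q\<in>A. p \<noteq> q \<and> P p q))"

text \<open>
  Infinite classes are distinguished by their suprema, which form an index set of a definable
  family of disjoint infinite sets.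
\<close>

lemma finite_convex_classes:
  assumes P: "def_rel S d d P" and conv: "convex_rel P" and hit: "hits_infinite_sets P"
  defines "K \<equiv> \<lambda>x. {z. P x z \<or> P z x}"
  shows "finite (K ` C)" "\<And>x. x \<in> C \<Longrightarrow> x \<in> K x" "\<And>x. definable S d (K x)" "\<And>x. K x \<subseteq> C"
    "\<And>x y z. y \<in> K x \<Longrightarrow> z \<in> K x \<Longrightarrow> y \<preceq> z \<Longrightarrow> P y z"
    "\<And>x y. y \<in> K x \<Longrightarrow> K y = K x"
    "\<And>x y z a. y \<in> K x \<Longrightarrow> z \<in> K x \<Longrightarrow> y \<preceq> a \<Longrightarrow> a \<preceq> z \<Longrightarrow> a \<in> K x"
proof -
  have P_le: "x \<preceq> y" if "P x y" for x y using conv that unfolding convex_rel_def by blast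
  have P_refl: "P x x" if "x \<in> C" for x using conv that unfolding convex_rel_def by blast
  have P_mono: "P a b" if "P x y" "x \<preceq> a" "a \<preceq> b" "b \<preceq> y" for x y a b
    using conv that unfolding convex_rel_def by blast
  have P_glue: "P x z" if "P x y" "P y z" for x y z
    using conv that unfolding convex_rel_def by blast
  have P_C: "x \<in> C \<and> y \<in> C" if "P x y" for x y using P_le[OF that] le_C by blast
  show K_refl: "x \<in> K x" if "x \<in> C" for x using P_refl that unfolding K_def by blast
  show K_C: "K x \<subseteq> C" for x unfolding K_def using P_C by blast
  have K_sym: "x \<in> K y" if "y \<in> K x" for x y using that unfolding K_def by blast
  have K_def_pred: "def_rel S d d (\<lambda>x y. y \<in> K x)"
    unfolding K_def def_rel_def mem_Collect_eq
    by (intro def_rules def_rel_subst[OF P] def_list_block def_list_vars)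
  show K_definable: "definable S d (K x)" for x
  proof (cases "x \<in> C")
    case True
    have "definable S d {z. length z = d \<and> z \<in> K x}"
      by (intro definableI def_rel_subst[OF K_def_pred] def_list_block def_list_const length_C True)
    also have "{z. length z = d \<and> z \<in> K x} = K x" using K_C length_C by blast
    finally show ?thesis .
  next
    case False
    then have "K x = {}" unfolding K_def using P_C by blast
    then show ?thesis using finite_imp_definable[of "{}" d S] by simp
  qed
  show between: "P y z" if "y \<in> K x" "z \<in> K x" "y \<preceq> z" for x y z
  proof -
    from that(1,2) consider "P x y" "P x z" | "P x y" "P z x" | "P y x" "P x z" | "P y x" "P z x"
      unfolding K_def by blast
    then show ?thesis
    proof cases
      case 1
      then show ?thesis using P_mono[of x z y z] that(3) P_le refl P_C by blast
    next
      case 2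
      then have "y = z" using P_le that(3) trans antisym by blast
      then show ?thesis using P_refl 2 P_C by blast
    next
      case 3
      then show ?thesis using P_glue by blast
    next
      case 4
      then show ?thesis using P_mono[of y x y z] that(3) P_le refl P_C by blast
    qed
  qed
  have K_trans: "z \<in> K y" if "y \<in> K x" "z \<in> K x" for x y z
    using between[OF that] between[OF that(2,1)] total[of y z] K_C that unfolding K_def by blast
  show K_eq: "K y = K x" if "y \<in> K x" for x y
    using K_trans[OF that] K_trans[OF K_sym[OF that]] by blast
  show convex: "a \<in> K x" if "y \<in> K x" "z \<in> K x" "y \<preceq> a" "a \<preceq> z" for x y z a
  proof -
    have "P y z" using between[OF that(1,2)] trans that(3,4) by blast
    then have "P y a" using P_mono[of y z y a] that(3,4) P_C refl by blast
    then have "a \<in> K y" unfolding K_def by blast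
    then show ?thesis using K_eq[OF that(1)] by simp
  qed
  \<comment> \<open>The points with infinite class. Suprema take care of these; the remaining points
    are finitely many because of \<open>hit\<close>.\<close>
  define W where "W = {y \<in> C. infinite {z \<in> H. z \<in> K y}}"
  have KH: "{z \<in> H. z \<in> K y} = K y" for y using K_C C_subset by blast
  have W: "definable S d W"
    unfolding W_def
    by (intro definable_subset[OF definable_C] def_pred_infinite_list[OF definable_H]
        def_rel_subst[OF K_def_pred] def_list_block def_list_vars)
  have below_iff: "is_sup (K y) s \<longleftrightarrow> s \<in> carrier D \<and> (\<forall>x\<in>C. x \<in> K y \<longrightarrow> below x s) \<and>
      (\<forall>t\<in>carrier D. (\<forall>x\<in>C. x \<in> K y \<longrightarrow> below x t) \<longrightarrow>
        s \<in> carrier D \<and> t \<in> carrier D \<and> s \<sqsubseteq>\<^bsub>D\<^esub> t)" for y s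
    using K_C[of y] unfolding is_sup_def below_def by blast
  \<comment> \<open>The index \<open>s\<close> stands for all points whose class is infinite with
    supremum \<open>s\<close>. Members with distinct indices are disjoint because suprema are
    unique.\<close>
  have sup_rel: "def_rel S m d (\<lambda>s y. y \<in> W \<and> is_sup (K y) s)"
    unfolding def_rel_def below_iff
    by (intro def_rules def_pred_mem[OF W] def_pred_mem[OF definable_carrier_D]
        def_pred_ball[OF definable_carrier_D] def_pred_ball[OF definable_C]
        def_rel_subst[OF K_def_pred] def_rel_subst[OF def_rel_below] def_rel_subst[OF def_rel_D]
        def_list_block def_list_vars)
  define T where "T = {s \<in> carrier D. \<exists>y\<in>W. y \<in> W \<and> is_sup (K y) s}"
  have T: "definable S m T"
    unfolding T_def
    by (intro definable_subset[OF definable_carrier_D] def_pred_bex[OF W] def_rel_subst[OF sup_rel]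
        def_list_block def_list_vars)
  have "finite T"
  proof (rule ccontr)
    assume "infinite T"
    moreover have "infinite {y \<in> H. y \<in> W \<and> is_sup (K y) s}" if s: "s \<in> T" for s
    proof -
      obtain y where y: "y \<in> W" "is_sup (K y) s" using s unfolding T_def by blast
      then have "infinite (K y)" unfolding W_def KH by blast
      then have "z \<in> W \<and> is_sup (K z) s" if "z \<in> K y" for z
        using y K_eq[OF that] K_C that unfolding W_def KH by auto
      then have "K y \<subseteq> {y \<in> H. y \<in> W \<and> is_sup (K y) s}" using K_C C_subset by blast
      then show ?thesis using \<open>infinite (K y)\<close> infinite_super by blast
    qed
    ultimately obtain y where "infinite {s \<in> T. y \<in> W \<and> is_sup (K y) s}"
      using infinite_fibers_overlap[OF sup_rel T] by blast
    moreover have "{s \<in> T. y \<in> W \<and> is_sup (K y) s} \<subseteq> {THE s. is_sup (K y) s}"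
      using is_sup_unique by (auto intro!: the_equality[symmetric])
    ultimately show False using finite_subset by blast
  qed
  \<comment> \<open>A later class with the same supremum \<open>s\<close> would contain some
    \<open>z1\<close> strictly below some \<open>z2\<close>, although \<open>s\<close> is at most
    the image of \<open>z1\<close> and at least that of \<open>z2\<close>.\<close>
  have sup_inj: "y' \<in> K y"
    if y: "y \<in> C" "y' \<in> W" "is_sup (K y) s" "is_sup (K y') s" "y \<preceq> y'" for y y' s
  proof (rule ccontr)
    assume *: "y' \<notin> K y"
    have y'C: "y' \<in> C" using y(2) unfolding W_def by blast
    have sep: "z \<preceq> z'" if z: "z \<in> K y" "z' \<in> K y'" for z z'
    proof (rule ccontr)
      assume "\<not> z \<preceq> z'"
      then have "z' \<preceq> z" using total z K_C by blast
      consider "y \<preceq> z'" | "z' \<preceq> y" using total z(2) K_C y(1) by blast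
      then show False
      proof cases
        case 1
        then have "z' \<in> K y" using convex[OF K_refl[OF y(1)] z(1) 1 \<open>z' \<preceq> z\<close>] by blast
        then show False using K_eq[of z' y] K_eq[OF z(2)] K_refl[OF y'C] * by blast
      next
        case 2
        then have "y \<in> K y'" using convex[OF z(2) K_refl[OF y'C] 2 y(5)] by blast
        then show False using K_sym * by blast
      qed
    qed
    have "infinite (K y')" using y(2) unfolding W_def KH by blast
    then have "infinite (K y' - {y'})" by simp
    then obtain z where "z \<in> K y'" "z \<noteq> y'" by (metis Diff_iff finite.emptyI insertI1 ex_in_conv)
    then obtain z1 z2 where zz: "z1 \<in> K y'" "z2 \<in> K y'" "z1 \<preceq> z2" "z1 \<noteq> z2"
      using total[of z y'] K_C K_refl[OF y'C] by blast
    have "s \<sqsubseteq>\<^bsub>D\<^esub> \<iota> z1"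
      using y(3) sep[OF _ zz(1)] \<iota>_le \<iota>_D K_C zz(1) unfolding is_sup_def by (meson subsetD)
    moreover have "\<iota> z2 \<sqsubseteq>\<^bsub>D\<^esub> s" using y(4) zz(2) unfolding is_sup_def by blast
    ultimately have "\<iota> z2 \<sqsubseteq>\<^bsub>D\<^esub> \<iota> z1"
      using D.le_trans[of "\<iota> z2" s "\<iota> z1"] y(3) \<iota>_D K_C zz unfolding is_sup_def by blast
    then have "z2 \<preceq> z1" using \<iota>_le K_C zz by blast
    then show False using zz antisym by blast
  qed
  have "finite (K ` W)"
  proof (rule inj_on_finite[OF _ _ \<open>finite T\<close>])
    let ?f = "\<lambda>k. SOME s. is_sup k s"
    have f: "is_sup (K y) (?f (K y))" for y
      by (rule someI_ex) (use is_sup_exists[OF K_definable K_C] in blast)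
    show "inj_on ?f (K ` W)"
    proof (rule inj_onI; clarify)
      fix y y' assume y: "y \<in> W" "y' \<in> W" "?f (K y) = ?f (K y')"
      have yC: "y \<in> C" "y' \<in> C" using y unfolding W_def by auto
      have s: "is_sup (K y) (?f (K y'))" "is_sup (K y') (?f (K y'))" using f[of y] f[of y'] y(3) by simp_all
      consider "y \<preceq> y'" | "y' \<preceq> y" using total yC by blast
      then show "K y = K y'"
      proof cases
        case 1
        then show ?thesis using sup_inj[OF yC(1) y(2) s] K_eq by blast
      next
        case 2
        then show ?thesis using sup_inj[OF yC(2) y(1) s(2,1)] K_eq by blast
      qed
    qed
    show "?f ` (K ` W) \<subseteq> T"
    proof safe
      fix y assume "y \<in> W"
      then show "?f (K y) \<in> T" using f[of y] unfolding T_def is_sup_def by blast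
    qed
  qed
  moreover have "finite (C - W)"
  proof (rule ccontr)
    assume "infinite (C - W)"
    moreover have "definable S d {x \<in> C. \<not> x \<in> W}"
      by (intro definable_subset[OF definable_C] def_rules def_pred_mem[OF W] def_list_block)
    then have "definable S d (C - W)" by (simp add: set_diff_eq)
    ultimately obtain p q where pq: "p \<in> C - W" "p \<noteq> q" "P p q"
      using hit unfolding hits_infinite_sets_def by blast
    have "{z. p \<preceq> z \<and> z \<preceq> q} \<subseteq> K p"
      using convex[of p p q] K_refl pq unfolding K_def by blast
    then have "infinite (K p)" using infinite_between[OF P_le[OF pq(3)] pq(2)] infinite_super by blast
    then show False using pq(1) unfolding W_def KH by blast
  qed
  moreover have "K ` C \<subseteq> K ` W \<union> K ` (C - W)" by blast
  ultimately show "finite (K ` C)" using finite_subset by blast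
qed

end

section \<open>Homogeneous cells\<close>

context completed_chain
begin

lemma infinite_colour_class:
  assumes "finite K" "A \<subseteq> (\<Union>k\<in>K. X k)" "infinite A"
  obtains k where "k \<in> K" "infinite (A \<inter> X k)"
proof -
  have "A = (\<Union>k\<in>K. A \<inter> X k)" using assms(2) by blast
  then have "infinite (\<Union>k\<in>K. A \<inter> X k)" using assms(3) by simp
  then show thesis using that assms(1) by blast
qed

lemma definable_Int_segment:
  assumes "definable S d A" "definable S d B" "A \<subseteq> C" "infinite (A \<inter> B)"
  obtains p q where "p \<in> A \<inter> B" "q \<in> A \<inter> B" "p \<preceq> q" "p \<noteq> q"
    "\<And>z. p \<preceq> z \<Longrightarrow> z \<preceq> q \<Longrightarrow> z \<in> A \<inter> B"
proof -
  have "definable S d {x \<in> A. x \<in> B}"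
    by (intro definable_subset[OF assms(1)] def_pred_mem[OF assms(2)] def_list_block)
  then have "definable S d (A \<inter> B)" by (simp add: Int_def)
  then show thesis using exists_segment[of "A \<inter> B"] assms(3,4) that by blast
qed

text \<open>Constancy of the colour between two points is a convex relation. It hits infinite sets,
  because an infinite definable set meets some colour class in a set containing a segment. Its
  finitely many classes leave a first stretch of constant colour after \<open>x\<close>.\<close>

lemma right_colour_germ:
  assumes fin: "finite K" and \<kappa>: "\<And>x. x \<in> C \<Longrightarrow> \<kappa> x \<in> K"
    and col: "\<And>k. k \<in> K \<Longrightarrow> definable S d {x \<in> C. \<kappa> x = k}"
    and x: "x \<preceq> y0" "x \<noteq> y0"
  obtains z where "x \<preceq> z" "x \<noteq> z" "\<And>y. x \<preceq> y \<Longrightarrow> x \<noteq> y \<Longrightarrow> y \<preceq> z \<Longrightarrow> \<kappa> y = \<kappa> z"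
proof -
  define X where "X k = {x \<in> C. \<kappa> x = k}" for k
  define P where "P a b \<longleftrightarrow> a \<preceq> b \<and> (\<exists>k\<in>K. \<forall>z\<in>C. a \<preceq> z \<and> z \<preceq> b \<longrightarrow> z \<in> X k)" for a b
  have P: "def_rel S d d P"
    unfolding P_def def_rel_def
    by (intro def_rules def_pred_finite_bex[OF fin] chain_rules def_pred_mem[OF col[folded X_def]])
      assumption+
  have P_le: "a \<preceq> b" if "P a b" for a b using that unfolding P_def by blast
  have P_refl: "P a a" if a: "a \<in> C" for a
  proof -
    have "z \<in> X (\<kappa> a)" if "a \<preceq> z" "z \<preceq> a" for z using antisym[OF that] a unfolding X_def by simp
    then show ?thesis unfolding P_def using refl[OF a] \<kappa>[OF a] by blast
  qed
  have P_mono: "P a' b'" if "P a b" "a \<preceq> a'" "a' \<preceq> b'" "b' \<preceq> b" for a b a' b'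
    using that trans unfolding P_def by meson
  have P_colour: "\<kappa> z = \<kappa> a" if "P a b" "a \<preceq> z" "z \<preceq> b" for a b z
  proof -
    have "z \<in> C" "a \<in> C" "a \<preceq> a" "a \<preceq> b" using le_C[OF that(2)] refl trans that(2,3) by blast+
    then show ?thesis using that unfolding P_def X_def by auto
  qed
  have P_glue: "P a c" if "P a b" "P b c" for a b c
  proof -
    have le: "a \<preceq> b" "b \<preceq> c" using that P_le by blast+
    have "\<kappa> z = \<kappa> b" if z: "a \<preceq> z" "z \<preceq> c" for z
    proof -
      consider "z \<preceq> b" | "b \<preceq> z" using total[of z b] le_C[OF z(1)] le_C[OF le(1)] by blast
      then show ?thesis
      proof cases
        case 1
        have "\<kappa> b = \<kappa> a" using P_colour[OF \<open>P a b\<close> le(1)] refl le_C[OF le(1)] by blast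
        then show ?thesis using P_colour[OF \<open>P a b\<close> z(1) 1] by simp
      next
        case 2
        then show ?thesis using P_colour[OF \<open>P b c\<close> 2 z(2)] by simp
      qed
    qed
    then show ?thesis
      unfolding P_def X_def using trans[OF le] \<kappa> le_C[OF le(1)] by blast
  qed
  have hit: "\<exists>p\<in>A. \<exists>q\<in>A. p \<noteq> q \<and> P p q" if A: "definable S d A" "A \<subseteq> C" "infinite A" for A
  proof -
    have "A \<subseteq> (\<Union>k\<in>K. X k)" using A(2) \<kappa> unfolding X_def by blast
    then obtain k where k: "k \<in> K" "infinite (A \<inter> X k)"
      using infinite_colour_class[OF fin _ A(3)] by blast
    obtain p q where "p \<in> A \<inter> X k" "q \<in> A \<inter> X k" "p \<preceq> q" "p \<noteq> q"
      "\<And>z. p \<preceq> z \<Longrightarrow> z \<preceq> q \<Longrightarrow> z \<in> A \<inter> X k"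
      using definable_Int_segment[OF A(1) col[OF k(1), folded X_def] A(2) k(2)] by blast
    then show ?thesis unfolding P_def using k(1) by blast
  qed
  have conv: "convex_rel P" unfolding convex_rel_def using P_le P_refl P_mono P_glue by blast
  have hits: "hits_infinite_sets P" unfolding hits_infinite_sets_def using hit by blast
  note cls = finite_convex_classes[OF P conv hits]
  let ?K = "\<lambda>x. {z. P x z \<or> P z x}"
  define U where "U = {y \<in> C. x \<preceq> y \<and> x \<noteq> y}"
  \<comment> \<open>One representative strictly above \<open>x\<close> is picked from each class,
    and \<open>z\<close> will be the least of them. A point \<open>y\<close> above \<open>x\<close>
    and up to \<open>z\<close> has its representative at or above \<open>z\<close>, so the colour is
    constant from \<open>y\<close> to \<open>z\<close>.\<close>
  define r where "r k = (SOME y. y \<in> k \<and> y \<in> U)" for k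
  have r_ex: "r k \<in> k \<and> r k \<in> U" if "\<exists>y. y \<in> k \<and> y \<in> U" for k
    unfolding r_def by (rule someI_ex[OF that])
  have r: "r (?K y) \<in> ?K y \<and> r (?K y) \<in> U" if "y \<in> U" for y
  proof -
    have "y \<in> C" using that unfolding U_def by blast
    then have "P y y" by (rule P_refl)
    then have "y \<in> ?K y \<and> y \<in> U" using that by simp
    then show ?thesis by (rule r_ex[OF exI])
  qed
  have UC: "U \<subseteq> C" unfolding U_def by blast
  have "finite (r ` ?K ` U)" by (rule finite_imageI[OF finite_subset[OF image_mono[OF UC] cls(1)]])
  moreover have "r ` ?K ` U \<noteq> {}" using x le_C unfolding U_def by blast
  moreover have "r ` ?K ` U \<subseteq> U" using r by blast
  moreover have "U \<subseteq> C" unfolding U_def by blast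
  ultimately obtain z where z: "z \<in> r ` ?K ` U" "\<forall>w\<in>r ` ?K ` U. z \<preceq> w"
    using finite_has_min[of "r ` ?K ` U"] by (meson order.trans)
  have zU: "z \<in> U" using z(1) \<open>r ` ?K ` U \<subseteq> U\<close> by blast
  have "\<kappa> y = \<kappa> z" if y: "x \<preceq> y" "x \<noteq> y" "y \<preceq> z" for y
  proof -
    have "y \<in> U" using y le_C unfolding U_def by blast
    then have "z \<preceq> r (?K y)" "r (?K y) \<in> ?K y" using z(2) r by blast+
    moreover have "P y (r (?K y))"
      using cls(5)[of y y "r (?K y)"] cls(2)[of y] \<open>y \<in> U\<close> calculation trans[OF y(3)] unfolding U_def
      by blast
    ultimately show ?thesis using P_colour[of y "r (?K y)" z] y(3) by simp
  qed
  then show thesis using that zU unfolding U_def by blast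
qed

lemma finite_minima: "finite {x \<in> A. \<forall>y\<in>A. x \<preceq> y}"
proof (rule ccontr)
  assume *: "infinite {x \<in> A. \<forall>y\<in>A. x \<preceq> y}"
  then obtain x where "x \<in> {x \<in> A. \<forall>y\<in>A. x \<preceq> y}" by (metis finite.emptyI equals0I)
  then have "{x \<in> A. \<forall>y\<in>A. x \<preceq> y} \<subseteq> {x}" using antisym by blast
  then show False using * finite_subset by blast
qed

lemma finite_maxima: "finite {x \<in> A. \<forall>y\<in>A. y \<preceq> x}"
proof (rule ccontr)
  assume *: "infinite {x \<in> A. \<forall>y\<in>A. y \<preceq> x}"
  then obtain x where "x \<in> {x \<in> A. \<forall>y\<in>A. y \<preceq> x}" by (metis finite.emptyI equals0I)
  then have "{x \<in> A. \<forall>y\<in>A. y \<preceq> x} \<subseteq> {x}" using antisym by blast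
  then show False using * finite_subset by blast
qed

lemma enumerate_chain:
  assumes "finite F" "F \<subseteq> C"
  obtains f :: "nat \<Rightarrow> 'a list" where "bij_betw f {1..card F} F"
    "\<And>i j. i \<in> {1..card F} \<Longrightarrow> j \<in> {1..card F} \<Longrightarrow> i < j \<Longrightarrow> f i \<preceq> f j \<and> f i \<noteq> f j"
proof -
  \<comment> \<open>Counting the points up to and including \<open>x\<close> makes the indices start
    at 1.\<close>
  define \<rho> where "\<rho> x = card {y \<in> F. y \<preceq> x}" for x
  have less: "\<rho> x < \<rho> y" if "x \<in> F" "y \<in> F" "x \<preceq> y" "x \<noteq> y" for x y
    unfolding \<rho>_def
  proof (rule psubset_card_mono)
    have "y \<in> {z \<in> F. z \<preceq> y}" "y \<notin> {z \<in> F. z \<preceq> x}" using that antisym refl assms(2) by blast+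
    then show "{z \<in> F. z \<preceq> x} \<subset> {z \<in> F. z \<preceq> y}" using trans[OF _ that(3)] by blast
  qed (use assms(1) in simp)
  have inj: "inj_on \<rho> F"
  proof (rule inj_onI, rule ccontr)
    fix x y assume "x \<in> F" "y \<in> F" "\<rho> x = \<rho> y" "x \<noteq> y"
    then show False using less[of x y] less[of y x] total[of x y] assms(2) by auto
  qed
  have "\<rho> ` F \<subseteq> {1..card F}"
  proof safe
    fix x assume "x \<in> F"
    then have "{y \<in> F. y \<preceq> x} \<noteq> {}" using refl assms(2) by blast
    then show "\<rho> x \<in> {1..card F}"
      unfolding \<rho>_def using assms(1) by (simp add: Suc_le_eq card_gt_0_iff card_mono)
  qed
  then have "\<rho> ` F = {1..card F}"
    by (intro card_subset_eq) (simp_all add: card_image[OF inj])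
  then have bij: "bij_betw \<rho> F {1..card F}" using inj by (simp add: bij_betw_def)
  let ?f = "the_inv_into F \<rho>"
  have f: "bij_betw ?f {1..card F} F" by (rule bij_betw_the_inv_into[OF bij])
  have "?f i \<preceq> ?f j \<and> ?f i \<noteq> ?f j" if ij: "i \<in> {1..card F}" "j \<in> {1..card F}" "i < j" for i j
  proof -
    have m: "?f i \<in> F" "?f j \<in> F" using f ij by (auto simp: bij_betw_def)
    have "\<rho> (?f i) = i" "\<rho> (?f j) = j" using f_the_inv_into_f_bij_betw[OF bij] ij by auto
    then have "\<not> (?f j \<preceq> ?f i)" using less[of "?f j" "?f i"] m ij(3) by (cases "?f i = ?f j") auto
    then show ?thesis using total[of "?f i" "?f j"] m assms(2) refl by auto
  qed
  then show thesis using that f by blast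
qed

text \<open>The completion provides suprema, so the lower endpoint is taken as the supremum of the
  lower bounds of \<open>M\<close> in the chain; if there are none, it is the least element of
  \<open>D\<close>. Strictness at both ends comes from the absence of extremal points.\<close>

lemma open_convex_imp_chain_interval:
  assumes M: "definable S d M" "M \<subseteq> C" "M \<noteq> {}"
    and convex: "\<And>x y z. x \<in> M \<Longrightarrow> y \<in> M \<Longrightarrow> x \<preceq> z \<Longrightarrow> z \<preceq> y \<Longrightarrow> z \<in> M"
    and no_max: "\<And>x. x \<in> M \<Longrightarrow> \<exists>y\<in>M. x \<preceq> y \<and> x \<noteq> y"
    and no_min: "\<And>x. x \<in> M \<Longrightarrow> \<exists>y\<in>M. y \<preceq> x \<and> y \<noteq> x"
  shows "chain_interval C D \<iota> M"
proof -
  define A where "A = {z \<in> C. \<forall>x\<in>M. z \<preceq> x}"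
  have "definable S d A"
    unfolding A_def by (intro definable_subset[OF definable_C] def_pred_ball[OF M(1)] chain_rules)
  then obtain a where a: "is_sup A a" using is_sup_exists[of A] unfolding A_def by blast
  obtain b where b: "is_sup M b" using is_sup_exists[OF M(1,2)] by blast
  have ab: "a \<in> carrier D" "b \<in> carrier D" using a b unfolding is_sup_def by blast+
  have ge_a: "a \<sqsubseteq>\<^bsub>D\<^esub> \<iota> x" if "x \<in> M" for x
  proof -
    have "x \<in> C" using that M(2) by blast
    then have "\<forall>z\<in>A. \<iota> z \<sqsubseteq>\<^bsub>D\<^esub> \<iota> x" using \<iota>_le that unfolding A_def by blast
    then show ?thesis using a \<iota>_D[OF \<open>x \<in> C\<close>] unfolding is_sup_def by blast
  qed
  have le_b: "\<iota> x \<sqsubseteq>\<^bsub>D\<^esub> b" if "x \<in> M" for x using b that unfolding is_sup_def by blast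
  have gt_a: "a \<sqsubset>\<^bsub>D\<^esub> \<iota> x" if x: "x \<in> M" for x
  proof -
    obtain y where y: "y \<in> M" "y \<preceq> x" "y \<noteq> x" using no_min[OF x] by blast
    have "a \<noteq> \<iota> x"
    proof
      assume "a = \<iota> x"
      then have "\<iota> x \<sqsubseteq>\<^bsub>D\<^esub> \<iota> y" using ge_a[OF y(1)] by simp
      then have "x \<preceq> y" using \<iota>_le x y(1) M(2) by blast
      then show False using y antisym by blast
    qed
    then show ?thesis using ge_a[OF x] by (simp add: D.lless_eq)
  qed
  have lt_b: "\<iota> x \<sqsubset>\<^bsub>D\<^esub> b" if x: "x \<in> M" for x
  proof -
    obtain y where y: "y \<in> M" "x \<preceq> y" "x \<noteq> y" using no_max[OF x] by blast
    have "\<iota> x \<noteq> b"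
    proof
      assume "\<iota> x = b"
      then have "\<iota> y \<sqsubseteq>\<^bsub>D\<^esub> \<iota> x" using le_b[OF y(1)] by simp
      then have "y \<preceq> x" using \<iota>_le x y(1) M(2) by blast
      then show False using y antisym by blast
    qed
    then show ?thesis using le_b[OF x] by (simp add: D.lless_eq)
  qed
  have "z \<in> M" if z: "z \<in> C" "a \<sqsubset>\<^bsub>D\<^esub> \<iota> z" "\<iota> z \<sqsubset>\<^bsub>D\<^esub> b" for z
  proof -
    have "z \<notin> A"
    proof
      assume "z \<in> A"
      then have "\<iota> z \<sqsubseteq>\<^bsub>D\<^esub> a" using a unfolding is_sup_def by blast
      then show False using z(1,2) D.le_antisym[of a "\<iota> z"] ab \<iota>_D by (simp add: D.lless_eq)
    qed
    then obtain x where x: "x \<in> M" "x \<preceq> z" using z(1) M(2) total unfolding A_def by blast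
    have "\<exists>y\<in>M. z \<preceq> y"
    proof (rule ccontr)
      assume "\<not> ?thesis"
      then have "\<forall>y\<in>M. \<iota> y \<sqsubseteq>\<^bsub>D\<^esub> \<iota> z" using total z(1) M(2) \<iota>_le by blast
      then have "b \<sqsubseteq>\<^bsub>D\<^esub> \<iota> z" using b \<iota>_D[OF z(1)] unfolding is_sup_def by blast
      then show False using z(1,3) D.le_antisym[of b "\<iota> z"] ab \<iota>_D by (simp add: D.lless_eq)
    qed
    then show ?thesis using convex x by blast
  qed
  then have eq: "M = {z \<in> C. a \<sqsubset>\<^bsub>D\<^esub> \<iota> z \<and> \<iota> z \<sqsubset>\<^bsub>D\<^esub> b}" using gt_a lt_b M(2) by blast
  obtain x where x: "x \<in> M" using M(3) by blast
  have "a \<sqsubseteq>\<^bsub>D\<^esub> b" using D.le_trans[OF ge_a[OF x] le_b[OF x]] ab \<iota>_D x M(2) by blast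
  moreover have "a \<noteq> b"
  proof
    assume "a = b"
    then have "a = \<iota> x"
      using ge_a[OF x] le_b[OF x] D.le_antisym[of a "\<iota> x"] ab \<iota>_D x M(2) by blast
    then show False using gt_a[OF x] by (simp add: D.lless_eq)
  qed
  ultimately show ?thesis
    unfolding chain_interval_def using eq ab by (auto simp: D.lless_eq)
qed

text \<open>
  Splitting the extremal points off the classes of a convex equivalence relation leaves cells
  without endpoints.
\<close>

lemma convex_classes_cells:
  assumes P: "def_rel S d d P" and conv: "convex_rel P" and hit: "hits_infinite_sets P"
  obtains n :: nat and M :: "nat \<Rightarrow> 'a list set" where
    "\<And>i x y. i \<in> {1..n} \<Longrightarrow> x \<in> M i \<Longrightarrow> y \<in> M i \<Longrightarrow> x \<preceq> y \<Longrightarrow> P x y"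
    "\<And>i. i \<in> {1..n} \<Longrightarrow> M i \<noteq> {}"
    "disjoint_family_on M {1..n}"
    "(\<Union>i\<in>{1..n}. M i) = C"
    "\<And>i j x y. i \<in> {1..n} \<Longrightarrow> j \<in> {1..n} \<Longrightarrow> i < j \<Longrightarrow> x \<in> M i \<Longrightarrow> y \<in> M j \<Longrightarrow> x \<preceq> y \<and> x \<noteq> y"
    "\<And>i x y z. i \<in> {1..n} \<Longrightarrow> x \<in> M i \<Longrightarrow> y \<in> M i \<Longrightarrow> x \<preceq> z \<Longrightarrow> z \<preceq> y \<Longrightarrow> z \<in> M i"
    "\<And>i. i \<in> {1..n} \<Longrightarrow> (\<exists>x\<in>C. M i = {x}) \<or>
       chain_interval C D \<iota> (M i) \<and> (\<forall>x\<in>M i. (\<exists>y\<in>M i. x \<preceq> y \<and> x \<noteq> y) \<and> (\<exists>y\<in>M i. y \<preceq> x \<and> y \<noteq> x))"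
proof -
  define K where "K x = {z. P x z \<or> P z x}" for x
  note classes = finite_convex_classes[OF P conv hit, folded K_def]
  note fin = classes(1) and K_refl = classes(2) and K_definable = classes(3) and K_C = classes(4)
    and K_P = classes(5) and K_eq = classes(6) and K_convex = classes(7)
  \<comment> \<open>An extremal point of its class becomes a cell by itself.\<close>
  define ends where "ends x \<longleftrightarrow> (\<forall>z\<in>K x. x \<preceq> z) \<or> (\<forall>z\<in>K x. z \<preceq> x)" for x
  define cell where "cell x = (if ends x then {x} else {z \<in> K x. \<not> ends z})" for x
  have cell_refl: "x \<in> cell x" if "x \<in> C" for x using K_refl[OF that] unfolding cell_def by simp
  have cell_K: "cell x \<subseteq> K x" if "x \<in> C" for x using K_refl[OF that] unfolding cell_def by auto
  have cell_eq: "cell y = cell x" if "y \<in> cell x" for x y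
    using that K_eq unfolding cell_def by (auto split: if_splits)
  have cell_convex: "a \<in> cell x" if "x \<in> C" "y \<in> cell x" "z \<in> cell x" "y \<preceq> a" "a \<preceq> z" for a x y z
  proof (cases "ends x")
    case True
    then have "a = x" using that antisym unfolding cell_def by auto
    then show ?thesis using cell_refl that(1) by simp
  next
    case False
    then have yz: "y \<in> K x" "z \<in> K x" "\<not> ends y" "\<not> ends z" using that unfolding cell_def by auto
    then have a: "a \<in> K x" using K_convex that by blast
    have "\<not> ends a"
    proof
      assume "ends a"
      then have "a = y \<or> a = z" using K_eq[OF a] yz that(4,5) antisym unfolding ends_def by blast
      then show False using \<open>ends a\<close> yz by blast
    qed
    then show ?thesis using a False unfolding cell_def by simp
  qed
  \<comment> \<open>Density puts a further point of the class strictly between \<open>y\<close> and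
    a point beyond it. That point is not extremal, so removing the extremal points creates no new
    ones.\<close>
  have cell_endless: "(\<exists>z\<in>cell x. y \<preceq> z \<and> y \<noteq> z) \<and> (\<exists>z\<in>cell x. z \<preceq> y \<and> z \<noteq> y)"
    if "\<not> ends x" "y \<in> cell x" for x y
  proof -
    have y: "y \<in> K x" "\<not> ends y" using that unfolding cell_def by auto
    have yC: "y \<in> C" using y K_C by blast
    obtain p where p: "p \<in> K x" "\<not> y \<preceq> p" using y K_eq[OF y(1)] unfolding ends_def by blast
    obtain q where q: "q \<in> K x" "\<not> q \<preceq> y" using y K_eq[OF y(1)] unfolding ends_def by blast
    have le: "p \<preceq> y" "p \<noteq> y" "y \<preceq> q" "y \<noteq> q" using p q total[OF yC] refl[OF yC] K_C by blast+
    obtain z where z: "y \<preceq> z" "z \<preceq> q" "z \<noteq> y" "z \<noteq> q" using between_exists[OF le(3,4)] by blast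
    obtain w where w: "p \<preceq> w" "w \<preceq> y" "w \<noteq> p" "w \<noteq> y" using between_exists[OF le(1,2)] by blast
    have zw: "z \<in> K x" "w \<in> K x" using K_convex[OF y(1) q(1) z(1,2)] K_convex[OF p(1) y(1) w(1,2)] by blast+
    have "\<not> ends z" using K_eq[OF zw(1)] y(1) q(1) z antisym unfolding ends_def by blast
    moreover have "\<not> ends w" using K_eq[OF zw(2)] y(1) p(1) w antisym unfolding ends_def by blast
    ultimately show ?thesis using zw z w that(1) unfolding cell_def by auto
  qed
  have cell_interval: "chain_interval C D \<iota> (cell x)" if "x \<in> C" "\<not> ends x" for x
  proof (rule open_convex_imp_chain_interval)
    have "cell x = {z \<in> K x. \<not> ((\<forall>w\<in>K x. z \<preceq> w) \<or> (\<forall>w\<in>K x. w \<preceq> z))}"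
      using that(2) K_eq unfolding cell_def ends_def by auto
    also have "definable S d \<dots>"
      by (intro definable_subset[OF K_definable] def_rules def_pred_ball[OF K_definable] chain_rules)
    finally show "definable S d (cell x)" .
    show "cell x \<subseteq> C" using cell_K[OF that(1)] K_C by blast
    show "cell x \<noteq> {}" using cell_refl[OF that(1)] by blast
  qed (use cell_convex[OF that(1)] cell_endless[OF that(2)] in blast)+
  \<comment> \<open>Each class contributes at most one endless cell and at most two
    singletons.\<close>
  have "finite (cell ` C)"
  proof (rule finite_subset)
    show "cell ` C \<subseteq> (\<Union>k\<in>K ` C. insert {z \<in> k. \<not> ends z} ((\<lambda>x. {x}) ` {x \<in> k. ends x}))"
      using K_refl unfolding cell_def by auto
    have "finite {x \<in> k. ends x}" if k: "k \<in> K ` C" for k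
    proof -
      obtain c where c: "k = K c" "c \<in> C" using k by blast
      have "{x \<in> k. ends x} \<subseteq> {y \<in> k. \<forall>z\<in>k. y \<preceq> z} \<union> {y \<in> k. \<forall>z\<in>k. z \<preceq> y}"
        using K_eq unfolding c(1) ends_def by blast
      then show ?thesis using finite_minima finite_maxima finite_subset by blast
    qed
    then show "finite (\<Union>k\<in>K ` C. insert {z \<in> k. \<not> ends z} ((\<lambda>x. {x}) ` {x \<in> k. ends x}))"
      using fin by blast
  qed
  \<comment> \<open>One representative per cell turns the enumeration of cells into an enumeration
    of points.\<close>
  then obtain F where F: "F \<subseteq> C" "inj_on cell F" "cell ` F = cell ` C"
    using subset_image_inj[of "cell ` C" cell C] by auto
  have "finite (cell ` F)" unfolding F(3) by fact
  then have finF: "finite F" using F(2) finite_imageD by blast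
  obtain f :: "nat \<Rightarrow> 'a list" where f: "bij_betw f {1..card F} F"
    "\<And>i j. i \<in> {1..card F} \<Longrightarrow> j \<in> {1..card F} \<Longrightarrow> i < j \<Longrightarrow> f i \<preceq> f j \<and> f i \<noteq> f j"
    using enumerate_chain[OF finF F(1)] by blast
  define n where "n = card F"
  have fC: "f i \<in> C" if "i \<in> {1..n}" for i
    using f(1) that F(1) unfolding n_def bij_betw_def by blast
  have disj: "cell (f i) \<inter> cell (f j) = {}" if ij: "i \<in> {1..n}" "j \<in> {1..n}" "i \<noteq> j" for i j
  proof (rule ccontr)
    assume "cell (f i) \<inter> cell (f j) \<noteq> {}"
    then have "cell (f i) = cell (f j)" using cell_eq by blast
    moreover have "f i \<in> F" "f j \<in> F" using f(1) ij unfolding n_def bij_betw_def by auto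
    ultimately have "f i = f j" using F(2) by (simp add: inj_on_def)
    then show False using f(1) ij unfolding n_def bij_betw_def inj_on_def by blast
  qed
  show thesis
  proof (rule that[of n "\<lambda>i. cell (f i)"])
    show "P x y" if "i \<in> {1..n}" "x \<in> cell (f i)" "y \<in> cell (f i)" "x \<preceq> y" for i x y
      using K_P[OF _ _ that(4)] cell_K[OF fC[OF that(1)]] that(2,3) by blast
    show "cell (f i) \<noteq> {}" if "i \<in> {1..n}" for i using cell_refl fC[OF that] by blast
    show "disjoint_family_on (\<lambda>i. cell (f i)) {1..n}" using disj unfolding disjoint_family_on_def by blast
    show "(\<Union>i\<in>{1..n}. cell (f i)) = C"
    proof -
      have "F = f ` {1..n}" using f(1) by (simp add: n_def bij_betw_def)
      then have "(\<Union>i\<in>{1..n}. cell (f i)) = \<Union>(cell ` F)" by (simp only: image_image)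
      also have "\<dots> = \<Union>(cell ` C)" unfolding F(3) ..
      also have "\<dots> = C" using cell_refl cell_K K_C by blast
      finally show ?thesis .
    qed
    show "x \<preceq> y \<and> x \<noteq> y"
      if ij: "i \<in> {1..n}" "j \<in> {1..n}" "i < j" and xy: "x \<in> cell (f i)" "y \<in> cell (f j)" for i j x y
    proof -
      have d: "cell (f i) \<inter> cell (f j) = {}" using disj[OF ij(1,2)] ij(3) by simp
      have C: "f i \<in> C" "f j \<in> C" "x \<in> C" "y \<in> C" using fC ij xy cell_K K_C by blast+
      have le: "f i \<preceq> f j" using f(2) ij unfolding n_def by blast
      have "\<not> y \<preceq> x"
      proof
        assume yx: "y \<preceq> x"
        consider "f i \<preceq> y" | "y \<preceq> f i" using total C by blast
        then show False
        proof cases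
          case 1
          then have "y \<in> cell (f i)" using cell_convex[OF C(1) cell_refl[OF C(1)] xy(1)] yx by blast
          then show ?thesis using d xy by blast
        next
          case 2
          then have "f i \<in> cell (f j)" using cell_convex[OF C(2) xy(2) cell_refl[OF C(2)]] le by blast
          then show ?thesis using d cell_refl[OF C(1)] by blast
        qed
      qed
      then show ?thesis using total[OF C(3,4)] refl[OF C(3)] by blast
    qed
    show "z \<in> cell (f i)"
      if "i \<in> {1..n}" "x \<in> cell (f i)" "y \<in> cell (f i)" "x \<preceq> z" "z \<preceq> y" for i x y z
      using cell_convex[OF fC[OF that(1)] that(2-5)] .
    show "(\<exists>x\<in>C. cell (f i) = {x}) \<or> chain_interval C D \<iota> (cell (f i)) \<and>
        (\<forall>x\<in>cell (f i). (\<exists>y\<in>cell (f i). x \<preceq> y \<and> x \<noteq> y) \<and> (\<exists>y\<in>cell (f i). y \<preceq> x \<and> y \<noteq> x))"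
      if "i \<in> {1..n}" for i
    proof (cases "ends (f i)")
      case True
      then show ?thesis using fC[OF that] unfolding cell_def by auto
    next
      case False
      then show ?thesis using cell_interval[OF fC[OF that]] cell_endless[OF False] by blast
    qed
  qed
qed

text \<open>
  An additive colouring \<open>g\<close> of pairs is determined near \<open>x\<close> by its right germ at \<open>x\<close>. Two
  points are equivalent if \<open>g\<close> and its germs are constant between them. The overlap principle,
  applied to the range of validity of the germs, shows that only finitely many points are
  equivalent to no other point.
\<close>

lemma homogeneous_cells:
  assumes fin_\<tau>: "finite (\<tau> ` C)" and \<tau>: "\<And>k. definable S d {x \<in> C. \<tau> x = k}"
    and fin_g: "finite E" and g_E: "\<And>x y. x \<preceq> y \<Longrightarrow> x \<noteq> y \<Longrightarrow> g x y \<in> E"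
    and g: "\<And>e. def_rel S d d (\<lambda>x y. x \<preceq> y \<and> x \<noteq> y \<and> g x y = e)"
    and comp: "\<And>x y z. x \<preceq> y \<Longrightarrow> x \<noteq> y \<Longrightarrow> y \<preceq> z \<Longrightarrow> y \<noteq> z \<Longrightarrow> g x z = c (g y z) (g x y)"
  obtains n :: nat and M :: "nat \<Rightarrow> 'a list set" where
    "\<And>i. i \<in> {1..n} \<Longrightarrow> chain_cell C D \<iota> (M i) \<and> M i \<noteq> {}"
    "disjoint_family_on M {1..n}"
    "(\<Union>i\<in>{1..n}. M i) = C"
    "\<And>i j x y. i \<in> {1..n} \<Longrightarrow> j \<in> {1..n} \<Longrightarrow> i < j \<Longrightarrow> x \<in> M i \<Longrightarrow> y \<in> M j \<Longrightarrow> x \<preceq> y \<and> x \<noteq> y"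
    "\<And>i x y. i \<in> {1..n} \<Longrightarrow> x \<in> M i \<Longrightarrow> y \<in> M i \<Longrightarrow> \<tau> x = \<tau> y"
    "\<And>i j x y x' y'. i \<in> {1..n} \<Longrightarrow> j \<in> {1..n} \<Longrightarrow> i \<le> j \<Longrightarrow>
       x \<in> M i \<Longrightarrow> y \<in> M j \<Longrightarrow> x \<preceq> y \<Longrightarrow> x \<noteq> y \<Longrightarrow>
       x' \<in> M i \<Longrightarrow> y' \<in> M j \<Longrightarrow> x' \<preceq> y' \<Longrightarrow> x' \<noteq> y' \<Longrightarrow> g x y = g x' y'"
    "\<And>i x y. i \<in> {1..n} \<Longrightarrow> x \<in> M i \<Longrightarrow> y \<in> M i \<Longrightarrow> x \<preceq> y \<Longrightarrow> x \<noteq> y \<Longrightarrow> c (g x y) (g x y) = g x y"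
proof -
  define X where "X k = {x \<in> C. \<tau> x = k}" for k
  define \<Lambda> where "\<Lambda> e x y \<longleftrightarrow> x \<preceq> y \<and> x \<noteq> y \<and> g x y = e" for e x y
  \<comment> \<open>\<open>G e x\<close> says that \<open>e\<close> is the right germ at
    \<open>x\<close>: the colour of \<open>(x, y)\<close> is \<open>e\<close> for all
    \<open>y\<close> just above \<open>x\<close>.\<close>
  define G where "G e x \<longleftrightarrow> (\<exists>z\<in>C. x \<preceq> z \<and> \<not> x = z \<and>
    (\<forall>y\<in>C. x \<preceq> y \<and> \<not> x = y \<and> y \<preceq> z \<longrightarrow> \<Lambda> e x y))" for e x
  note \<Lambda> = g[folded \<Lambda>_def]
  note X = \<tau>[folded X_def]
  have G_rule: "def_pred S (\<lambda>v. G e (f v))" if "def_list d f" for e f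
    by (rule def_pred_subst_list[OF _ that])
      (unfold G_def, intro def_rules chain_rules def_rel_subst[OF \<Lambda>])
  have G_exists: "\<exists>e\<in>E. G e x" if x: "x \<preceq> y0" "x \<noteq> y0" for x y0
  proof -
    have xC: "x \<in> C" using le_C[OF x(1)] by blast
    \<comment> \<open>\<open>None\<close> absorbs the points not strictly above \<open>x\<close>,
      for which \<open>g x y\<close> need not lie in \<open>E\<close>.\<close>
    define \<kappa> where "\<kappa> y = (if x \<preceq> y \<and> x \<noteq> y then Some (g x y) else None)" for y
    have "definable S d {y \<in> C. \<kappa> y = k}" for k
    proof (cases k)
      case None
      have "definable S d {y \<in> C. \<not> (x \<preceq> y \<and> \<not> x = y)}"
        by (intro definable_subset[OF definable_C] def_rules chain_rules xC)
      also have "{y \<in> C. \<not> (x \<preceq> y \<and> \<not> x = y)} = {y \<in> C. \<kappa> y = k}" using None by (auto simp: \<kappa>_def)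
      finally show ?thesis .
    next
      case (Some e)
      have "definable S d {y \<in> C. \<Lambda> e x y}"
        by (intro definable_subset[OF definable_C] def_rel_subst[OF \<Lambda>] chain_rules xC)
      also have "{y \<in> C. \<Lambda> e x y} = {y \<in> C. \<kappa> y = k}" using Some by (auto simp: \<kappa>_def \<Lambda>_def)
      finally show ?thesis .
    qed
    moreover have "\<kappa> y \<in> insert None (Some ` E)" for y using g_E by (auto simp: \<kappa>_def)
    moreover have "finite (insert None (Some ` E))" using fin_g by simp
    ultimately obtain z where z: "x \<preceq> z" "x \<noteq> z"
      "\<And>y. x \<preceq> y \<Longrightarrow> x \<noteq> y \<Longrightarrow> y \<preceq> z \<Longrightarrow> \<kappa> y = \<kappa> z"
      using right_colour_germ[of "insert None (Some ` E)" \<kappa> x y0] x by blast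
    have "\<Lambda> (g x z) x y" if "x \<preceq> y" "x \<noteq> y" "y \<preceq> z" for y
      using z(3)[OF that] that z(1,2) by (simp add: \<kappa>_def \<Lambda>_def)
    then have "G (g x z) x" unfolding G_def using z(1,2) le_C by blast
    then show ?thesis using g_E[OF z(1,2)] by blast
  qed
  have G_unique: "e = e'" if G: "G e x" "G e' x" for e e' x
  proof -
    obtain z z' where z: "z \<in> C" "x \<preceq> z" "x \<noteq> z" "\<And>y. x \<preceq> y \<Longrightarrow> x \<noteq> y \<Longrightarrow> y \<preceq> z \<Longrightarrow> \<Lambda> e x y"
      and z': "z' \<in> C" "x \<preceq> z'" "x \<noteq> z'" "\<And>y. x \<preceq> y \<Longrightarrow> x \<noteq> y \<Longrightarrow> y \<preceq> z' \<Longrightarrow> \<Lambda> e' x y"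
      using G le_C unfolding G_def by metis
    consider "z \<preceq> z'" | "z' \<preceq> z" using total z(1) z'(1) by blast
    then show ?thesis
    proof cases
      case 1
      then have "\<Lambda> e x z" "\<Lambda> e' x z" using z z' refl by blast+
      then show ?thesis by (simp add: \<Lambda>_def)
    next
      case 2
      then have "\<Lambda> e x z'" "\<Lambda> e' x z'" using z z' refl by blast+
      then show ?thesis by (simp add: \<Lambda>_def)
    qed
  qed
  define hom where "hom e k x y \<longleftrightarrow> (\<forall>a\<in>C. x \<preceq> a \<and> a \<preceq> y \<longrightarrow> G e a \<and> a \<in> X k) \<and>
    (\<forall>a\<in>C. \<forall>b\<in>C. x \<preceq> a \<and> a \<preceq> b \<and> \<not> a = b \<and> b \<preceq> y \<longrightarrow> \<Lambda> e a b)" for e k x y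
  \<comment> \<open>The case \<open>x = y\<close> is kept apart because a greatest point of the
    chain has no right germ.\<close>
  define P where "P x y \<longleftrightarrow> x \<preceq> y \<and> (x = y \<or> (\<exists>e\<in>E. \<exists>k\<in>\<tau> ` C. hom e k x y))" for x y
  have P: "def_rel S d d P"
    unfolding P_def hom_def def_rel_def
    by (intro def_rules def_pred_finite_bex fin_g fin_\<tau> chain_rules G_rule def_pred_mem[OF X]
        def_rel_subst[OF \<Lambda>])
  have P_le: "x \<preceq> y" if "P x y" for x y using that unfolding P_def by blast
  have P_refl: "P x x" if "x \<in> C" for x using refl[OF that] unfolding P_def by blast
  have hom_mono: "hom e k a b" if "hom e k x y" "x \<preceq> a" "b \<preceq> y" for e k x y a b
    using that trans unfolding hom_def by meson
  have P_mono: "P a b" if "P x y" "x \<preceq> a" "a \<preceq> b" "b \<preceq> y" for x y a b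
  proof (cases "x = y")
    case True
    then have "a = b" using that trans antisym by blast
    then show ?thesis using P_refl le_C[OF that(2)] by blast
  next
    case False
    then show ?thesis using that hom_mono unfolding P_def by blast
  qed
  have hom_idem: "c e e = e" if h: "hom e k x y" and xy: "x \<preceq> y" "x \<noteq> y" for e k x y
  proof -
    obtain w where w: "x \<preceq> w" "w \<preceq> y" "w \<noteq> x" "w \<noteq> y" using between_exists[OF xy] by blast
    then have "\<Lambda> e x w" "\<Lambda> e w y" "\<Lambda> e x y" using h xy refl le_C unfolding hom_def by blast+
    then show ?thesis using comp[of x w y] w by (simp add: \<Lambda>_def)
  qed
  have P_glue: "P x z" if xy: "P x y" and yz: "P y z" for x y z
  proof (cases "x = y \<or> y = z")
    case True
    then show ?thesis using xy yz by blast
  next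
    case False
    have le: "x \<preceq> y" "y \<preceq> z" using P_le xy yz by blast+
    obtain e k where h: "e \<in> E" "k \<in> \<tau> ` C" "hom e k x y" using xy False unfolding P_def by blast
    obtain e' k' where h': "hom e' k' y z" using yz False unfolding P_def by blast
    have y: "y \<in> C" "y \<preceq> y" using le_C[OF le(1)] refl by blast+
    \<comment> \<open>The common point \<open>y\<close> has only one germ, so the colours on its two
      sides agree.\<close>
    have "G e y" "G e' y" "y \<in> X k" "y \<in> X k'" using h(3) h' le y unfolding hom_def by blast+
    then have eq: "e' = e" "k' = k" using G_unique by (auto simp: X_def)
    have idem: "c e e = e" using hom_idem[OF h(3) le(1)] False by blast
    have 1: "G e a \<and> a \<in> X k" if "x \<preceq> a" "a \<preceq> z" for a
      using h(3) h' that total[of a y] le_C[OF that(1)] y(1) unfolding eq hom_def by blast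
    have 2: "\<Lambda> e a b" if ab: "x \<preceq> a" "a \<preceq> b" "a \<noteq> b" "b \<preceq> z" for a b
    proof -
      have C: "a \<in> C" "b \<in> C" using le_C[OF ab(2)] by blast+
      consider "b \<preceq> y" | "y \<preceq> a" | "a \<preceq> y" "a \<noteq> y" "y \<preceq> b" "y \<noteq> b"
        using total[OF C(1) y(1)] total[OF C(2) y(1)] refl[OF C(1)] refl[OF C(2)] by blast
      then show ?thesis
      proof cases
        case 1
        then show ?thesis using h(3) ab C unfolding hom_def by blast
      next
        case 2
        then show ?thesis using h' ab C unfolding eq hom_def by blast
      next
        \<comment> \<open>A pair straddling \<open>y\<close> is composed of two pairs of colour
          \<open>e\<close>, and \<open>e\<close> is idempotent.\<close>
        case 3
        then have "\<Lambda> e a y" "\<Lambda> e y b"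
          using h(3) h' ab C y unfolding eq hom_def by blast+
        then show ?thesis using comp[of a y b] 3 ab idem by (simp add: \<Lambda>_def)
      qed
    qed
    have "hom e k x z" unfolding hom_def using 1 2 by blast
    then show ?thesis unfolding P_def using h(1,2) trans[OF le] by blast
  qed
  have hit: "\<exists>p\<in>A. \<exists>q\<in>A. p \<noteq> q \<and> P p q" if A: "definable S d A" "A \<subseteq> C" "infinite A" for A
  proof -
    \<comment> \<open>A greatest point has no right germ; without it the set stays infinite.\<close>
    have inf: "infinite (A - {x \<in> C. \<forall>y\<in>C. y \<preceq> x})" using A(3) finite_maxima by simp
    define Y where "Y = (\<lambda>(e, k). {x \<in> C. G e x \<and> x \<in> X k})"
    have "A - {x \<in> C. \<forall>y\<in>C. y \<preceq> x} \<subseteq> (\<Union>ek\<in>E \<times> \<tau> ` C. Y ek)"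
    proof
      fix x assume "x \<in> A - {x \<in> C. \<forall>y\<in>C. y \<preceq> x}"
      then obtain y where y: "x \<in> C" "y \<in> C" "\<not> y \<preceq> x" using A(2) by blast
      then have "x \<preceq> y" "x \<noteq> y" using total refl by blast+
      then obtain e where "e \<in> E" "G e x" using G_exists by blast
      then have "(e, \<tau> x) \<in> E \<times> \<tau> ` C" "x \<in> Y (e, \<tau> x)" using y(1) unfolding Y_def X_def by auto
      then show "x \<in> (\<Union>ek\<in>E \<times> \<tau> ` C. Y ek)" by blast
    qed
    then obtain ek where ek: "ek \<in> E \<times> \<tau> ` C" "infinite ((A - {x \<in> C. \<forall>y\<in>C. y \<preceq> x}) \<inter> Y ek)"
      using infinite_colour_class[OF _ _ inf, of "E \<times> \<tau> ` C" Y] fin_g fin_\<tau> by blast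
    obtain e k where [simp]: "ek = (e, k)" by (cases ek)
    have Y: "definable S d (Y ek)"
      by (simp add: Y_def)
        (intro definable_subset[OF definable_C] def_rules G_rule def_pred_mem[OF X] def_list_block)
    have "infinite (A \<inter> Y ek)" using ek(2) by (rule infinite_super[rotated]) blast
    then obtain p0 q0 where pq: "p0 \<preceq> q0" "p0 \<noteq> q0"
      and seg: "\<And>z. p0 \<preceq> z \<Longrightarrow> z \<preceq> q0 \<Longrightarrow> z \<in> A \<inter> Y ek"
      using definable_Int_segment[OF A(1) Y A(2)] by metis
    have pqC: "p0 \<in> C" "q0 \<in> C" using le_C[OF pq(1)] by blast+
    define T where "T = {x \<in> C. p0 \<preceq> x \<and> x \<preceq> q0 \<and> \<not> x = q0}"
    have T: "definable S d T"
      unfolding T_def by (intro definable_subset[OF definable_C] def_rules chain_rules pqC)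
    have "infinite ({z. p0 \<preceq> z \<and> z \<preceq> q0} - {q0})" using infinite_between[OF pq] by simp
    then have infT: "infinite T"
      by (rule infinite_super[rotated]) (use le_C in \<open>auto simp: T_def\<close>)
    \<comment> \<open>The range of validity of the germ at \<open>x\<close>, cut off at
      \<open>q0\<close>. The germ \<open>e\<close> is already common to all points of
      \<open>T\<close>.\<close>
    define Q where "Q x z \<longleftrightarrow> z \<preceq> q0 \<and> x \<preceq> z \<and> \<not> x = z \<and>
      (\<forall>y\<in>C. x \<preceq> y \<and> \<not> x = y \<and> y \<preceq> z \<longrightarrow> \<Lambda> e x y)" for x z
    have Q: "def_rel S d d Q"
      unfolding Q_def def_rel_def by (intro def_rules chain_rules def_rel_subst[OF \<Lambda>] pqC)
    have "infinite {z \<in> H. Q x z}" if x: "x \<in> T" for x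
    proof -
      have xx: "x \<in> C" "p0 \<preceq> x" "x \<preceq> q0" "x \<noteq> q0" using x unfolding T_def by auto
      then have "G e x" using seg[OF xx(2,3)] unfolding Y_def by simp
      then obtain z where z: "z \<in> C" "x \<preceq> z" "x \<noteq> z" "\<And>y. x \<preceq> y \<Longrightarrow> x \<noteq> y \<Longrightarrow> y \<preceq> z \<Longrightarrow> \<Lambda> e x y"
        unfolding G_def using le_C by metis
      obtain z' where z': "x \<preceq> z'" "x \<noteq> z'" "z' \<preceq> z" "z' \<preceq> q0"
        using total[OF z(1) pqC(2)] z xx refl[OF z(1)] refl[OF pqC(2)] by blast
      have "infinite ({w. x \<preceq> w \<and> w \<preceq> z'} - {x})" using infinite_between[OF z'(1,2)] by simp
      moreover have "{w. x \<preceq> w \<and> w \<preceq> z'} - {x} \<subseteq> {z \<in> H. Q x z}"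
      proof
        fix w assume w: "w \<in> {w. x \<preceq> w \<and> w \<preceq> z'} - {x}"
        then have "w \<preceq> q0" "w \<in> H" using trans[OF _ z'(4)] le_C C_subset by blast+
        moreover have "\<Lambda> e x y" if "x \<preceq> y" "x \<noteq> y" "y \<preceq> w" for y
          using z(4)[OF that(1,2)] trans[OF that(3)] trans[OF _ z'(3)] w by blast
        ultimately show "w \<in> {z \<in> H. Q x z}" using w unfolding Q_def by blast
      qed
      ultimately show ?thesis using infinite_super by blast
    qed
    \<comment> \<open>One \<open>z\<close> lies in the range of infinitely many germs. If
      \<open>a\<close> and a later point \<open>b\<close> are such points, then
      \<open>b \<preceq> z\<close>, so \<open>b\<close> is in the range of the germ at
      \<open>a\<close> and the pair has colour \<open>e\<close>.\<close>
    then obtain z where z: "z \<in> H" "infinite {x \<in> T. Q x z}"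
      using infinite_fibers_overlap[OF Q T infT] by blast
    define A' where "A' = {x \<in> T. Q x z}"
    have "A' \<noteq> {}" using z(2) unfolding A'_def by (metis finite.emptyI)
    then have zC: "z \<in> C" unfolding A'_def Q_def using le_C by blast
    have "definable S d A'"
      unfolding A'_def by (intro definable_subset[OF T] def_rel_subst[OF Q] chain_rules zC)
    moreover have "A' \<subseteq> C" unfolding A'_def T_def by blast
    ultimately obtain p q where pq': "p \<in> A'" "q \<in> A'" "p \<preceq> q" "p \<noteq> q"
      and seg': "\<And>x. p \<preceq> x \<Longrightarrow> x \<preceq> q \<Longrightarrow> x \<in> A'"
      using exists_segment[of A'] z(2) unfolding A'_def by blast
    have A'_sub: "x \<in> A \<inter> Y ek" if "x \<in> A'" for x using that seg unfolding A'_def T_def by blast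
    have "hom e k p q"
      unfolding hom_def
    proof (intro conjI ballI impI)
      fix a assume "a \<in> C" "p \<preceq> a \<and> a \<preceq> q"
      then show "G e a" "a \<in> X k" using A'_sub[OF seg'] unfolding Y_def by auto
    next
      fix a b assume ab: "a \<in> C" "b \<in> C" "p \<preceq> a \<and> a \<preceq> b \<and> \<not> a = b \<and> b \<preceq> q"
      then have "a \<in> A'" "b \<in> A'" using seg' trans by blast+
      then have "Q a z" "b \<preceq> z" unfolding A'_def Q_def by auto
      then show "\<Lambda> e a b" using ab unfolding Q_def by blast
    qed
    then have "P p q" unfolding P_def using pq'(3) ek(1) by auto
    then show ?thesis using A'_sub pq' by blast
  qed
  have conv: "convex_rel P" unfolding convex_rel_def using P_le P_refl P_mono P_glue by blast
  have hits: "hits_infinite_sets P" unfolding hits_infinite_sets_def using hit by blast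
  obtain n :: nat and M :: "nat \<Rightarrow> 'a list set" where
    M_P: "\<And>i x y. i \<in> {1..n} \<Longrightarrow> x \<in> M i \<Longrightarrow> y \<in> M i \<Longrightarrow> x \<preceq> y \<Longrightarrow> P x y" and
    M_ne: "\<And>i. i \<in> {1..n} \<Longrightarrow> M i \<noteq> {}" and
    M_disj: "disjoint_family_on M {1..n}" and
    M_C: "(\<Union>i\<in>{1..n}. M i) = C" and
    M_ord: "\<And>i j x y. i \<in> {1..n} \<Longrightarrow> j \<in> {1..n} \<Longrightarrow> i < j \<Longrightarrow> x \<in> M i \<Longrightarrow> y \<in> M j \<Longrightarrow> x \<preceq> y \<and> x \<noteq> y" and
    M_conv: "\<And>i x y z. i \<in> {1..n} \<Longrightarrow> x \<in> M i \<Longrightarrow> y \<in> M i \<Longrightarrow> x \<preceq> z \<Longrightarrow> z \<preceq> y \<Longrightarrow> z \<in> M i" and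
    M_cell: "\<And>i. i \<in> {1..n} \<Longrightarrow> (\<exists>x\<in>C. M i = {x}) \<or>
       chain_interval C D \<iota> (M i) \<and> (\<forall>x\<in>M i. (\<exists>y\<in>M i. x \<preceq> y \<and> x \<noteq> y) \<and> (\<exists>y\<in>M i. y \<preceq> x \<and> y \<noteq> x))"
    by (rule convex_classes_cells[OF P conv hits]) (rule that; assumption)
  have M_sub: "x \<in> C" if "i \<in> {1..n}" "x \<in> M i" for i x using M_C that by blast
  have M_\<tau>: "\<tau> x = \<tau> y" if i: "i \<in> {1..n}" and xy: "x \<in> M i" "y \<in> M i" "x \<preceq> y" for i x y
  proof (cases "x = y")
    case False
    then obtain e k where "hom e k x y" using M_P[OF i xy] unfolding P_def by blast
    then have "x \<in> X k" "y \<in> X k" using M_sub[OF i] xy refl unfolding hom_def by blast+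
    then show ?thesis by (simp add: X_def)
  qed simp
  have M_hom: "g x y = g x z \<and> g y z = g x z"
    if i: "i \<in> {1..n}" and x: "x \<in> M i" and z: "z \<in> M i"
      and le: "x \<preceq> y" "x \<noteq> y" "y \<preceq> z" "y \<noteq> z" for i x y z
  proof -
    have xz: "x \<preceq> z" "x \<noteq> z" using le trans antisym by blast+
    then obtain e k where "hom e k x z" using M_P[OF i x z] unfolding P_def by blast
    then have "\<Lambda> e x y" "\<Lambda> e y z" "\<Lambda> e x z" using le xz refl le_C unfolding hom_def by blast+
    then show ?thesis by (simp add: \<Lambda>_def)
  qed
  have M_idem: "c (g x y) (g x y) = g x y"
    if i: "i \<in> {1..n}" and xy: "x \<in> M i" "y \<in> M i" "x \<preceq> y" "x \<noteq> y" for i x y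
  proof -
    obtain w where w: "x \<preceq> w" "w \<preceq> y" "w \<noteq> x" "w \<noteq> y" using between_exists[OF xy(3,4)] by blast
    have eq: "g x w = g x y" "g w y = g x y"
      using M_hom[OF i xy(1,2) w(1) _ w(2,4)] w(3) by blast+
    have "g x y = c (g w y) (g x w)" by (rule comp) (use w in auto)
    then show ?thesis unfolding eq by (rule sym)
  qed
  have M_below: "g x y = g x y'"
    if i: "i \<in> {1..n}" and x: "x \<in> M i" and y: "y \<in> M i" "y' \<in> M i"
      and le: "x \<preceq> y" "x \<noteq> y" "x \<preceq> y'" "x \<noteq> y'" for i x y y'
  proof -
    consider "y = y'" | "y \<preceq> y'" "y \<noteq> y'" | "y' \<preceq> y" "y' \<noteq> y"
      using total[OF M_sub[OF i y(1)] M_sub[OF i y(2)]] by blast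
    then show ?thesis
    proof cases
      case 2
      then show ?thesis using M_hom[OF i x y(2) le(1,2)] by simp
    next
      case 3
      then show ?thesis using M_hom[OF i x y(1) le(3,4)] by simp
    qed simp
  qed
  have M_above: "g y x = g y' x"
    if i: "i \<in> {1..n}" and x: "x \<in> M i" and y: "y \<in> M i" "y' \<in> M i"
      and le: "y \<preceq> x" "y \<noteq> x" "y' \<preceq> x" "y' \<noteq> x" for i x y y'
  proof -
    consider "y = y'" | "y \<preceq> y'" "y \<noteq> y'" | "y' \<preceq> y" "y' \<noteq> y"
      using total[OF M_sub[OF i y(1)] M_sub[OF i y(2)]] by blast
    then show ?thesis
    proof cases
      case 2
      then show ?thesis using M_hom[OF i y(1) x 2 le(3,4)] by simp
    next
      case 3
      then show ?thesis using M_hom[OF i y(2) x 3 le(1,2)] by simp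
    qed simp
  qed
  have upper: "\<exists>z\<in>M i. x \<preceq> z \<and> x \<noteq> z \<and> x' \<preceq> z \<and> x' \<noteq> z"
    if i: "i \<in> {1..n}" and x: "x \<in> M i" "x' \<in> M i" "x \<noteq> x'" for i x x'
  proof -
    have no_max: "\<exists>y\<in>M i. w \<preceq> y \<and> w \<noteq> y" if "w \<in> M i" for w
      using M_cell[OF i] x that by auto
    consider "x \<preceq> x'" | "x' \<preceq> x" using total M_sub[OF i] x by blast
    then show ?thesis
    proof cases
      case 1
      obtain z where "z \<in> M i" "x' \<preceq> z" "x' \<noteq> z" using no_max[OF x(2)] by blast
      then show ?thesis using 1 trans antisym by blast
    next
      case 2
      obtain z where "z \<in> M i" "x \<preceq> z" "x \<noteq> z" using no_max[OF x(1)] by blast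
      then show ?thesis using 2 trans antisym by blast
    qed
  qed
  have lower: "\<exists>z\<in>M i. z \<preceq> x \<and> z \<noteq> x \<and> z \<preceq> x' \<and> z \<noteq> x'"
    if i: "i \<in> {1..n}" and x: "x \<in> M i" "x' \<in> M i" "x \<noteq> x'" for i x x'
  proof -
    have no_min: "\<exists>y\<in>M i. y \<preceq> w \<and> y \<noteq> w" if "w \<in> M i" for w
      using M_cell[OF i] x that by auto
    consider "x \<preceq> x'" | "x' \<preceq> x" using total M_sub[OF i] x by blast
    then show ?thesis
    proof cases
      case 1
      obtain z where "z \<in> M i" "z \<preceq> x" "z \<noteq> x" using no_min[OF x(1)] by blast
      then show ?thesis using 1 trans antisym by blast
    next
      case 2
      obtain z where "z \<in> M i" "z \<preceq> x'" "z \<noteq> x'" using no_min[OF x(2)] by blast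
      then show ?thesis using 2 trans antisym by blast
    qed
  qed
  \<comment> \<open>A point \<open>z\<close> of the cell above both \<open>x\<close> and
    \<open>x'\<close> lets additivity factor both colours through \<open>g z y\<close>.\<close>
  have const_left: "g x y = g x' y"
    if ij: "i \<in> {1..n}" "j \<in> {1..n}" "i < j" and x: "x \<in> M i" "x' \<in> M i" and y: "y \<in> M j" for i j x x' y
  proof (cases "x = x'")
    case False
    obtain z where z: "z \<in> M i" "x \<preceq> z" "x \<noteq> z" "x' \<preceq> z" "x' \<noteq> z"
      using upper[OF ij(1) x False] by blast
    have zy: "z \<preceq> y" "z \<noteq> y" using M_ord[OF ij z(1) y] by blast+
    have "g x z = g x' z" using M_above[OF ij(1) z(1) x z(2-5)] .
    then show ?thesis using comp[OF z(2,3) zy] comp[OF z(4,5) zy] by simp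
  qed simp
  have const_right: "g x y = g x y'"
    if ij: "i \<in> {1..n}" "j \<in> {1..n}" "i < j" and x: "x \<in> M i" and y: "y \<in> M j" "y' \<in> M j" for i j x y y'
  proof (cases "y = y'")
    case False
    obtain z where z: "z \<in> M j" "z \<preceq> y" "z \<noteq> y" "z \<preceq> y'" "z \<noteq> y'"
      using lower[OF ij(2) y False] by blast
    have xz: "x \<preceq> z" "x \<noteq> z" using M_ord[OF ij x z(1)] by blast+
    have "g z y = g z y'" using M_below[OF ij(2) z(1) y z(2-5)] .
    then show ?thesis using comp[OF xz z(2,3)] comp[OF xz z(4,5)] by simp
  qed simp
  have same: "g x y = g x' y'"
    if i: "i \<in> {1..n}" and x: "x \<in> M i" "y \<in> M i" "x \<preceq> y" "x \<noteq> y"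
      and x': "x' \<in> M i" "y' \<in> M i" "x' \<preceq> y'" "x' \<noteq> y'" for i x y x' y'
  proof -
    \<comment> \<open>Both pairs are compared with pairs that start at a common lower point
      \<open>z\<close> of the cell.\<close>
    have "\<exists>z\<in>M i. z \<preceq> x \<and> z \<noteq> x \<and> z \<preceq> x' \<and> z \<noteq> x'"
    proof (cases "x = x'")
      case True
      then show ?thesis using M_cell[OF i] x by auto
    next
      case False
      then show ?thesis using lower[OF i x(1) x'(1)] by blast
    qed
    then obtain z where z: "z \<in> M i" "z \<preceq> x" "z \<noteq> x" "z \<preceq> x'" "z \<noteq> x'" by blast
    have "z \<preceq> y" "z \<noteq> y" "z \<preceq> y'" "z \<noteq> y'" using z x x' trans antisym by blast+
    then have "g z y = g z y'" using M_below[OF i z(1) x(2) x'(2)] by blast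
    then show ?thesis
      using M_hom[OF i z(1) x(2) z(2,3) x(3,4)] M_hom[OF i z(1) x'(2) z(4,5) x'(3,4)] by simp
  qed
  show thesis
  proof (rule that[of n M])
    show "chain_cell C D \<iota> (M i) \<and> M i \<noteq> {}" if "i \<in> {1..n}" for i
      using M_cell[OF that] M_ne[OF that] unfolding chain_cell_def by blast
    show "\<tau> x = \<tau> y" if "i \<in> {1..n}" "x \<in> M i" "y \<in> M i" for i x y
      using M_\<tau>[OF that] M_\<tau>[OF that(1,3,2)] total M_sub[OF that(1)] that(2,3) by metis
    show "g x y = g x' y'"
      if "i \<in> {1..n}" "j \<in> {1..n}" "i \<le> j" "x \<in> M i" "y \<in> M j" "x \<preceq> y" "x \<noteq> y"
        "x' \<in> M i" "y' \<in> M j" "x' \<preceq> y'" "x' \<noteq> y'" for i j x y x' y'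
    proof (cases "i = j")
      case True
      then show ?thesis using same that by blast
    next
      case False
      then have "i < j" using that(3) by simp
      then have "g x y = g x' y" "g x' y = g x' y'" using const_left const_right that by blast+
      then show ?thesis by simp
    qed
  qed (use M_disj M_C M_ord M_idem in blast)+
qed

end

section \<open>Lexicographic types\<close>

lemma lex_less_iff_nth:
  assumes "length x = d" "length y = d"
  shows "lex_less x y \<longleftrightarrow> (\<exists>i<d. (\<forall>j<i. x ! j = y ! j) \<and> x ! i < y ! i)"
proof -
  have "take i x = take i y \<longleftrightarrow> (\<forall>j<i. x ! j = y ! j)" if "i < d" for i
    using assms that by (auto simp: list_eq_iff_nth_eq)
  then show ?thesis unfolding lexord_take_index_conv using assms by auto
qed

lemma lex_less_trans: "lex_less x y \<Longrightarrow> lex_less y z \<Longrightarrow> lex_less x (z :: 'a::linorder list)"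
  by (erule lexord_trans, assumption) (auto simp: trans_def)

lemma lex_less_irrefl: "\<not> lex_less x (x :: 'a::linorder list)"
  by (rule lexord_irreflexive) simp

lemma lex_less_linear: "lex_less x y \<or> x = y \<or> lex_less y (x :: 'a::linorder list)"
  by (rule lexord_linear) auto

lemma lex_rank_less:
  fixes F :: "'a::linorder list set"
  assumes "finite F" "y \<in> F" "lex_less y z"
  shows "card {w \<in> F. lex_less w y} < card {w \<in> F. lex_less w z}"
proof (rule psubset_card_mono)
  have "y \<in> {w \<in> F. lex_less w z}" "y \<notin> {w \<in> F. lex_less w y}"
    using assms lex_less_irrefl[of y] by auto
  then show "{w \<in> F. lex_less w y} \<subset> {w \<in> F. lex_less w z}"
    using lex_less_trans[OF _ assms(3)] by blast
qed (use assms(1) in simp)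

lemma lex_rank_bound:
  fixes F :: "'a::linorder list set"
  assumes "finite F" "z \<in> F"
  shows "card {w \<in> F. lex_less w z} < card F"
proof (rule psubset_card_mono[OF assms(1)])
  have "z \<notin> {w \<in> F. lex_less w z}" using lex_less_irrefl[of z] by simp
  then show "{w \<in> F. lex_less w z} \<subset> F" using assms(2) by blast
qed

lemma lex_rank_bij:
  fixes F :: "'a::linorder list set"
  assumes "finite F"
  shows "bij_betw (\<lambda>z. card {w \<in> F. lex_less w z}) F {..<card F}"
proof -
  let ?\<rho> = "\<lambda>z. card {w \<in> F. lex_less w z}"
  have inj: "inj_on ?\<rho> F"
  proof (rule inj_onI, rule ccontr)
    fix y z assume yz: "y \<in> F" "z \<in> F" "?\<rho> y = ?\<rho> z" "y \<noteq> z"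
    then consider "lex_less y z" | "lex_less z y" using lex_less_linear by blast
    then show False
    proof cases
      case 1
      then show ?thesis using lex_rank_less[OF assms yz(1)] yz(3) by fastforce
    next
      case 2
      then show ?thesis using lex_rank_less[OF assms yz(2)] yz(3) by fastforce
    qed
  qed
  have "?\<rho> ` F = {..<card F}"
    using lex_rank_bound[OF assms] by (intro card_subset_eq) (auto simp: card_image[OF inj])
  then show ?thesis using inj by (simp add: bij_betw_def)
qed

section \<open>Definability of lexicographic coordinates and fiber types\<close>

locale fibered_lattice = curve_lattice S L d
  for S :: "('f, 'r, 'a::linordered_field) expansion" and L :: "'a list gorder" (structure) and d +
  fixes N :: nat
  assumes fibers: "\<forall>x\<in>principal_chain d L.
    finite (principal_fiber d L x) \<and> card (principal_fiber d L x) \<le> N"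
begin

abbreviation F :: "'a list \<Rightarrow> 'a list set" where "F \<equiv> principal_fiber d L"

lemma finite_F: "x \<in> C \<Longrightarrow> finite (F x)" using fibers by blast

lemma F_carrier: "z \<in> F x \<Longrightarrow> z \<in> carrier L" unfolding principal_fiber_def by blast

text \<open>The rank condition implies \<open>n \<le> card (F x)\<close>, and ranks are unique, so
  the case distinction and the definite description both disappear.\<close>

lemma lex_coord_eq_Some_iff:
  assumes x: "x \<in> C"
  shows "lex_coord d L n x = Some z \<longleftrightarrow>
    1 \<le> n \<and> z \<in> F x \<and> card {w \<in> F x. lex_less w z} = n - 1"
proof -
  note bij = lex_rank_bij[OF finite_F[OF x]]
  note rank = lex_rank_bound[OF finite_F[OF x]]
  have unique: "z = z'" if "z \<in> F x \<and> card {w \<in> F x. lex_less w z} = n - 1"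
    "z' \<in> F x \<and> card {w \<in> F x. lex_less w z'} = n - 1" for z z'
    using inj_onD[OF bij_betw_imp_inj_on[OF bij], of z z'] that by simp
  show ?thesis
  proof (cases "1 \<le> n \<and> n \<le> card (F x)")
    case True
    then have "n - 1 < card (F x)" by linarith
    then have "n - 1 \<in> (\<lambda>z. card {w \<in> F x. lex_less w z}) ` F x"
      unfolding bij_betw_imp_surj_on[OF bij] by simp
    then obtain u where u: "u \<in> F x \<and> card {w \<in> F x. lex_less w u} = n - 1" by auto
    then have "(THE z. z \<in> F x \<and> card {w \<in> F x. lex_less w z} = n - 1) = u"
      using unique by blast
    then have "lex_coord d L n x = Some u" using True unfolding lex_coord_def by simp
    then show ?thesis using u unique True by auto
  next
    case False
    then have "lex_coord d L n x = None" unfolding lex_coord_def by auto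
    moreover have "\<not> (1 \<le> n \<and> z \<in> F x \<and> card {w \<in> F x. lex_less w z} = n - 1)"
      using False rank[of z] by auto
    ultimately show ?thesis by simp
  qed
qed

lemma lex_coord_exists:
  assumes "x \<in> C" "z \<in> F x"
  shows "\<exists>!j. j \<in> {1..N} \<and> lex_coord d L j x = Some z"
proof (rule ex1I)
  let ?j = "Suc (card {w \<in> F x. lex_less w z})"
  have "card {w \<in> F x. lex_less w z} < card (F x)"
    using lex_rank_bound[OF finite_F[OF assms(1)] assms(2)] .
  then have "?j \<le> N" using fibers assms(1) by fastforce
  then show "?j \<in> {1..N} \<and> lex_coord d L ?j x = Some z"
    using assms by (simp add: lex_coord_eq_Some_iff)
  show "j = ?j" if "j \<in> {1..N} \<and> lex_coord d L j x = Some z" for j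
    using that assms(1) by (auto simp: lex_coord_eq_Some_iff)
qed

text \<open>Replaces the principal projection by finiteness of an interval, which is a first-order
  condition.\<close>

definition in_fiber :: "'a list \<Rightarrow> 'a list \<Rightarrow> bool" where
  "in_fiber x z \<longleftrightarrow> x \<in> C \<and> leq x z \<and> finite {w \<in> carrier L. leq x w \<and> leq w z}"

lemma in_fiber_iff: "in_fiber x z \<longleftrightarrow> x \<in> C \<and> z \<in> F x"
proof -
  have "{w \<in> carrier L. leq x w \<and> leq w z} = \<lbrace>x..z\<rbrace>" if "x \<in> C" "z \<in> carrier L"
    using that C_carrier by (auto simp: leq_def interval_iff)
  then show ?thesis
    unfolding in_fiber_def using principal_fiber_iff C_carrier by (auto simp: leq_def)
qed

lemmas lattice_rules = leq_rules def_pred_mem[OF definable_C]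

lemma def_rel_in_fiber: "def_rel S d d in_fiber"
  unfolding in_fiber_def def_rel_def
  by (intro def_rules lattice_rules def_pred_finite_list[OF definable_H])

lemma def_pred_lex_less:
  assumes "def_list d f" "def_list d g"
  shows "def_pred S (\<lambda>v. lex_less (f v) (g v))"
proof -
  have "def_pred S (\<lambda>v. \<exists>i<d. (\<forall>j<i. f v ! j = g v ! j) \<and> f v ! i < g v ! i)"
    by (intro def_pred_bex_less def_pred_conj def_pred_ball_less def_pred_eq def_pred_less
        def_term_nth[OF assms(1)] def_term_nth[OF assms(2)]) auto
  then show ?thesis
    using lex_less_iff_nth[OF def_list_length[OF assms(1)] def_list_length[OF assms(2)]] by simp
qed

text \<open>The rank of \<open>z\<close> in the fiber, in a form that is visibly first-order.\<close>

primrec has_rank :: "nat \<Rightarrow> 'a list \<Rightarrow> 'a list \<Rightarrow> bool" where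
  "has_rank 0 x z \<longleftrightarrow> in_fiber x z \<and> (\<forall>w\<in>carrier L. in_fiber x w \<longrightarrow> \<not> lex_less w z)"
| "has_rank (Suc n) x z \<longleftrightarrow> in_fiber x z \<and> (\<exists>w\<in>carrier L. has_rank n x w \<and> lex_less w z \<and>
     (\<forall>u\<in>carrier L. in_fiber x u \<and> lex_less u z \<longrightarrow> u = w \<or> lex_less u w))"

lemma has_rank_iff:
  "has_rank n x z \<longleftrightarrow> x \<in> C \<and> z \<in> F x \<and> card {w \<in> F x. lex_less w z} = n"
proof (induction n arbitrary: z)
  case 0
  have "card {w \<in> F x. lex_less w z} = 0 \<longleftrightarrow> (\<forall>w\<in>F x. \<not> lex_less w z)" if "x \<in> C"
    using finite_F[OF that] by auto
  then show ?case using F_carrier by (auto simp: in_fiber_iff)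
next
  case (Suc n)
  show ?case
  proof
    assume "has_rank (Suc n) x z"
    then obtain w where x: "x \<in> C" and z: "z \<in> F x" and w: "w \<in> F x" "card {u \<in> F x. lex_less u w} = n"
      "lex_less w z" and max: "\<And>u. u \<in> F x \<Longrightarrow> lex_less u z \<Longrightarrow> u = w \<or> lex_less u w"
      using F_carrier by (auto simp: in_fiber_iff Suc.IH)
    \<comment> \<open>\<open>w\<close> is the immediate predecessor of \<open>z\<close> in the
      fiber.\<close>
    have "{u \<in> F x. lex_less u z} = insert w {u \<in> F x. lex_less u w}"
      using w max lex_less_trans by blast
    moreover have "w \<notin> {u \<in> F x. lex_less u w}" using lex_less_irrefl by blast
    ultimately have "card {u \<in> F x. lex_less u z} = Suc n" using w(2) finite_F[OF x] by simp
    then show "x \<in> C \<and> z \<in> F x \<and> card {w \<in> F x. lex_less w z} = Suc n" using x z by blast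
  next
    assume *: "x \<in> C \<and> z \<in> F x \<and> card {w \<in> F x. lex_less w z} = Suc n"
    note bij = lex_rank_bij[OF finite_F, of x]
    have "Suc n < card (F x)" using lex_rank_bound[OF finite_F, of x z] * by simp
    then have "n \<in> (\<lambda>z. card {w \<in> F x. lex_less w z}) ` F x" using bij * by (auto simp: bij_betw_def)
    then obtain w where w: "w \<in> F x" "card {u \<in> F x. lex_less u w} = n" by auto
    have fin: "finite (F x)" using finite_F * by blast
    have below: "u = w \<or> lex_less u w" if u: "u \<in> F x" "lex_less u z" for u
      using lex_less_linear[of u w] lex_rank_less[OF fin u] lex_rank_less[OF fin w(1), of u] w * by auto
    have "lex_less w z"
      using lex_less_linear[of w z] lex_rank_less[OF fin, of z w] w * by auto
    moreover have "\<forall>u\<in>carrier L. in_fiber x u \<and> lex_less u z \<longrightarrow> u = w \<or> lex_less u w"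
      using below by (auto simp: in_fiber_iff)
    moreover have "has_rank n x w" using Suc.IH[of w] w * by blast
    ultimately show "has_rank (Suc n) x z"
      unfolding has_rank.simps using * F_carrier[OF w(1)] in_fiber_iff by blast
  qed
qed

lemma def_rel_has_rank: "def_rel S d d (has_rank n)"
proof (induction n)
  case 0
  show ?case
    unfolding def_rel_def has_rank.simps
    by (intro def_rules def_rel_subst[OF def_rel_in_fiber] lattice_rules def_pred_lex_less)
next
  case (Suc n)
  show ?case
    unfolding def_rel_def has_rank.simps
    by (intro def_rules def_rel_subst[OF def_rel_in_fiber] def_rel_subst[OF Suc]
        lattice_rules def_pred_lex_less)
qed

definition coord :: "nat \<Rightarrow> 'a list \<Rightarrow> 'a list \<Rightarrow> bool" where
  "coord n x z \<longleftrightarrow> 1 \<le> n \<and> has_rank (n - 1) x z"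

lemma coord_iff: "coord n x z \<longleftrightarrow> x \<in> C \<and> lex_coord d L n x = Some z"
  unfolding coord_def has_rank_iff using lex_coord_eq_Some_iff by blast

lemma coord_F: "coord n x z \<Longrightarrow> x \<in> C \<and> z \<in> F x"
  unfolding coord_def has_rank_iff by blast

lemma def_rel_coord: "def_rel S d d (coord n)"
  unfolding coord_def def_rel_def
  by (intro def_pred_conj def_pred_const def_rel_subst[OF def_rel_has_rank] lattice_rules)

definition is_join :: "'a list \<Rightarrow> 'a list \<Rightarrow> 'a list \<Rightarrow> bool" where
  "is_join x y z \<longleftrightarrow> leq x z \<and> leq y z \<and> (\<forall>w\<in>carrier L. leq x w \<and> leq y w \<longrightarrow> leq z w)"

lemma is_join_iff: "x \<in> carrier L \<Longrightarrow> y \<in> carrier L \<Longrightarrow> is_join x y z \<longleftrightarrow> z = x \<squnion> y"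
  unfolding is_join_def using leq_joinI by blast

text \<open>The fiber type is rebuilt from the finite set of its valid triples; in this form
  \<open>def_pred_finite_valued\<close> yields its definability.\<close>

definition table_of :: "(nat \<times> nat \<times> nat) set \<Rightarrow> nat list list" where
  "table_of A = map (\<lambda>i. map (\<lambda>j. if \<exists>k. (i, j, k) \<in> A then THE k. (i, j, k) \<in> A else 0)
     [1..<Suc N]) [1..<Suc N]"

definition table_entry :: "nat \<times> nat \<times> nat \<Rightarrow> 'a list \<Rightarrow> bool" where
  "table_entry ijk x \<longleftrightarrow> (case ijk of (i, j, k) \<Rightarrow>
     \<exists>u\<in>carrier L. \<exists>v\<in>carrier L. \<exists>w\<in>carrier L. coord i x u \<and> coord j x v \<and> coord k x w \<and> is_join u v w)"

lemma lex_fiber_type_eq: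
  assumes "x \<in> C"
  shows "lex_fiber_type d L N x = table_of {ijk \<in> {1..N} \<times> {1..N} \<times> {1..N}. table_entry ijk x}"
proof -
  have coord: "lex_coord d L n x = Some z \<longleftrightarrow> z \<in> carrier L \<and> coord n x z" for n z
    using coord_iff assms coord_F F_carrier by blast
  have eq: "(k \<in> {1..N} \<and> (\<exists>u v w. lex_coord d L i x = Some u \<and> lex_coord d L j x = Some v \<and>
      lex_coord d L k x = Some w \<and> u \<squnion> v = w)) \<longleftrightarrow>
      (i, j, k) \<in> {ijk \<in> {1..N} \<times> {1..N} \<times> {1..N}. table_entry ijk x}"
    if "i \<in> {1..N}" "j \<in> {1..N}" for i j k
    using that unfolding coord table_entry_def by (auto simp: is_join_iff) (metis join_closed)
  show ?thesis
    unfolding lex_fiber_type_def table_of_def Let_def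
  proof (intro map_cong HOL.refl)
    fix i j assume "i \<in> set [1..<Suc N]" "j \<in> set [1..<Suc N]"
    then have "i \<in> {1..N}" "j \<in> {1..N}" by auto
    note eq = eq[OF this]
    show "(if \<exists>k. k \<in> {1..N} \<and> (\<exists>u v w. lex_coord d L i x = Some u \<and> lex_coord d L j x = Some v \<and>
          lex_coord d L k x = Some w \<and> u \<squnion> v = w)
        then THE k. k \<in> {1..N} \<and> (\<exists>u v w. lex_coord d L i x = Some u \<and> lex_coord d L j x = Some v \<and>
          lex_coord d L k x = Some w \<and> u \<squnion> v = w) else 0) =
      (if \<exists>k. (i, j, k) \<in> {ijk \<in> {1..N} \<times> {1..N} \<times> {1..N}. table_entry ijk x}
        then THE k. (i, j, k) \<in> {ijk \<in> {1..N} \<times> {1..N} \<times> {1..N}. table_entry ijk x} else 0)"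
      unfolding eq ..
  qed
qed

lemma def_pred_table_entry:
  assumes "def_list d f"
  shows "def_pred S (\<lambda>v. table_entry ijk (f v))"
proof (rule def_pred_subst_list[OF _ assms])
  show "def_pred S (\<lambda>v. table_entry ijk (map v [0..<d]))"
    unfolding table_entry_def is_join_def
    by (cases ijk) (simp only: prod.case,
        intro def_rules lattice_rules def_rel_subst[OF def_rel_coord])
qed

lemma definable_lex_fiber_type: "definable S d {x \<in> C. lex_fiber_type d L N x = k}"
proof -
  let ?I = "{1..N} \<times> {1..N} \<times> {1..N}"
  have "definable S d {x \<in> C. table_of {ijk \<in> ?I. table_entry ijk x} = k}"
    by (intro definable_subset[OF definable_C] def_pred_finite_valued[of ?I] def_pred_table_entry
        def_list_block) simp
  also have "{x \<in> C. table_of {ijk \<in> ?I. table_entry ijk x} = k} = {x \<in> C. lex_fiber_type d L N x = k}"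
    using lex_fiber_type_eq by auto
  finally show ?thesis .
qed

lemma finite_lex_fiber_types: "finite (lex_fiber_type d L N ` C)"
proof (rule finite_subset)
  show "lex_fiber_type d L N ` C \<subseteq> table_of ` Pow ({1..N} \<times> {1..N} \<times> {1..N})"
    using lex_fiber_type_eq by blast
qed simp

section \<open>Gluing types and their composition\<close>

definition glue :: "'a list \<Rightarrow> 'a list \<Rightarrow> nat \<Rightarrow> nat" where
  "glue x y i = (case lex_coord d L i x of None \<Rightarrow> 0
     | Some u \<Rightarrow> (THE j. j \<in> {1..N} \<and> lex_coord d L j y = Some (y \<squnion> u)))"

lemma lex_gluing_type_eq: "lex_gluing_type d L N x y = map (glue x y) [1..<Suc N]"
  unfolding lex_gluing_type_def glue_def ..

text \<open>The join stays in the fiber over \<open>y\<close>, where every element has exactly one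
  index, so the description is proper.\<close>

lemma glue_Some:
  assumes "x \<in> C" "y \<in> C" "x \<sqsubseteq> y" "lex_coord d L i x = Some u"
  shows "glue x y i \<in> {1..N} \<and> lex_coord d L (glue x y i) y = Some (y \<squnion> u)"
proof -
  have "u \<in> F x" using assms(1,4) by (simp add: lex_coord_eq_Some_iff)
  then have "\<exists>!j. j \<in> {1..N} \<and> lex_coord d L j y = Some (y \<squnion> u)"
    using join_in_fiber[OF assms(1-3)] lex_coord_exists[OF assms(2)] by blast
  from theI'[OF this] show ?thesis unfolding glue_def assms(4) by simp
qed

lemma glue_None: "lex_coord d L i x = None \<Longrightarrow> glue x y i = 0"
  unfolding glue_def by simp

lemma glue_le:
  assumes "x \<in> C" "y \<in> C" "x \<sqsubseteq> y"
  shows "glue x y i \<le> N"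
  using glue_Some[OF assms, of i] glue_None[of i x y] by (cases "lex_coord d L i x") auto

lemma lex_gluing_type_in_seqs:
  assumes "x \<in> C" "y \<in> C" "x \<sqsubseteq> y"
  shows "lex_gluing_type d L N x y \<in> gluing_seqs N"
  unfolding lex_gluing_type_eq gluing_seqs_def using glue_le[OF assms] by auto

text \<open>As \<open>y \<sqsubseteq> z\<close>, joining with \<open>y\<close> and then with
  \<open>z\<close> equals joining with \<open>z\<close> at once, and indices in the fiber over
  \<open>z\<close> are unique. An undefined coordinate gives 0 on both sides.\<close>

lemma lex_gluing_type_comp:
  assumes x: "x \<in> C" and y: "y \<in> C" and z: "z \<in> C" and le: "x \<sqsubseteq> y" "y \<sqsubseteq> z"
  shows "lex_gluing_type d L N x z =
    gluing_comp (lex_gluing_type d L N y z) (lex_gluing_type d L N x y)"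
proof -
  have c: "x \<in> carrier L" "y \<in> carrier L" "z \<in> carrier L" using x y z C_carrier by blast+
  have xz: "x \<sqsubseteq> z" using le_trans[OF le c] .
  have entry: "seq_entry (map (glue a b) [1..<Suc N]) n = glue a b n" if "n \<in> {1..N}" for a b n
    using that unfolding seq_entry_def by (subst nth_map_upt) auto
  have "glue x z n = (if seq_entry (map (glue x y) [1..<Suc N]) n > 0 \<and>
        seq_entry (map (glue y z) [1..<Suc N]) (seq_entry (map (glue x y) [1..<Suc N]) n) > 0
      then seq_entry (map (glue y z) [1..<Suc N]) (seq_entry (map (glue x y) [1..<Suc N]) n) else 0)"
    if n: "n \<in> {1..N}" for n
  proof (cases "lex_coord d L n x")
    case None
    then show ?thesis using glue_None[OF None] entry[OF n] by simp
  next
    case (Some u)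
    have u: "u \<in> carrier L" using Some F_carrier unfolding lex_coord_eq_Some_iff[OF x] by blast
    note xy_n = glue_Some[OF x y le(1) Some]
    note yz_n = glue_Some[OF y z le(2) conjunct2[OF xy_n]]
    note xz_n = glue_Some[OF x z xz Some]
    have "z \<squnion> (y \<squnion> u) = z \<squnion> u"
    proof (rule le_antisym)
      show "z \<squnion> (y \<squnion> u) \<sqsubseteq> z \<squnion> u"
        by (rule join_le[OF join_left[OF c(3) u] join_mono_left[OF le(2) c(2,3) u]]) (use c u in auto)
      have "u \<sqsubseteq> z \<squnion> (y \<squnion> u)"
        using c u by (intro le_trans[OF join_right[OF c(2) u] join_right]) auto
      then show "z \<squnion> u \<sqsubseteq> z \<squnion> (y \<squnion> u)" using c u by (intro join_le) (auto intro: join_left)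
    qed (use c u in auto)
    then have "lex_coord d L (glue y z (glue x y n)) z = lex_coord d L (glue x z n) z"
      using yz_n xz_n by simp
    moreover have "z \<squnion> u \<in> F z" using xz_n z by (simp add: lex_coord_eq_Some_iff)
    ultimately have "glue y z (glue x y n) = glue x z n"
      using lex_coord_exists[OF z] yz_n xz_n by metis
    then show ?thesis using entry n xy_n xz_n by simp
  qed
  then show ?thesis
    unfolding lex_gluing_type_eq gluing_comp_def by (simp del: upt_Suc)
qed

text \<open>Plays the role of \<open>table_of\<close> for gluing types.\<close>

definition seq_of :: "(nat \<times> nat) set \<Rightarrow> nat list" where
  "seq_of A = map (\<lambda>i. if (i, 0) \<in> A then THE j. j \<in> {1..N} \<and> (i, j) \<in> A else 0) [1..<Suc N]"

text \<open>The pair \<open>(i, 0)\<close> encodes that the \<open>i\<close>-th coordinate of \<open>x\<close> is defined.\<close>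

definition seq_entries :: "nat \<times> nat \<Rightarrow> 'a list \<Rightarrow> 'a list \<Rightarrow> bool" where
  "seq_entries ij x y \<longleftrightarrow> (case ij of (i, j) \<Rightarrow> \<exists>u\<in>carrier L. coord i x u \<and>
     (j = 0 \<or> (\<exists>w\<in>carrier L. is_join y u w \<and> coord j y w)))"

lemma lex_gluing_type_eq_seq_of:
  assumes "x \<in> C" "y \<in> C"
  shows "lex_gluing_type d L N x y = seq_of {ij \<in> {1..N} \<times> {0..N}. seq_entries ij x y}"
proof -
  have coord: "coord n a z \<longleftrightarrow> lex_coord d L n a = Some z" if "a \<in> C" for a n z
    using coord_iff that by blast
  have car: "z \<in> carrier L" if "lex_coord d L n a = Some z" "a \<in> C" for a n z
    using coord[OF that(2)] that(1) coord_F F_carrier by blast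
  have "glue x y i = (if seq_entries (i, 0) x y
      then THE j. j \<in> {1..N} \<and> seq_entries (i, j) x y else 0)" if "i \<in> {1..N}" for i
  proof (cases "lex_coord d L i x")
    case None
    then show ?thesis unfolding glue_def seq_entries_def coord[OF assms(1)] by simp
  next
    case (Some u)
    have "u \<in> carrier L" "y \<in> carrier L" using car[OF Some assms(1)] assms(2) C_carrier by blast+
    then have "seq_entries (i, j) x y \<longleftrightarrow> j = 0 \<or> lex_coord d L j y = Some (y \<squnion> u)" for j
      unfolding seq_entries_def coord[OF assms(1)] coord[OF assms(2)] using Some
      by (auto simp: is_join_iff)
    moreover have "j \<in> {1..N} \<and> (j = 0 \<or> lex_coord d L j y = Some (y \<squnion> u)) \<longleftrightarrow>
        j \<in> {1..N} \<and> lex_coord d L j y = Some (y \<squnion> u)" for j by auto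
    ultimately show ?thesis unfolding glue_def Some by simp
  qed
  then show ?thesis
    unfolding lex_gluing_type_eq seq_of_def by (intro map_cong refl) (auto cong: conj_cong)
qed

definition chain_le :: "'a list \<Rightarrow> 'a list \<Rightarrow> bool" where
  "chain_le x y \<longleftrightarrow> x \<in> C \<and> y \<in> C \<and> leq x y"

lemma chain_le_iff: "chain_le x y \<longleftrightarrow> x \<in> C \<and> y \<in> C \<and> x \<sqsubseteq> y"
  unfolding chain_le_def leq_def using C_carrier by blast

lemma def_rel_chain_le: "def_rel S d d chain_le"
  unfolding chain_le_def def_rel_def by (intro def_rules lattice_rules)

lemma def_rel_seq_entries: "def_rel S d d (seq_entries ij)"
proof (cases ij)
  case (Pair i j)
  show ?thesis
    unfolding seq_entries_def is_join_def def_rel_def Pair prod.case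
    by (intro def_rules def_pred_const lattice_rules def_rel_subst[OF def_rel_coord])
qed

lemma def_rel_lex_gluing_type:
  "def_rel S d d (\<lambda>x y. chain_le x y \<and> x \<noteq> y \<and> lex_gluing_type d L N x y = e)"
proof -
  let ?I = "{1..N} \<times> {0..N}"
  have "(chain_le x y \<and> x \<noteq> y \<and> lex_gluing_type d L N x y = e) \<longleftrightarrow>
      chain_le x y \<and> \<not> x = y \<and> seq_of {ij \<in> ?I. seq_entries ij x y} = e" for x y
    using lex_gluing_type_eq_seq_of unfolding chain_le_iff by auto
  then show ?thesis
    unfolding def_rel_def
    by (simp only:) (intro def_pred_conj def_pred_not def_pred_finite_valued
        def_rel_subst[OF def_rel_seq_entries] def_rel_subst[OF def_rel_chain_le] lattice_rules; simp)
qed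

text \<open>Density of the chain is \<open>C_dense\<close>, hence a consequence of the finiteness of
  the fibers.\<close>

lemma definable_chain_C: "definable_chain S d (carrier L) C chain_le"
proof unfold_locales
  show "infinite {z. chain_le x z \<and> chain_le z y}" if "chain_le x y" "x \<noteq> y" for x y
  proof -
    have "infinite {z \<in> C. x \<sqsubseteq> z \<and> z \<sqsubseteq> y}"
      using that fibers by (intro C_dense) (auto simp: chain_le_iff)
    moreover have "{z \<in> C. x \<sqsubseteq> z \<and> z \<sqsubseteq> y} = {z. chain_le x z \<and> chain_le z y}"
      using that by (auto simp: chain_le_iff)
    ultimately show ?thesis by simp
  qed
  show "chain_le x y \<Longrightarrow> chain_le y z \<Longrightarrow> chain_le x z" for x y z
    unfolding chain_le_iff
    using le_trans[of x y z] C_carrier[of x] C_carrier[of y] C_carrier[of z] by blast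
  show "chain_le x y \<Longrightarrow> chain_le y x \<Longrightarrow> x = y" for x y
    unfolding chain_le_iff using le_antisym[of x y] C_carrier[of x] C_carrier[of y] by blast
qed (use definable_C C_subset def_rel_chain_le C_total C_carrier in \<open>auto simp: chain_le_iff\<close>)

end

section \<open>Assembly of the decomposition\<close>

lemma finite_gluing_seqs: "finite (gluing_seqs N)"
  unfolding gluing_seqs_def
  using finite_lists_length_eq[of "{0..N}" N] by (simp add: conj_commute)

text \<open>A one-point cell contains no pair from which to read its gluing type; this keeps the
  default value idempotent.\<close>

lemma gluing_comp_zero: "gluing_comp (replicate N 0) (replicate N 0) = replicate N 0"
  unfolding gluing_comp_def seq_entry_def by (rule nth_equalityI) (auto simp del: upt_Suc)

lemma length_lex_fiber_type_concat: "length (concat (lex_fiber_type d L N x)) = N * N"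
  unfolding lex_fiber_type_def Let_def
  by (simp add: length_concat comp_def sum_list_triv del: upt_Suc)

theorem theorem2p40:
  fixes S :: "('f, 'r, 'a::real_closed_field) expansion"
    and L D :: "'a list gorder"
    and \<iota> :: "'a list \<Rightarrow> 'a list"
    and d m N :: nat
  assumes "o_minimal S"
    and "definable_bounded_distrib_lattice S d L"
    and "omin_dim d (carrier L) = Some 1"
    and fibers: "\<forall>x\<in>principal_chain d L.
                   finite (principal_fiber d L x) \<and> card (principal_fiber d L x) \<le> N"
    and completion: "definable_completion S d L (principal_chain d L) m D \<iota>"
  shows "\<exists>(n::nat) (M :: nat \<Rightarrow> 'a list set) (t :: nat \<Rightarrow> nat list list)
            (l :: nat \<Rightarrow> nat \<Rightarrow> nat list).
     (\<forall>i\<in>{1..n}. chain_cell (principal_chain d L) D \<iota> (M i) \<and> M i \<noteq> {}) \<and>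
     disjoint_family_on M {1..n} \<and>
     (\<Union>i\<in>{1..n}. M i) = principal_chain d L \<and>
     definable_table_fun S N n t \<and>
     (\<forall>i\<in>{1..n}. t i \<in> lex_fiber_type d L N ` principal_chain d L) \<and>
     definable_seq_fun S N n l \<and>
     (\<forall>j\<in>{1..n}. \<forall>i\<in>{1..j}. l i j \<in> gluing_seqs N) \<and>
     (\<forall>j\<in>{1..n}. \<forall>i\<in>{1..<j}. \<forall>x\<in>M i. \<forall>y\<in>M j. x \<sqsubset>\<^bsub>L\<^esub> y) \<and>
     (\<forall>i\<in>{1..n}. gluing_comp (l i i) (l i i) = l i i) \<and>
     (\<forall>i\<in>{1..n}. \<forall>x\<in>M i. lex_fiber_type d L N x = t i) \<and>
     (\<forall>j\<in>{1..n}. \<forall>i\<in>{1..j}. \<forall>x\<in>M i. \<forall>y\<in>M j.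
        x \<sqsubset>\<^bsub>L\<^esub> y \<longrightarrow> lex_gluing_type d L N x y = l i j)"
proof -
  interpret bounded_lattice L
    using assms(2) unfolding definable_bounded_distrib_lattice_def by blast
  interpret fibered_lattice S L d N
    by unfold_locales (use assms in \<open>auto simp: definable_bounded_distrib_lattice_def\<close>)
  interpret chain: definable_chain S d "carrier L" "principal_chain d L" chain_le
    by (rule definable_chain_C)
  interpret chain: completed_chain S d "carrier L" "principal_chain d L" chain_le m D \<iota>
  proof (rule completed_chain.intro[OF definable_chain_C completed_chain_axioms.intro])
    show "\<iota> x \<sqsubseteq>\<^bsub>D\<^esub> \<iota> y \<longleftrightarrow> chain_le x y"
      if "x \<in> principal_chain d L" "y \<in> principal_chain d L" for x y
      using completion that unfolding definable_completion_def chain_le_iff by blast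
  qed (use completion in \<open>auto simp: definable_completion_def\<close>)
  have less_iff: "x \<sqsubset>\<^bsub>L\<^esub> y \<longleftrightarrow> chain_le x y \<and> x \<noteq> y" if "x \<in> C" "y \<in> C" for x y
    using that by (auto simp: chain_le_iff lless_eq)
  let ?\<tau> = "lex_fiber_type d L N" and ?g = "lex_gluing_type d L N"
  obtain n :: nat and M :: "nat \<Rightarrow> 'a list set" where
    cell: "\<And>i. i \<in> {1..n} \<Longrightarrow> chain_cell C D \<iota> (M i) \<and> M i \<noteq> {}" and
    disj: "disjoint_family_on M {1..n}" and
    cover: "(\<Union>i\<in>{1..n}. M i) = C" and
    ord: "\<And>i j x y. i \<in> {1..n} \<Longrightarrow> j \<in> {1..n} \<Longrightarrow> i < j \<Longrightarrow> x \<in> M i \<Longrightarrow> y \<in> M j \<Longrightarrow>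
      chain_le x y \<and> x \<noteq> y" and
    \<tau>: "\<And>i x y. i \<in> {1..n} \<Longrightarrow> x \<in> M i \<Longrightarrow> y \<in> M i \<Longrightarrow> ?\<tau> x = ?\<tau> y" and
    g: "\<And>i j x y x' y'. i \<in> {1..n} \<Longrightarrow> j \<in> {1..n} \<Longrightarrow> i \<le> j \<Longrightarrow>
       x \<in> M i \<Longrightarrow> y \<in> M j \<Longrightarrow> chain_le x y \<Longrightarrow> x \<noteq> y \<Longrightarrow>
       x' \<in> M i \<Longrightarrow> y' \<in> M j \<Longrightarrow> chain_le x' y' \<Longrightarrow> x' \<noteq> y' \<Longrightarrow> ?g x y = ?g x' y'" and
    idem: "\<And>i x y. i \<in> {1..n} \<Longrightarrow> x \<in> M i \<Longrightarrow> y \<in> M i \<Longrightarrow> chain_le x y \<Longrightarrow> x \<noteq> y \<Longrightarrow>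
      gluing_comp (?g x y) (?g x y) = ?g x y"
  proof (rule chain.homogeneous_cells[of ?\<tau> "gluing_seqs N" ?g gluing_comp])
    show "finite (?\<tau> ` C)" by (rule finite_lex_fiber_types)
    show "definable S d {x \<in> C. ?\<tau> x = k}" for k by (rule definable_lex_fiber_type)
    show "finite (gluing_seqs N)" by (rule finite_gluing_seqs)
    show "?g x y \<in> gluing_seqs N" if "chain_le x y" for x y
      using lex_gluing_type_in_seqs that unfolding chain_le_iff by blast
    show "def_rel S d d (\<lambda>x y. chain_le x y \<and> x \<noteq> y \<and> ?g x y = e)" for e
      by (rule def_rel_lex_gluing_type)
    show "?g x z = gluing_comp (?g y z) (?g x y)" if "chain_le x y" "chain_le y z" for x y z
      using lex_gluing_type_comp that unfolding chain_le_iff by blast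
  qed (rule that; assumption)
  have sub: "M i \<subseteq> C" if "i \<in> {1..n}" for i using cover that by blast
  define r where "r i = (SOME x. x \<in> M i)" for i
  have r: "r i \<in> M i" if "i \<in> {1..n}" for i
    unfolding r_def using cell[OF that] by (simp add: some_in_eq)
  define t where "t i = ?\<tau> (r i)" for i
  define pair where "pair i j p \<longleftrightarrow> fst p \<in> M i \<and> snd p \<in> M j \<and> chain_le (fst p) (snd p) \<and> fst p \<noteq> snd p"
    for i j p
  \<comment> \<open>When a strict pair exists, any choice is good because \<open>g\<close> makes the
    gluing type constant on the pairs concerned. Otherwise, as for a one-point cell with
    \<open>i = j\<close>, the zero sequence is the default.\<close>
  define l where "l i j = (if \<exists>p. pair i j p
      then let p = SOME p. pair i j p in ?g (fst p) (snd p) else replicate N 0)" for i j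
  have l_pair: "\<exists>p. pair i j p \<and> l i j = ?g (fst p) (snd p)" if "\<exists>p. pair i j p" for i j
    using someI_ex[OF that] that unfolding l_def Let_def
    by (intro exI[of _ "SOME p. pair i j p"]) simp
  have l_none: "l i j = replicate N 0" if "\<not> (\<exists>p. pair i j p)" for i j
    using that unfolding l_def by simp
  have l_eq: "?g x y = l i j"
    if "i \<in> {1..n}" "j \<in> {1..n}" "i \<le> j" "x \<in> M i" "y \<in> M j" "x \<sqsubset>\<^bsub>L\<^esub> y" for i j x y
  proof -
    have xy: "chain_le x y" "x \<noteq> y" using that less_iff sub by blast+
    then have "pair i j (x, y)" using that unfolding pair_def by simp
    then obtain p where "pair i j p" "l i j = ?g (fst p) (snd p)" using l_pair by blast
    then show ?thesis
      using g[OF that(1-5) xy, of "fst p" "snd p"] unfolding pair_def by simp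
  qed
  have l_seqs: "l i j \<in> gluing_seqs N" for i j
  proof (cases "\<exists>p. pair i j p")
    case True
    then obtain p where "pair i j p" "l i j = ?g (fst p) (snd p)" using l_pair by blast
    then show ?thesis using lex_gluing_type_in_seqs unfolding pair_def chain_le_iff by auto
  next
    case False
    then show ?thesis by (auto simp: l_none gluing_seqs_def set_replicate_conv_if)
  qed
  have l_idem: "gluing_comp (l i i) (l i i) = l i i" if "i \<in> {1..n}" for i
  proof (cases "\<exists>p. pair i i p")
    case True
    then obtain p where "pair i i p" "l i i = ?g (fst p) (snd p)" using l_pair by blast
    then show ?thesis using idem[OF that] unfolding pair_def by simp
  next
    case False
    then show ?thesis by (simp add: l_none gluing_comp_zero)
  qed
  \<comment> \<open>Both graphs are finite sets of tuples of the right length, hence definable with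
    parameters.\<close>
  have "definable_table_fun S N n t"
    unfolding definable_table_fun_def
    by (rule finite_imp_definable) (auto simp: t_def length_lex_fiber_type_concat)
  moreover have "definable_seq_fun S N n l"
    unfolding definable_seq_fun_def
  proof (rule finite_imp_definable)
    have "{of_nat i # of_nat j # map of_nat (l i j) |i j. 1 \<le> i \<and> i \<le> j \<and> j \<le> n} \<subseteq>
        (\<lambda>(i, j). (of_nat i :: 'a) # of_nat j # map of_nat (l i j)) ` ({..n} \<times> {..n})"
      by force
    then show "finite {(of_nat i :: 'a) # of_nat j # map of_nat (l i j) |i j. 1 \<le> i \<and> i \<le> j \<and> j \<le> n}"
      by (rule finite_subset) simp
  qed (use l_seqs in \<open>auto simp: gluing_seqs_def\<close>)
  ultimately show ?thesis
  proof (intro exI[of _ n] exI[of _ M] exI[of _ t] exI[of _ l] conjI ballI impI)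
    show "chain_cell C D \<iota> (M i)" "M i \<noteq> {}" if "i \<in> {1..n}" for i using cell[OF that] by blast+
    show "t i \<in> ?\<tau> ` C" if "i \<in> {1..n}" for i using r[OF that] sub[OF that] unfolding t_def by blast
    show "?\<tau> x = t i" if "i \<in> {1..n}" "x \<in> M i" for i x
      unfolding t_def by (rule \<tau>[OF that r[OF that(1)]])
    show "x \<sqsubset>\<^bsub>L\<^esub> y" if "j \<in> {1..n}" "i \<in> {1..<j}" "x \<in> M i" "y \<in> M j" for i j x y
    proof -
      have "i \<in> {1..n}" "i < j" using that by auto
      then show ?thesis using ord[OF _ that(1) _ that(3,4)] less_iff sub that by blast
    qed
    show "?g x y = l i j" if "j \<in> {1..n}" "i \<in> {1..j}" "x \<in> M i" "y \<in> M j" "x \<sqsubset>\<^bsub>L\<^esub> y" for i j x y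
      by (rule l_eq) (use that in auto)
  qed (use disj cover l_seqs l_idem in auto)
qed

end
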